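(* For each integer $d\ge 1$ let $\alpha_d\in\mathbb{R}$ and let $\mu_{\alpha_d}$ be the Borel measure on $\mathbb{R}^d$ given by $d\mu_{\alpha_d}(x)=\|x\|_2^{-\alpha_d}\,dx$. Let $M_{\mu_{\alpha_d}}$ be the centered Hardy–Littlewood maximal operator associated to $\mu_{\alpha_d}$ and euclidean balls, acting on radial functions, and for $1\le p<\infty$ let $c_{p,d}$ denote the best constant in the weak type $(p,p)$ inequality $$\sup_{\lambda>0}\lambda\,\mu_{\alpha_d}(\{M_{\mu_{\alpha_d}} f>\lambda\})^{1/p}\le c_{p,d}\|f\|_{L^p(\mu_{\alpha_d})}$$ over all radial $f\in L^p(\mu_{\alpha_d})$ on $\mathbb{R}^d$; similarly let $C_{p,d}$ denote the best constant in the strong type $(p,p)$ inequality $\|M_{\mu_{\alpha_d}}f\|_{L^p(\mu_{\alpha_d})}\le C_{p,d}\|f\|_{L^p(\mu_{\alpha_d})}$ over radial $f$. Then: 1) If $\alpha$ is a fixed constant with $1/2<\alpha<1$ and $\alpha_d=\alpha d$ for all $d$, then for every $p\in[1,\infty)$ there exists $b=b(p)>1$ such that $c_{p,d}\ge \Theta(b^d)$; that is, the weak type $(p,p)$ constants grow exponentially in $d$ for all $p<\infty$. 2) If $\alpha_d\le d/2$, then $c_{1,d}\ge \Theta\big((5^{1/2}/2)^{\alpha_d}\big)$. In particular, if $\alpha_d\le d/2$ for all $d$ and $\limsup_d\alpha_d=\infty$, then $\limsup_d c_{1,d}=\infty$. 3) If $\sup_d\alpha_d\le\alpha<\infty$,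 then there exists $C=C(\alpha)$ such that $c_{1,d}\le C$ for every $d\ge 1$; consequently (by interpolation) for each $1<p<\infty$ the strong type constants $C_{p,d}$ are bounded uniformly in $d$.
   Context: A function $f:\mathbb{R}^d\to\mathbb{R}$ is radial if there is $f_0:(0,\infty)\to\mathbb{R}$ with $f(x)=f_0(\|x\|_2)$ for all $x\neq0$, where $\|x\|_2$ is the euclidean norm. For a Borel measure $\mu$ on $\mathbb{R}^d$ (possibly assigning infinite measure to some balls) and locally integrable $g$, the centered maximal operator is $M_\mu g(x)=\sup_{\{r>0:\,0<\mu(B(x,r))\}}\frac{1}{\mu(B(x,r))}\int_{B(x,r)}|g|\,d\mu$, where $B(x,r)$ is the closed euclidean ball of center $x$ and radius $r$, with the convention $\infty/\infty=\infty\cdot 0=0$. $\Theta$ denotes exact order of growth (up to multiplicative constants independent of $d$). *)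

theory Defs
  imports "HOL-Analysis.Analysis" "HOL-Probability.Probability"
begin

text \<open>R^d is modelled as the product measure space of functions nat => real
  (extensional on the index set {..<d}) with Lebesgue-Borel measure.\<close>

definition Rd :: "nat \<Rightarrow> (nat \<Rightarrow> real) measure" where
  "Rd d = PiM {..<d} (\<lambda>_. lborel)"

definition enorm :: "nat \<Rightarrow> (nat \<Rightarrow> real) \<Rightarrow> real" where
  "enorm d x = sqrt (\<Sum>i<d. (x i)\<^sup>2)"

definition eball :: "nat \<Rightarrow> (nat \<Rightarrow> real) \<Rightarrow> real \<Rightarrow> (nat \<Rightarrow> real) set" where
  "eball d x r = {y \<in> space (Rd d). sqrt (\<Sum>i<d. (y i - x i)\<^sup>2) \<le> r}"

definition mu :: "real \<Rightarrow> nat \<Rightarrow> (nat \<Rightarrow> real) measure" where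
  "mu a d = density (Rd d) (\<lambda>x. ennreal (enorm d x powr (- a)))"

text \<open>Real powers of extended nonnegative reals (for exponents q > 0).\<close>
definition ennpow :: "ennreal \<Rightarrow> real \<Rightarrow> ennreal" where
  "ennpow x q = (if x = \<infinity> then \<infinity> else ennreal (enn2real x powr q))"

text \<open>Centered maximal operator; ennreal arithmetic gives the conventions
  inf/inf = inf*0 = 0, and Sup of the empty set is 0.\<close>
definition maxop :: "(nat \<Rightarrow> real) measure \<Rightarrow> nat \<Rightarrow> ((nat \<Rightarrow> real) \<Rightarrow> real)
    \<Rightarrow> (nat \<Rightarrow> real) \<Rightarrow> ennreal" where
  "maxop M d g x = (SUP r \<in> {r. 0 < r \<and> 0 < emeasure M (eball d x r)}.
      (\<integral>\<^sup>+ y \<in> eball d x r. ennreal \<bar>g y\<bar> \<partial>M) / emeasure M (eball d x r))"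

definition radial :: "nat \<Rightarrow> ((nat \<Rightarrow> real) \<Rightarrow> real) \<Rightarrow> bool" where
  "radial d f \<longleftrightarrow> (\<exists>f0 :: real \<Rightarrow> real. \<forall>x \<in> space (Rd d). enorm d x \<noteq> 0 \<longrightarrow> f x = f0 (enorm d x))"

definition lpnorm :: "(nat \<Rightarrow> real) measure \<Rightarrow> real \<Rightarrow> ((nat \<Rightarrow> real) \<Rightarrow> ennreal) \<Rightarrow> ennreal" where
  "lpnorm M p g = ennpow (\<integral>\<^sup>+ x. ennpow (g x) p \<partial>M) (1 / p)"

definition radial_Lp :: "real \<Rightarrow> real \<Rightarrow> nat \<Rightarrow> ((nat \<Rightarrow> real) \<Rightarrow> real) set" where
  "radial_Lp p a d = {f. f \<in> borel_measurable (Rd d) \<and> radial d f \<and>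
      lpnorm (mu a d) p (\<lambda>x. ennreal \<bar>f x\<bar>) < \<infinity>}"

definition weak_const :: "real \<Rightarrow> real \<Rightarrow> nat \<Rightarrow> ennreal" where
  "weak_const p a d = Inf {ennreal c | c. 0 \<le> c \<and>
     (\<forall>f \<in> radial_Lp p a d. \<forall>t>0.
        ennreal t * ennpow (emeasure (mu a d) {x \<in> space (Rd d). ennreal t < maxop (mu a d) d f x}) (1 / p)
        \<le> ennreal c * lpnorm (mu a d) p (\<lambda>x. ennreal \<bar>f x\<bar>))}"

definition strong_const :: "real \<Rightarrow> real \<Rightarrow> nat \<Rightarrow> ennreal" where
  "strong_const p a d = Inf {ennreal c | c. 0 \<le> c \<and>
     (\<forall>f \<in> radial_Lp p a d.
        lpnorm (mu a d) p (maxop (mu a d) d f)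
        \<le> ennreal c * lpnorm (mu a d) p (\<lambda>x. ennreal \<bar>f x\<bar>))}"

end

theory Submission
  imports Defs
begin

text \<open>The lower bounds test the operator on indicators of balls \<open>B(0, R)\<close>. For \<open>\<bar>x\<bar> = 1\<close>, the part of \<open>B(x, r)\<close>
  inside a sphere around the origin lies in a ball of smaller radius centred on the segment from \<open>0\<close> to \<open>x\<close>, so all
  masses are compared through volumes of balls. For \<open>\<alpha>\<^sub>d \<le> d/2\<close> this makes \<open>\<mu>(B(x, 1))\<close> smaller than
  \<open>\<mu>(B(0, 1))\<close> by a factor of order \<open>(2/\<surd>5)\<close> to the power \<open>\<alpha>\<^sub>d\<close>, and one lets \<open>R\<close> tend to \<open>0\<close>. For \<open>\<alpha> > 1/2\<close>
  and \<open>r\<close> small, \<open>B(x, r)\<close> has a nonnegligible fraction of its mass in some \<open>B(0, R)\<close> with \<open>R < 1\<close>, while \<open>\<mu>(B(0, 1))\<close> is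
  exponentially larger than \<open>\<mu>(B(0, R))\<close>.

  For the upper bounds, rays from the origin meet \<open>B(x, r)\<close> in segments. Prolonging each nonempty segment up to the norm
  \<open>\<bar>x\<bar>\<close> enlarges the mass of the ball by at most a constant depending on the upper bound of the \<open>\<alpha>\<^sub>d\<close>, so the maximal
  function of a radial function is dominated by the one-dimensional maximal function of its profile over
  intervals containing \<open>\<bar>x\<bar>\<close>. The latter is of weak type \<open>(1,1)\<close> for every measure on the line.\<close>

section \<open>Lebesgue measure\<close>

text \<open>The threshold 1/2 is the sign of a derivative. For a small ball about \<open>u\<close>,
  \<open>|u| = 1\<close>, the squared radius of the lens cut out by \<open>B(0, s)\<close> has
  logarithmic derivative about 1/2 in \<open>s^2\<close> at \<open>s = 1\<close>, while the squared
  weight contributes \<open>-\<alpha>\<close>; so the mass prefers norms below 1 exactly if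
  \<open>\<alpha> > 1/2\<close>. The upper bounds face two obstacles. The exponents have no lower
  bound, so the weight may grow arbitrarily fast; and \<open>a \<ge> d\<close> is allowed in low
  dimensions, where the mass near the origin is infinite. For \<open>a \<le> 0\<close> the part
  added by the hull lies where the weight is at most its value at \<open>x\<close>, and is paid for
  by the half of the ball beyond the tangent hyperplane. For \<open>a > 0\<close> volumes are
  compared, except near the origin in dimensions below \<open>2 * \<alpha>\<close>: there a cone of
  directions is used, whose loss is exponential in \<open>d\<close> but bounded in terms of
  \<alpha>. Prolonging the segments gives intervals that all contain \<open>|x|\<close>, so one
  value of the one-dimensional maximal function serves all directions.\<close>

abbreviation ball0 :: "nat \<Rightarrow> real \<Rightarrow> (nat \<Rightarrow> real) set" where
  "ball0 d r \<equiv> eball d (\<lambda>_. 0) r"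

definition ip :: "nat \<Rightarrow> (nat \<Rightarrow> real) \<Rightarrow> (nat \<Rightarrow> real) \<Rightarrow> real" where
  "ip d x y = (\<Sum>i<d. x i * y i)"

text \<open>The restriction keeps the value extensional, hence a point of the product space. A zero
  translation gives dilations, \<open>c = -1\<close> a point reflection.\<close>

definition aff :: "nat \<Rightarrow> (nat \<Rightarrow> real) \<Rightarrow> real \<Rightarrow> (nat \<Rightarrow> real) \<Rightarrow> nat \<Rightarrow> real" where
  "aff d t c y = (\<lambda>i\<in>{..<d}. t i + c * y i)"

definition vol :: "nat \<Rightarrow> real" where
  "vol d = measure (Rd d) (ball0 d 1)"

lemma space_Rd: "space (Rd d) = extensional {..<d}"
  by (simp add: Rd_def space_PiM PiE_def)

lemma component_measurable [measurable]: "i < d \<Longrightarrow> (\<lambda>x. x i) \<in> borel_measurable (Rd d)"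
  unfolding Rd_def using measurable_component_singleton[of i "{..<d}" "\<lambda>_. lborel"] by simp

lemma ip_measurable [measurable]: "ip d x \<in> borel_measurable (Rd d)"
  unfolding ip_def by measurable

lemma enorm_measurable [measurable]: "enorm d \<in> borel_measurable (Rd d)"
  unfolding enorm_def by measurable

lemma eball_sets [measurable]: "eball d x r \<in> sets (Rd d)"
  unfolding eball_def by measurable

lemma aff_measurable [measurable]: "aff d t c \<in> Rd d \<rightarrow>\<^sub>M Rd d"
proof -
  have "(\<lambda>y. \<lambda>i\<in>{..<d}. t i + c * y i) \<in> Rd d \<rightarrow>\<^sub>M PiM {..<d} (\<lambda>_. lborel)"
  proof (rule measurable_restrict)
    fix i assume "i \<in> {..<d}"
    then have "i < d" by simp
    note [measurable] = component_measurable[OF this]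
    show "(\<lambda>y. t i + c * y i) \<in> Rd d \<rightarrow>\<^sub>M lborel"
      by simp
  qed
  then show ?thesis by (simp add: aff_def[abs_def] Rd_def)
qed

lemma aff_space [simp]: "aff d t c y \<in> space (Rd d)"
  by (simp add: aff_def space_Rd)

section \<open>Affine changes of variables\<close>

interpretation lborel_product: product_sigma_finite "\<lambda>_::nat. lborel :: real measure"
  by standard

lemma sigma_finite_Rd: "sigma_finite_measure (Rd d)"
  unfolding Rd_def by (rule lborel_product.sigma_finite) simp

text \<open>The product measure is determined by its values on boxes, and on a box the claim factors
  into one-dimensional affine changes of variables.\<close>

lemma Rd_affine:
  assumes c: "c \<noteq> 0"
  shows "Rd d = density (distr (Rd d) (Rd d) (aff d t c)) (\<lambda>_. ennreal (\<bar>c\<bar> ^ d))"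
proof -
  have "density (distr (Rd d) (Rd d) (aff d t c)) (\<lambda>_. ennreal (\<bar>c\<bar> ^ d)) = PiM {..<d} (\<lambda>_. lborel)"
  proof (rule lborel_product.PiM_eqI)
    show "finite {..<d}" by simp
    show "sets (density (distr (Rd d) (Rd d) (aff d t c)) (\<lambda>_. ennreal (\<bar>c\<bar> ^ d)))
        = sets (PiM {..<d} (\<lambda>_. lborel :: real measure))"
      by (simp add: Rd_def)
    fix A :: "nat \<Rightarrow> real set" assume A: "\<And>i. i \<in> {..<d} \<Longrightarrow> A i \<in> sets lborel"
    have PA[measurable]: "Pi\<^sub>E {..<d} A \<in> sets (Rd d)"
      unfolding Rd_def using A by (intro sets_PiM_I_finite) auto
    have pre: "aff d t c -` Pi\<^sub>E {..<d} A \<inter> space (Rd d) = Pi\<^sub>E {..<d} (\<lambda>i. (\<lambda>x. t i + c * x) -` A i)"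
      by (auto simp: aff_def space_Rd PiE_def Pi_def)
    have one: "ennreal \<bar>c\<bar> * emeasure lborel ((\<lambda>x. t i + c * x) -` A i) = emeasure lborel (A i)"
      if i: "i \<in> {..<d}" for i
    proof -
      have [measurable]: "A i \<in> sets borel" using A[OF i] by simp
      have "emeasure lborel (A i) = emeasure (density (distr lborel borel (\<lambda>x. t i + c * x)) (\<lambda>_. ennreal (abs c))) (A i)"
        using lborel_real_affine[OF c, of "t i"] by simp
      also have "\<dots> = ennreal \<bar>c\<bar> * emeasure lborel ((\<lambda>x. t i + c * x) -` A i)"
        by (subst emeasure_density_const) (auto simp: emeasure_distr)
      finally show ?thesis ..
    qed
    have "emeasure (density (distr (Rd d) (Rd d) (aff d t c)) (\<lambda>_. ennreal (\<bar>c\<bar> ^ d))) (Pi\<^sub>E {..<d} A)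
       = ennreal (\<bar>c\<bar> ^ d) * emeasure (Rd d) (Pi\<^sub>E {..<d} (\<lambda>i. (\<lambda>x. t i + c * x) -` A i))"
      by (subst emeasure_density_const) (auto simp: emeasure_distr pre)
    also have "emeasure (Rd d) (Pi\<^sub>E {..<d} (\<lambda>i. (\<lambda>x. t i + c * x) -` A i))
       = (\<Prod>i<d. emeasure lborel ((\<lambda>x. t i + c * x) -` A i))"
      unfolding Rd_def
    proof (rule lborel_product.emeasure_PiM)
      fix i assume "i \<in> {..<d}"
      then have [measurable]: "A i \<in> sets borel" using A by simp
      have "(\<lambda>x. t i + c * x) -` A i \<inter> space borel \<in> sets borel" by measurable
      then show "(\<lambda>x. t i + c * x) -` A i \<in> sets lborel" by simp
    qed simp
    also have "ennreal (\<bar>c\<bar> ^ d) * \<dots> = (\<Prod>i<d. ennreal \<bar>c\<bar> * emeasure lborel ((\<lambda>x. t i + c * x) -` A i))"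
      by (simp add: prod.distrib ennreal_power)
    also have "\<dots> = (\<Prod>i<d. emeasure lborel (A i))"
      by (intro prod.cong refl one)
    finally show "emeasure (density (distr (Rd d) (Rd d) (aff d t c)) (\<lambda>_. ennreal (\<bar>c\<bar> ^ d))) (Pi\<^sub>E {..<d} A)
       = (\<Prod>i\<in>{..<d}. emeasure lborel (A i))" .
  qed
  then show ?thesis by (simp add: Rd_def)
qed

lemma nn_integral_Rd_affine:
  assumes "c \<noteq> 0" and [measurable]: "h \<in> borel_measurable (Rd d)"
  shows "(\<integral>\<^sup>+y. h y \<partial>Rd d) = ennreal (\<bar>c\<bar> ^ d) * (\<integral>\<^sup>+y. h (aff d t c y) \<partial>Rd d)"
proof -
  have "(\<integral>\<^sup>+y. h y \<partial>Rd d)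
      = (\<integral>\<^sup>+y. h y \<partial>density (distr (Rd d) (Rd d) (aff d t c)) (\<lambda>_. ennreal (\<bar>c\<bar> ^ d)))"
    using Rd_affine[OF assms(1), of d t] by simp
  then show ?thesis
    by (simp add: nn_integral_density nn_integral_distr nn_integral_cmult)
qed

lemma emeasure_Rd_affine:
  assumes "c \<noteq> 0" and [measurable]: "A \<in> sets (Rd d)"
  shows "emeasure (Rd d) A = ennreal (\<bar>c\<bar> ^ d) * emeasure (Rd d) {y \<in> space (Rd d). aff d t c y \<in> A}"
proof -
  have "emeasure (Rd d) A = (\<integral>\<^sup>+y. indicator A y \<partial>Rd d)" by simp
  also have "\<dots> = ennreal (\<bar>c\<bar> ^ d) * (\<integral>\<^sup>+y. indicator A (aff d t c y) \<partial>Rd d)"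
    by (rule nn_integral_Rd_affine) (use assms in auto)
  also have "(\<integral>\<^sup>+y. indicator A (aff d t c y) \<partial>Rd d)
      = (\<integral>\<^sup>+y. indicator {y \<in> space (Rd d). aff d t c y \<in> A} y \<partial>Rd d)"
    by (intro nn_integral_cong) (auto split: split_indicator)
  finally show ?thesis by simp
qed

section \<open>Norms, inner products and volumes of balls\<close>

lemma enorm_nonneg [simp]: "0 \<le> enorm d x"
  by (simp add: enorm_def sum_nonneg)

lemma enorm_sq: "(enorm d x)\<^sup>2 = (\<Sum>i<d. (x i)\<^sup>2)"
  by (simp add: enorm_def sum_nonneg)

lemma dist_expand:
  "(\<Sum>i<d. (y i - k * x i)\<^sup>2) = (enorm d y)\<^sup>2 - 2 * k * ip d x y + k\<^sup>2 * (enorm d x)\<^sup>2"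
proof -
  have "(\<Sum>i<d. (y i - k * x i)\<^sup>2) = (\<Sum>i<d. (y i)\<^sup>2 - 2 * k * (x i * y i) + k\<^sup>2 * (x i)\<^sup>2)"
    by (intro sum.cong) (auto simp: power2_eq_square algebra_simps)
  then show ?thesis
    by (simp add: sum.distrib sum_subtractf sum_distrib_left enorm_sq ip_def)
qed

text \<open>Squared form, in terms of \<open>|y|^2\<close> and the inner product only: inclusions
  between balls centred on one line become polynomial inequalities in these two quantities.\<close>

lemma mem_eball_scaled:
  assumes "0 \<le> r"
  shows "y \<in> eball d (\<lambda>i. k * x i) r \<longleftrightarrow> y \<in> space (Rd d) \<and>
      (enorm d y)\<^sup>2 - 2 * k * ip d x y + k\<^sup>2 * (enorm d x)\<^sup>2 \<le> r\<^sup>2"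
  unfolding eball_def mem_Collect_eq dist_expand[symmetric]
  using real_sqrt_le_iff[of "\<Sum>i<d. (y i - k * x i)\<^sup>2" "r\<^sup>2"] assms by simp

lemma mem_eball:
  assumes "0 \<le> r"
  shows "y \<in> eball d x r \<longleftrightarrow> y \<in> space (Rd d) \<and>
      (enorm d y)\<^sup>2 - 2 * ip d x y + (enorm d x)\<^sup>2 \<le> r\<^sup>2"
  using mem_eball_scaled[OF assms, of y d 1 x] by simp

lemma eball_0: "ball0 d r = {y \<in> space (Rd d). enorm d y \<le> r}"
  by (simp add: eball_def enorm_def)

lemma ip_abs_le: "\<bar>ip d x y\<bar> \<le> enorm d x * enorm d y"
proof -
  have "\<bar>ip d x y\<bar> \<le> (\<Sum>i<d. \<bar>x i\<bar> * \<bar>y i\<bar>)"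
    unfolding ip_def by (rule order_trans[OF sum_abs]) (simp add: abs_mult)
  also have "\<dots> \<le> L2_set x {..<d} * L2_set y {..<d}"
    by (rule L2_set_mult_ineq)
  finally show ?thesis by (simp add: L2_set_def enorm_def)
qed

lemma ip_le: "ip d x y \<le> enorm d x * enorm d y"
  using ip_abs_le[of d x y] by linarith

lemma enorm_scale: "enorm d (\<lambda>i. c * x i) = \<bar>c\<bar> * enorm d x"
  unfolding enorm_def
  by (simp add: power_mult_distrib sum_distrib_left[symmetric] real_sqrt_mult)

lemma enorm_aff0: "enorm d (aff d (\<lambda>_. 0) c x) = \<bar>c\<bar> * enorm d x"
proof -
  have "enorm d (aff d (\<lambda>_. 0) c x) = enorm d (\<lambda>i. c * x i)"
    unfolding enorm_def aff_def by simp
  then show ?thesis by (simp add: enorm_scale)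
qed

lemma ip_aff0: "ip d x (aff d (\<lambda>_. 0) c y) = c * ip d x y"
  unfolding ip_def aff_def by (simp add: sum_distrib_left mult.left_commute)

lemma aff_eball:
  assumes "0 < c"
  shows "{y \<in> space (Rd d). aff d x c y \<in> eball d x (c * r)} = ball0 d r"
proof -
  have "(\<Sum>i<d. (aff d x c y i - x i)\<^sup>2) = (\<Sum>i<d. (c * y i)\<^sup>2)" for y
    unfolding aff_def by (intro sum.cong) auto
  then have "sqrt (\<Sum>i<d. (aff d x c y i - x i)\<^sup>2) = c * sqrt (\<Sum>i<d. (y i)\<^sup>2)" for y
    using assms by (simp add: power_mult_distrib sum_distrib_left[symmetric] real_sqrt_mult)
  then show ?thesis
    using assms by (auto simp: eball_def)
qed

lemma emeasure_unit_ball_finite: "emeasure (Rd d) (ball0 d 1) < \<infinity>"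
proof -
  have "ball0 d 1 \<subseteq> Pi\<^sub>E {..<d} (\<lambda>_. {-1..1})"
  proof
    fix y assume y: "y \<in> ball0 d 1"
    have "\<bar>y i\<bar> \<le> 1" if "i < d" for i
    proof -
      have "(y i)\<^sup>2 \<le> (\<Sum>i<d. (y i)\<^sup>2)"
        using that by (intro member_le_sum) auto
      also have "\<dots> \<le> 1" using y by (simp add: eball_def)
      finally show ?thesis by (simp add: abs_square_le_1)
    qed
    then have "-1 \<le> y i \<and> y i \<le> 1" if "i < d" for i
      using that abs_le_iff[of "y i" 1] by force
    then show "y \<in> Pi\<^sub>E {..<d} (\<lambda>_. {-1..1})"
      using y by (auto simp: eball_def space_Rd PiE_def)
  qed
  then have "emeasure (Rd d) (ball0 d 1) \<le> emeasure (Rd d) (Pi\<^sub>E {..<d} (\<lambda>_. {-1..1}))"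
    by (intro emeasure_mono) (auto simp: Rd_def intro!: sets_PiM_I_finite)
  also have "\<dots> = (\<Prod>i<d. emeasure lborel {-1..1::real})"
    unfolding Rd_def by (intro lborel_product.emeasure_PiM) auto
  also have "\<dots> = ennreal (2 ^ d)" using ennreal_power[of 2 d] by simp
  also have "\<dots> < \<infinity>" by simp
  finally show ?thesis .
qed

lemma emeasure_unit_ball_pos: "0 < emeasure (Rd d) (ball0 d 1)"
proof -
  \<comment> \<open>Since \<open>s \<le> 1\<close> gives \<open>s^2 \<le> s\<close>, the bound
    \<open>d * s \<le> 1\<close> puts the cube of side \<open>2 * s\<close> into the unit ball; the
    \<open>+ 1\<close> covers \<open>d = 0\<close>.\<close>
  define s where "s = 1 / (real d + 1)"
  have s0: "0 < s" unfolding s_def by (intro divide_pos_pos) auto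
  have s1: "s * (real d + 1) = 1" unfolding s_def by simp
  have s2: "s * real d + s = 1" using s1 by (simp add: distrib_left)
  have s: "0 < s" "s * real d \<le> 1" "s \<le> 1"
    using s0 s2 mult_nonneg_nonneg[of s "real d"] by linarith+
  have "Pi\<^sub>E {..<d} (\<lambda>_. {-s..s}) \<subseteq> ball0 d 1"
  proof
    fix y assume y: "y \<in> Pi\<^sub>E {..<d} (\<lambda>_. {-s..s})"
    have "(\<Sum>i<d. (y i)\<^sup>2) \<le> (\<Sum>i<d. s)"
    proof (rule sum_mono)
      fix i assume "i \<in> {..<d}"
      then have "y i \<in> {-s..s}" using PiE_mem[OF y] by blast
      then have "\<bar>y i\<bar> \<le> s" by auto
      then have "(y i)\<^sup>2 \<le> s\<^sup>2" using s0 by (intro abs_le_square_iff[THEN iffD1]) simp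
      also have "\<dots> \<le> s" using s mult_left_le[of s s] by (simp add: power2_eq_square)
      finally show "(y i)\<^sup>2 \<le> s" .
    qed
    also have "\<dots> = s * real d" by simp
    also have "\<dots> \<le> 1" by (rule s)
    finally show "y \<in> ball0 d 1"
      using y by (auto simp: eball_def space_Rd PiE_def)
  qed
  then have "emeasure (Rd d) (Pi\<^sub>E {..<d} (\<lambda>_. {-s..s})) \<le> emeasure (Rd d) (ball0 d 1)"
    by (intro emeasure_mono) auto
  moreover have "emeasure (Rd d) (Pi\<^sub>E {..<d} (\<lambda>_. {-s..s})) = (\<Prod>i<d. emeasure lborel {-s..s})"
    unfolding Rd_def by (intro lborel_product.emeasure_PiM) auto
  moreover have "0 < (\<Prod>i<d. emeasure lborel {-s..s})"
    using s0 by (simp add: ennreal_power)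
  ultimately show ?thesis by simp
qed

lemma vol_pos: "0 < vol d"
  unfolding vol_def measure_def
  using emeasure_unit_ball_finite[of d] emeasure_unit_ball_pos[of d] by (simp add: enn2real_positive_iff)

lemma emeasure_eball:
  assumes "0 < r"
  shows "emeasure (Rd d) (eball d x r) = ennreal (vol d * r ^ d)"
proof -
  have "emeasure (Rd d) (eball d x r) = ennreal (\<bar>r\<bar> ^ d) * emeasure (Rd d) (ball0 d 1)"
    using emeasure_Rd_affine[of r "eball d x (r * 1)" d x] aff_eball[OF assms, of d x 1] assms by simp
  also have "emeasure (Rd d) (ball0 d 1) = ennreal (vol d)"
    unfolding vol_def using emeasure_unit_ball_finite[of d] by (intro emeasure_eq_ennreal_measure) auto
  finally show ?thesis
    using assms by (simp add: ennreal_mult'[symmetric] mult.commute vol_pos less_imp_le)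
qed

section \<open>The power weights\<close>

lemma sets_mu [simp, measurable_cong]: "sets (mu a d) = sets (Rd d)"
  by (simp add: mu_def)

lemma space_mu [simp]: "space (mu a d) = space (Rd d)"
  by (simp add: mu_def)

lemma nn_integral_mu:
  assumes "h \<in> borel_measurable (Rd d)"
  shows "(\<integral>\<^sup>+y. h y \<partial>mu a d) = (\<integral>\<^sup>+y. ennreal (enorm d y powr (- a)) * h y \<partial>Rd d)"
  unfolding mu_def using assms by (intro nn_integral_density) measurable

lemma emeasure_mu:
  assumes "A \<in> sets (Rd d)"
  shows "emeasure (mu a d) A = (\<integral>\<^sup>+y. ennreal (enorm d y powr (- a)) * indicator A y \<partial>Rd d)"
  unfolding mu_def using assms by (intro emeasure_density) measurable

lemma mu_le:
  assumes [measurable]: "A \<in> sets (Rd d)" and k: "\<And>y. y \<in> A \<Longrightarrow> enorm d y powr (- a) \<le> k"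
  shows "emeasure (mu a d) A \<le> ennreal k * emeasure (Rd d) A"
proof -
  have "emeasure (mu a d) A \<le> (\<integral>\<^sup>+y. ennreal k * indicator A y \<partial>Rd d)"
    unfolding emeasure_mu[OF assms(1)]
    by (intro nn_integral_mono) (auto split: split_indicator intro!: ennreal_leI k)
  then show ?thesis by (simp add: nn_integral_cmult)
qed

lemma mu_ge:
  assumes [measurable]: "A \<in> sets (Rd d)" and k: "\<And>y. y \<in> A \<Longrightarrow> k \<le> enorm d y powr (- a)"
  shows "ennreal k * emeasure (Rd d) A \<le> emeasure (mu a d) A"
proof -
  have "(\<integral>\<^sup>+y. ennreal k * indicator A y \<partial>Rd d) \<le> emeasure (mu a d) A"
    unfolding emeasure_mu[OF assms(1)]
    by (intro nn_integral_mono) (auto split: split_indicator intro!: ennreal_leI k)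
  then show ?thesis by (simp add: nn_integral_cmult)
qed

text \<open>Lebesgue measure scales by \<open>c^d\<close> and the weight is homogeneous of degree
  \<open>-a\<close>. This reduces estimates to centres of norm 1.\<close>

lemma mu_scale:
  assumes c: "0 < c" and [measurable]: "A \<in> sets (Rd d)"
  shows "emeasure (mu a d) A = ennreal (c powr (real d - a)) *
      emeasure (mu a d) {y \<in> space (Rd d). aff d (\<lambda>_. 0) c y \<in> A}"
proof -
  let ?B = "{y \<in> space (Rd d). aff d (\<lambda>_. 0) c y \<in> A}"
  have [measurable]: "?B \<in> sets (Rd d)" by measurable
  have "emeasure (mu a d) A = ennreal (\<bar>c\<bar> ^ d) *
     (\<integral>\<^sup>+y. ennreal (enorm d (aff d (\<lambda>_. 0) c y) powr (- a)) * indicator A (aff d (\<lambda>_. 0) c y) \<partial>Rd d)"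
    unfolding emeasure_mu[OF assms(2)] by (rule nn_integral_Rd_affine) (use c in auto)
  also have "(\<integral>\<^sup>+y. ennreal (enorm d (aff d (\<lambda>_. 0) c y) powr (- a)) * indicator A (aff d (\<lambda>_. 0) c y) \<partial>Rd d)
     = (\<integral>\<^sup>+y. ennreal (c powr (- a)) * (ennreal (enorm d y powr (- a)) * indicator ?B y) \<partial>Rd d)"
    using c by (intro nn_integral_cong)
      (auto simp: enorm_aff0 powr_mult ennreal_mult' split: split_indicator)
  also have "\<dots> = ennreal (c powr (- a)) * emeasure (mu a d) ?B"
    by (simp add: nn_integral_cmult emeasure_mu)
  also have "ennreal (\<bar>c\<bar> ^ d) * (ennreal (c powr (- a)) * emeasure (mu a d) ?B)
     = ennreal (c powr (real d - a)) * emeasure (mu a d) ?B"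
    using c by (simp add: powr_diff powr_minus powr_realpow ennreal_mult'[symmetric] mult.assoc[symmetric] divide_inverse)
  finally show ?thesis .
qed

text \<open>The convention \<open>0 powr b = 0\<close> makes the density vanish at the origin, for
  every exponent and dimension.\<close>

lemma mu_origin: "emeasure (mu a d) {y \<in> space (Rd d). enorm d y = 0} = 0"
proof -
  have [measurable]: "{y \<in> space (Rd d). enorm d y = 0} \<in> sets (Rd d)" by measurable
  have "emeasure (mu a d) {y \<in> space (Rd d). enorm d y = 0} = (\<integral>\<^sup>+y. 0 \<partial>Rd d)"
    unfolding emeasure_mu[OF \<open>_ \<in> sets _\<close>]
    by (intro nn_integral_cong) (auto split: split_indicator)
  then show ?thesis by simp
qed

lemma AE_mu_nonzero: "AE y in mu a d. enorm d y \<noteq> 0"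
  by (rule AE_I[OF _ mu_origin]) auto

text \<open>The origin lies in balls of arbitrarily small volume. In dimension 0 it is the whole
  space, of mass 1.\<close>

lemma Rd_origin:
  assumes "1 \<le> d"
  shows "emeasure (Rd d) {y \<in> space (Rd d). enorm d y = 0} = 0"
proof -
  have "emeasure (Rd d) {y \<in> space (Rd d). enorm d y = 0} \<le> 0 + ennreal e" if e: "0 < e" for e :: real
  proof -
    define r where "r = min 1 (e / vol d)"
    have r: "0 < r" "r \<le> 1" "r \<le> e / vol d" using e vol_pos[of d] by (auto simp: r_def)
    have "r ^ d \<le> r" using assms r power_decreasing[of 1 d r] by simp
    then have "vol d * r ^ d \<le> vol d * (e / vol d)"
      using vol_pos[of d] r by (intro mult_left_mono) auto
    then have le: "vol d * r ^ d \<le> e" using vol_pos[of d] by simp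
    have "emeasure (Rd d) {y \<in> space (Rd d). enorm d y = 0} \<le> emeasure (Rd d) (ball0 d r)"
      using r by (intro emeasure_mono) (auto simp: eball_0)
    also have "\<dots> \<le> ennreal e"
      using le r by (simp add: emeasure_eball ennreal_leI)
    finally show ?thesis by simp
  qed
  then have "emeasure (Rd d) {y \<in> space (Rd d). enorm d y = 0} \<le> 0"
    by (rule ennreal_le_epsilon)
  then show ?thesis by simp
qed

section \<open>Distribution of the norm\<close>

lemma borel_measure_eqI_atMost:
  fixes M N :: "real measure"
  assumes sets: "sets M = sets borel" "sets N = sets borel"
    and eq: "\<And>t. emeasure M {..t} = emeasure N {..t}" and fin: "\<And>t. emeasure M {..t} < \<infinity>"
  shows "M = N"
proof (rule measure_eqI_generator_eq[where E="range atMost" and \<Omega>=UNIV and A="\<lambda>i. {..real i}"])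
  show "Int_stable (range (atMost :: real \<Rightarrow> _))"
    by (auto simp: Int_stable_def)
  show "(\<Union>i. {..real i}) = (UNIV :: real set)"
    by (auto intro: real_arch_simple)
  show "sets M = sigma_sets UNIV (range atMost)" "sets N = sigma_sets UNIV (range atMost)"
    unfolding sets by (subst borel_eq_atMost, simp)+
qed (use eq fin in \<open>auto simp: less_top\<close>)

lemma nn_integral_powr_from_0:
  fixes e c :: real
  assumes "-1 < e" "0 \<le> c"
  shows "(\<integral>\<^sup>+s. ennreal (s powr e) * indicator {0..c} s \<partial>lborel) = ennreal (c powr (e + 1) / (e + 1))"
proof -
  have "((\<lambda>s. if s \<in> {0..c} then s powr e else 0) has_integral (c powr (e + 1) / (e + 1))) UNIV"
    using has_integral_powr_from_0[OF assms] by (simp only: has_integral_restrict_UNIV)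
  then have "(\<integral>\<^sup>+s. ennreal (if s \<in> {0..c} then s powr e else 0) \<partial>lborel) = ennreal (c powr (e + 1) / (e + 1))"
    by (intro nn_integral_has_integral_lborel) auto
  moreover have "(\<integral>\<^sup>+s. ennreal (s powr e) * indicator {0..c} s \<partial>lborel)
     = (\<integral>\<^sup>+s. ennreal (if s \<in> {0..c} then s powr e else 0) \<partial>lborel)"
    by (intro nn_integral_cong) (auto split: split_indicator)
  ultimately show ?thesis by simp
qed

text \<open>Both sides give \<open>{..t}\<close> the volume of a centred ball, so the radial density
  is obtained from ball volumes without a surface measure.\<close>

lemma distr_enorm:
  assumes d: "1 \<le> d"
  shows "distr (Rd d) borel (enorm d) =
    density lborel (\<lambda>s. ennreal (real d * vol d) * (ennreal (s powr (real d - 1)) * indicator {0..} s))"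
    (is "?M = ?N")
proof (rule borel_measure_eqI_atMost)
  fix t :: real
  have M: "emeasure ?M {..t} = emeasure (Rd d) {y \<in> space (Rd d). enorm d y \<le> t}"
    by (subst emeasure_distr) (auto intro!: arg_cong[where f="emeasure _"])
  have N: "emeasure ?N {..t} = (\<integral>\<^sup>+s. ennreal (real d * vol d) * (ennreal (s powr (real d - 1)) * indicator {0..t} s) \<partial>lborel)"
    by (subst emeasure_density) (auto intro!: nn_integral_cong split: split_indicator)
  show eq: "emeasure ?M {..t} = emeasure ?N {..t}"
  proof (cases "0 < t")
    case True
    have "emeasure ?M {..t} = ennreal (vol d * t ^ d)"
      unfolding M using emeasure_eball[OF True, of d "\<lambda>_. 0"] by (simp add: eball_0)
    moreover have "emeasure ?N {..t} = ennreal (real d * vol d) * ennreal (t powr real d / real d)"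
      unfolding N using nn_integral_powr_from_0[of "real d - 1" t] True d
      by (simp add: nn_integral_cmult)
    moreover have "ennreal (real d * vol d) * ennreal (t powr real d / real d) = ennreal (vol d * t ^ d)"
      using d True vol_pos[of d] by (simp add: ennreal_mult'[symmetric] powr_realpow)
    ultimately show ?thesis by simp
  next
    case False
    have "emeasure ?M {..t} \<le> emeasure (Rd d) {y \<in> space (Rd d). enorm d y = 0}"
      unfolding M using False by (intro emeasure_mono) (auto intro: antisym order_trans)
    moreover have "emeasure ?N {..t} = (\<integral>\<^sup>+s. 0 \<partial>(lborel :: real measure))"
      unfolding N using False d by (intro nn_integral_cong) (auto split: split_indicator)
    ultimately show ?thesis using Rd_origin[OF d] by simp
  qed
  have "emeasure ?M {..t} \<le> emeasure (Rd d) (ball0 d (max t 1))"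
    unfolding M by (intro emeasure_mono) (auto simp: eball_0)
  also have "\<dots> < \<infinity>" by (simp add: emeasure_eball)
  finally show "emeasure ?M {..t} < \<infinity>" .
qed simp_all

lemma mu_eball_0:
  assumes d: "1 \<le> d" and a: "a < real d" and R: "0 \<le> R"
  shows "emeasure (mu a d) (ball0 d R) = ennreal (real d / (real d - a) * vol d * R powr (real d - a))"
proof -
  have "emeasure (mu a d) (ball0 d R)
      = (\<integral>\<^sup>+y. ennreal (enorm d y powr (- a)) * indicator {..R} (enorm d y) \<partial>Rd d)"
    by (subst emeasure_mu) (auto intro!: nn_integral_cong simp: eball_0 split: split_indicator)
  also have "\<dots> = (\<integral>\<^sup>+s. ennreal (s powr (- a)) * indicator {..R} s \<partial>distr (Rd d) borel (enorm d))"
    by (subst nn_integral_distr) auto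
  also have "\<dots> = (\<integral>\<^sup>+s. ennreal (real d * vol d) * (ennreal (s powr (real d - 1)) * indicator {0..} s)
      * (ennreal (s powr (- a)) * indicator {..R} s) \<partial>lborel)"
    unfolding distr_enorm[OF d] by (subst nn_integral_density) auto
  also have "\<dots> = (\<integral>\<^sup>+s. ennreal (real d * vol d) * (ennreal (s powr (real d - 1 - a)) * indicator {0..R} s) \<partial>lborel)"
    by (intro nn_integral_cong)
      (auto simp: mult.assoc ennreal_mult'[symmetric] powr_diff powr_minus divide_inverse split: split_indicator)
  also have "\<dots> = ennreal (real d * vol d) * ennreal (R powr (real d - a) / (real d - a))"
    using nn_integral_powr_from_0[of "real d - 1 - a" R] a R by (simp add: nn_integral_cmult)
  also have "\<dots> = ennreal (real d / (real d - a) * vol d * R powr (real d - a))"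
    using vol_pos[of d] a by (subst ennreal_mult'[symmetric]) (auto simp: field_simps)
  finally show ?thesis .
qed

lemma mu_positive:
  assumes d: "1 \<le> d" and A[measurable]: "A \<in> sets (Rd d)" and pos: "emeasure (Rd d) A \<noteq> 0"
  shows "emeasure (mu a d) A \<noteq> 0"
proof
  assume "emeasure (mu a d) A = 0"
  then have "(\<integral>\<^sup>+y. ennreal (enorm d y powr (- a)) * indicator A y \<partial>Rd d) = 0"
    by (simp add: emeasure_mu)
  then have "AE y in Rd d. ennreal (enorm d y powr (- a)) * indicator A y = 0"
    by (subst (asm) nn_integral_0_iff_AE) auto
  moreover have "AE y in Rd d. enorm d y \<noteq> 0"
    by (rule AE_I[OF _ Rd_origin[OF d]]) auto
  ultimately have "AE y in Rd d. y \<notin> A"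
    by eventually_elim (auto split: split_indicator_asm simp: powr_def)
  then have "A \<in> null_sets (Rd d)"
    using AE_iff_null_sets[OF A] by simp
  then have "emeasure (Rd d) A = 0" by auto
  with pos show False by simp
qed

lemma mu_eball_pos:
  assumes "1 \<le> d" "0 < r"
  shows "0 < emeasure (mu a d) (eball d x r)"
  using mu_positive[OF assms(1) eball_sets, of x r a] assms vol_pos[of d]
  by (simp add: emeasure_eball zero_less_iff_neq_zero)

lemma enorm_triangle: "enorm d y \<le> enorm d x + sqrt (\<Sum>i<d. (y i - x i)\<^sup>2)"
proof -
  have "L2_set (\<lambda>i. x i + (y i - x i)) {..<d} \<le> L2_set x {..<d} + L2_set (\<lambda>i. y i - x i) {..<d}"
    by (rule L2_set_triangle_ineq)
  then show ?thesis by (simp add: L2_set_def enorm_def)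
qed

lemma eball_subset_centered: "eball d x r \<subseteq> ball0 d (enorm d x + r)"
proof
  fix y assume y: "y \<in> eball d x r"
  have "enorm d y \<le> enorm d x + sqrt (\<Sum>i<d. (y i - x i)\<^sup>2)" by (rule enorm_triangle)
  with y show "y \<in> ball0 d (enorm d x + r)"
    unfolding eball_0 by (simp add: eball_def)
qed

lemma mu_eball_finite:
  assumes d: "1 \<le> d" and a: "a < real d"
  shows "emeasure (mu a d) (eball d x r) < \<infinity>"
proof -
  have "emeasure (mu a d) (eball d x r) \<le> emeasure (mu a d) (ball0 d (max 0 (enorm d x + r)))"
    using eball_subset_centered[of d x r] by (intro emeasure_mono) (auto simp: eball_0)
  also have "\<dots> < \<infinity>" by (simp add: mu_eball_0[OF d a])
  finally show ?thesis .
qed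

section \<open>Testing on indicators of balls\<close>

text \<open>As a condition on the pair \<open>(x, y)\<close>, membership in the ball is jointly
  measurable; integrating out \<open>y\<close> keeps measurability in the centre.\<close>

lemma ball_integral_measurable:
  assumes [measurable]: "h \<in> borel_measurable (Rd d)"
  shows "(\<lambda>x. \<integral>\<^sup>+ y \<in> eball d x r. h y \<partial>mu a d) \<in> borel_measurable (Rd d)"
proof -
  interpret sigma_finite_measure "Rd d" by (rule sigma_finite_Rd)
  have comp: "(\<lambda>z. fst z i) \<in> borel_measurable (Rd d \<Otimes>\<^sub>M Rd d)"
      "(\<lambda>z. snd z i) \<in> borel_measurable (Rd d \<Otimes>\<^sub>M Rd d)" if "i < d" for i
    using that by measurable
  have [measurable]: "(\<lambda>z. \<Sum>i<d. (snd z i - fst z i)\<^sup>2) \<in> borel_measurable (Rd d \<Otimes>\<^sub>M Rd d)"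
    by (intro borel_measurable_sum borel_measurable_power borel_measurable_diff comp) auto
  have "(\<lambda>x. \<integral>\<^sup>+ y. ennreal (enorm d y powr (- a)) *
      (h y * (if sqrt (\<Sum>i<d. (y i - x i)\<^sup>2) \<le> r then 1 else 0)) \<partial>Rd d) \<in> borel_measurable (Rd d)"
    by (rule borel_measurable_nn_integral) (simp add: case_prod_beta)
  also have "(\<lambda>x. \<integral>\<^sup>+ y. ennreal (enorm d y powr (- a)) *
      (h y * (if sqrt (\<Sum>i<d. (y i - x i)\<^sup>2) \<le> r then 1 else 0)) \<partial>Rd d)
    = (\<lambda>x. \<integral>\<^sup>+ y \<in> eball d x r. h y \<partial>mu a d)"
    by (subst nn_integral_mu) (auto intro!: ext nn_integral_cong simp: eball_def split: split_indicator)
  finally show ?thesis .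
qed

text \<open>A countable supremum is needed for measurability. Closed balls are intersections of
  slightly larger ones, and \<open>a < d\<close> makes their masses finite, hence continuous from
  above.\<close>

lemma maxop_rational:
  assumes d: "1 \<le> d" and a: "a < real d"
  shows "maxop (mu a d) d f x = (SUP q \<in> {q \<in> \<rat>. 0 < q}.
      (\<integral>\<^sup>+ y \<in> eball d x q. ennreal \<bar>f y\<bar> \<partial>mu a d) / emeasure (mu a d) (eball d x q))"
    (is "_ = ?T")
proof -
  let ?N = "\<lambda>r. \<integral>\<^sup>+ y \<in> eball d x r. ennreal \<bar>f y\<bar> \<partial>mu a d"
  let ?D = "\<lambda>r. emeasure (mu a d) (eball d x r)"
  have sub: "eball d x r \<subseteq> eball d x s" if "r \<le> s" for r s
    using that by (auto simp: eball_def)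
  have pos: "0 < ?D r" if "0 < r" for r using mu_eball_pos[OF d that] .
  have fin: "?D r < \<infinity>" for r using mu_eball_finite[OF d a] .
  have le: "?N r / ?D r \<le> ?T" if r: "0 < r" for r
  proof (cases "?T = \<infinity>")
    case False
    \<comment> \<open>A rational radius between \<open>r\<close> and \<open>r + 1/(n+1)\<close> only
      enlarges the integral; the mass is brought back to that of radius \<open>r\<close> as
      \<open>n\<close> grows.\<close>
    have step: "?N r \<le> ?T * ?D (r + 1 / real (Suc n))" for n
    proof -
      obtain q where q: "q \<in> \<rat>" "r < q" "q < r + 1 / real (Suc n)"
        using Rats_dense_in_real[of r "r + 1 / real (Suc n)"] by auto
      have "?N r \<le> ?N q"
        using sub[of r q] q by (intro nn_integral_mono) (auto split: split_indicator)
      also have "\<dots> = (?N q / ?D q) * ?D q"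
        using pos[of q] fin[of q] q r by (simp add: ennreal_divide_times ennreal_mult_divide_eq mult_divide_eq_ennreal)
      also have "\<dots> \<le> ?T * ?D q"
        using q r by (intro mult_right_mono SUP_upper) auto
      also have "\<dots> \<le> ?T * ?D (r + 1 / real (Suc n))"
        using q sub[of q "r + 1 / real (Suc n)"] by (intro mult_left_mono emeasure_mono) auto
      finally show ?thesis .
    qed
    have "(\<lambda>n. ?D (r + 1 / real (Suc n))) \<longlonglongrightarrow> emeasure (mu a d) (\<Inter>n. eball d x (r + 1 / real (Suc n)))"
    proof (rule Lim_emeasure_decseq)
      show "decseq (\<lambda>n. eball d x (r + 1 / real (Suc n)))"
        unfolding decseq_def by (intro allI impI sub add_left_mono) (simp add: frac_le)
      show "emeasure (mu a d) (eball d x (r + 1 / real (Suc n))) \<noteq> \<infinity>" for n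
        using fin[of "r + 1 / real (Suc n)"] by simp
    qed (auto simp del: of_nat_Suc)
    also have "(\<Inter>n. eball d x (r + 1 / real (Suc n))) = eball d x r"
    proof
      show "(\<Inter>n. eball d x (r + 1 / real (Suc n))) \<subseteq> eball d x r"
      proof
        fix y assume y: "y \<in> (\<Inter>n. eball d x (r + 1 / real (Suc n)))"
        have "(\<lambda>n. r + 1 / real (Suc n)) \<longlonglongrightarrow> r + 0"
          by (intro tendsto_intros LIMSEQ_Suc[OF lim_1_over_n])
        moreover have "sqrt (\<Sum>i<d. (y i - x i)\<^sup>2) \<le> r + 1 / real (Suc n)" for n
          using y by (auto simp: eball_def simp del: of_nat_Suc)
        ultimately have "sqrt (\<Sum>i<d. (y i - x i)\<^sup>2) \<le> r"
          by (intro LIMSEQ_le_const) (auto simp del: of_nat_Suc)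
        then show "y \<in> eball d x r" using y by (auto simp: eball_def simp del: of_nat_Suc)
      qed
      show "eball d x r \<subseteq> (\<Inter>n. eball d x (r + 1 / real (Suc n)))"
        by (intro INT_greatest sub) auto
    qed
    finally have lim: "(\<lambda>n. ?D (r + 1 / real (Suc n))) \<longlonglongrightarrow> ?D r" .
    have "?T < top" using False unfolding less_top[symmetric] by simp
    then have "(\<lambda>n. ?T * ?D (r + 1 / real (Suc n))) \<longlonglongrightarrow> ?T * ?D r"
      by (rule ennreal_tendsto_cmult[OF _ lim])
    then have "?N r \<le> ?T * ?D r"
      using step by (intro LIMSEQ_le_const) (auto simp del: of_nat_Suc)
    then have "?N r / ?D r \<le> ?T * ?D r / ?D r" by (rule divide_right_mono_ennreal)
    also have "\<dots> = ?T" using pos[OF r] fin[of r] by (simp add: mult_divide_eq_ennreal)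
    finally show ?thesis .
  next
    case True
    show ?thesis unfolding True by simp
  qed
  show ?thesis
    unfolding maxop_def
  proof (rule antisym)
    show "(SUP r \<in> {r. 0 < r \<and> 0 < ?D r}. ?N r / ?D r) \<le> ?T"
      by (intro SUP_least le) auto
    show "?T \<le> (SUP r \<in> {r. 0 < r \<and> 0 < ?D r}. ?N r / ?D r)"
      by (intro SUP_subset_mono) (auto simp: pos)
  qed
qed

lemma maxop_measurable:
  assumes d: "1 \<le> d" and a: "a < real d" and [measurable]: "f \<in> borel_measurable (Rd d)"
  shows "maxop (mu a d) d f \<in> borel_measurable (Rd d)"
proof -
  have D: "(\<lambda>x. emeasure (mu a d) (eball d x q)) \<in> borel_measurable (Rd d)" for q
    using ball_integral_measurable[of "\<lambda>_. 1" d a q] by (simp add: nn_integral_indicator)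
  have N: "(\<lambda>x. \<integral>\<^sup>+ y \<in> eball d x q. ennreal \<bar>f y\<bar> \<partial>mu a d) \<in> borel_measurable (Rd d)" for q
    by (rule ball_integral_measurable) measurable
  have "countable {q::real \<in> \<rat>. 0 < q}"
    using countable_rat by (rule countable_subset[rotated]) auto
  then show ?thesis
    unfolding maxop_rational[OF d a, abs_def]
    by (intro borel_measurable_SUP borel_measurable_divide_ennreal N D)
qed

lemma ennpow_mono: "x \<le> y \<Longrightarrow> 0 \<le> q \<Longrightarrow> ennpow x q \<le> ennpow y q"
  unfolding ennpow_def
  by (cases x; cases y) (auto intro!: ennreal_leI powr_mono2 simp: top_unique)

lemma ennpow_ennreal: "0 \<le> x \<Longrightarrow> ennpow (ennreal x) q = ennreal (x powr q)"
  by (simp add: ennpow_def)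

lemma ennpow_one [simp]: "ennpow x 1 = x"
  by (cases x) (auto simp: ennpow_def)

text \<open>The test function is the indicator of \<open>B(0, R)\<close>, whose maximal function is
  at least \<tau> on \<open>S\<close>. As level sets are strict, the level \<open>\<tau> / 2\<close>
  is used, at the cost of the factor 1/2.\<close>

lemma weak_const_ge:
  assumes d: "1 \<le> d" and a: "a < real d" and R: "0 < R" and p: "1 \<le> p" and \<tau>: "0 < \<tau>"
    and S[measurable]: "S \<in> sets (Rd d)"
    and avg: "\<And>x. x \<in> S \<Longrightarrow> \<exists>r>0. ennreal \<tau> * emeasure (mu a d) (eball d x r)
        \<le> emeasure (mu a d) (eball d x r \<inter> ball0 d R)"
  shows "ennreal (\<tau> / 2 * (measure (mu a d) S / measure (mu a d) (ball0 d R)) powr (1 / p))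
      \<le> weak_const p a d"
  unfolding weak_const_def
proof (rule Inf_greatest, clarify)
  fix c :: real assume c: "0 \<le> c"
  assume H: "\<forall>f\<in>radial_Lp p a d. \<forall>t>0.
      ennreal t * ennpow (emeasure (mu a d) {x \<in> space (Rd d). ennreal t < maxop (mu a d) d f x}) (1 / p)
      \<le> ennreal c * lpnorm (mu a d) p (\<lambda>x. ennreal \<bar>f x\<bar>)"
  define B where "B = ball0 d R"
  have B[measurable]: "B \<in> sets (Rd d)" by (simp add: B_def)
  define f :: "(nat \<Rightarrow> real) \<Rightarrow> real" where "f = indicator B"
  define m where "m = measure (mu a d) B"
  define s where "s = measure (mu a d) S"
  have f[measurable]: "f \<in> borel_measurable (Rd d)" unfolding f_def by measurable
  have mB: "emeasure (mu a d) B = ennreal m"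
    unfolding m_def using mu_eball_finite[OF d a, of "\<lambda>_. 0" R]
    by (intro emeasure_eq_ennreal_measure) (simp add: B_def)
  have m: "0 < m"
    using mu_eball_pos[OF d R, of a "\<lambda>_. 0"] mB by (simp add: B_def[symmetric])
  have f_abs: "ennreal \<bar>f y\<bar> = indicator B y" for y
    by (simp add: f_def split: split_indicator)
  have lp: "lpnorm (mu a d) p (\<lambda>x. ennreal \<bar>f x\<bar>) = ennreal (m powr (1 / p))"
  proof -
    have "ennpow (indicator B x) p = indicator B x" for x
      by (auto simp: ennpow_def split: split_indicator)
    then show ?thesis
      using m by (simp add: lpnorm_def f_abs mB ennpow_ennreal)
  qed
  have "radial d f"
    unfolding radial_def
    by (intro exI[of _ "\<lambda>s. if s \<le> R then 1 else 0"]) (auto simp: f_def B_def eball_0 split: split_indicator)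
  then have fL: "f \<in> radial_Lp p a d"
    unfolding radial_Lp_def using f lp by simp
  have max: "ennreal \<tau> \<le> maxop (mu a d) d f x" if x: "x \<in> S" for x
  proof -
    from avg[OF x] obtain r where r: "0 < r"
      and le: "ennreal \<tau> * emeasure (mu a d) (eball d x r) \<le> emeasure (mu a d) (eball d x r \<inter> B)"
      unfolding B_def by blast
    let ?D = "emeasure (mu a d) (eball d x r)"
    have D: "0 < ?D" "?D < \<infinity>" using mu_eball_pos[OF d r] mu_eball_finite[OF d a] by auto
    have "(\<integral>\<^sup>+ y \<in> eball d x r. ennreal \<bar>f y\<bar> \<partial>mu a d) = emeasure (mu a d) (eball d x r \<inter> B)"
    proof -
      have "(\<integral>\<^sup>+ y \<in> eball d x r. ennreal \<bar>f y\<bar> \<partial>mu a d) = (\<integral>\<^sup>+ y. indicator (eball d x r \<inter> B) y \<partial>mu a d)"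
        unfolding f_abs by (intro nn_integral_cong) (auto split: split_indicator)
      then show ?thesis by simp
    qed
    moreover have "ennreal \<tau> = ennreal \<tau> * ?D / ?D"
      using D by (simp add: mult_divide_eq_ennreal)
    ultimately have "ennreal \<tau> \<le> (\<integral>\<^sup>+ y \<in> eball d x r. ennreal \<bar>f y\<bar> \<partial>mu a d) / ?D"
      using divide_right_mono_ennreal[OF le, of ?D] by simp
    also have "\<dots> \<le> maxop (mu a d) d f x"
      unfolding maxop_def using r D by (intro SUP_upper) auto
    finally show ?thesis .
  qed
  let ?L = "{x \<in> space (Rd d). ennreal (\<tau> / 2) < maxop (mu a d) d f x}"
  \<comment> \<open>A nonmeasurable set would have \<open>emeasure\<close> 0, and the comparison
    with \<open>S\<close> would fail.\<close>
  have [measurable]: "?L \<in> sets (Rd d)"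
    using maxop_measurable[OF d a f] by measurable
  have "S \<subseteq> ?L"
  proof
    fix x assume x: "x \<in> S"
    have "ennreal (\<tau> / 2) < ennreal \<tau>" using \<tau> by (simp add: ennreal_lessI)
    also note max[OF x]
    finally show "x \<in> ?L" using x sets.sets_into_space[OF S] by auto
  qed
  then have "emeasure (mu a d) S \<le> emeasure (mu a d) ?L" by (intro emeasure_mono) auto
  \<comment> \<open>Only an inequality: if \<open>S\<close> had infinite mass, its
    \<open>measure\<close> would be 0.\<close>
  moreover have "ennreal s \<le> emeasure (mu a d) S"
    unfolding s_def measure_def by (cases "emeasure (mu a d) S") auto
  ultimately have "ennpow (ennreal s) (1 / p) \<le> ennpow (emeasure (mu a d) ?L) (1 / p)"
    using p by (intro ennpow_mono) auto
  then have "ennreal (\<tau> / 2) * ennreal (s powr (1 / p)) \<le> ennreal (\<tau> / 2) * ennpow (emeasure (mu a d) ?L) (1 / p)"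
    by (intro mult_left_mono) (auto simp: ennpow_ennreal s_def)
  also have "\<dots> \<le> ennreal c * ennreal (m powr (1 / p))"
  proof -
    have "0 < \<tau> / 2" using \<tau> by simp
    from H[rule_format, OF fL this] show ?thesis unfolding lp .
  qed
  finally have "\<tau> / 2 * s powr (1 / p) \<le> c * m powr (1 / p)"
    using \<tau> c by (simp add: ennreal_mult'[symmetric])
  then have "\<tau> / 2 * (s powr (1 / p) / m powr (1 / p)) \<le> c"
    using m by (simp add: field_simps)
  then show "ennreal (\<tau> / 2 * (measure (mu a d) S / measure (mu a d) (ball0 d R)) powr (1 / p)) \<le> ennreal c"
    unfolding B_def[symmetric] m_def[symmetric] s_def[symmetric]
    using m by (intro ennreal_leI) (simp add: powr_divide s_def)
qed

text \<open>Inside a ball, small averages of its indicator equal 1. This general bound serves where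
  the sharper estimates do not reach: negative exponents and small dimensions.\<close>

lemma weak_const_ge_half:
  assumes d: "1 \<le> d" and a: "a < real d" and p: "1 \<le> p"
  shows "ennreal (1 / 2 * (1 / 2) powr (1 / p)) \<le> weak_const p a d"
proof -
  \<comment> \<open>By homogeneity, \<open>B(0, \<rho>)\<close> has half the mass of the unit
    ball.\<close>
  define \<rho> where "\<rho> = (1 / 2 :: real) powr (1 / (real d - a))"
  have \<rho>0: "0 < \<rho>" by (simp add: \<rho>_def)
  have \<rho>1: "\<rho> < 1" unfolding \<rho>_def using powr_less_mono2[of "1 / (real d - a)" "1 / 2" 1] a by simp
  have \<rho>d: "\<rho> powr (real d - a) = 1 / 2" unfolding \<rho>_def powr_powr using a by simp
  have "ennreal (1 / 2 * (measure (mu a d) (ball0 d \<rho>) / measure (mu a d) (ball0 d 1)) powr (1 / p))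
      \<le> weak_const p a d"
  proof (rule weak_const_ge[OF d a _ p])
    fix x assume x: "x \<in> ball0 d \<rho>"
    then have "eball d x (1 - \<rho>) \<subseteq> ball0 d 1"
      using eball_subset_centered[of d x "1 - \<rho>"] by (auto simp: eball_0)
    then have "eball d x (1 - \<rho>) \<inter> ball0 d 1 = eball d x (1 - \<rho>)" by blast
    then show "\<exists>r>0. ennreal 1 * emeasure (mu a d) (eball d x r)
        \<le> emeasure (mu a d) (eball d x r \<inter> ball0 d 1)"
      using \<rho>1 by (intro exI[of _ "1 - \<rho>"]) simp
  qed auto
  moreover have "measure (mu a d) (ball0 d \<rho>) / measure (mu a d) (ball0 d 1) = 1 / 2"
    using \<rho>0 \<rho>d vol_pos[of d] d a by (simp add: measure_def mu_eball_0)
  ultimately show ?thesis by simp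
qed

section \<open>Weak type (1,1) for exponents at most d/2\<close>

lemma aff_scale_eball:
  assumes "0 < c"
  shows "{y \<in> space (Rd d). aff d (\<lambda>_. 0) c y \<in> eball d (\<lambda>i. c * u i) (c * r)} = eball d u r"
proof -
  have "(\<Sum>i<d. (aff d (\<lambda>_. 0) c y i - c * u i)\<^sup>2) = (\<Sum>i<d. c\<^sup>2 * (y i - u i)\<^sup>2)" for y
    unfolding aff_def by (intro sum.cong) (auto simp: power2_eq_square algebra_simps)
  then have "sqrt (\<Sum>i<d. (aff d (\<lambda>_. 0) c y i - c * u i)\<^sup>2) = c * sqrt (\<Sum>i<d. (y i - u i)\<^sup>2)" for y
    using assms by (simp add: sum_distrib_left[symmetric] real_sqrt_mult)
  then show ?thesis using assms by (auto simp: eball_def)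
qed

lemma mu_eball_scale:
  assumes "0 < c"
  shows "emeasure (mu a d) (eball d (\<lambda>i. c * u i) (c * r)) =
      ennreal (c powr (real d - a)) * emeasure (mu a d) (eball d u r)"
  using mu_scale[OF assms eball_sets, of a d "\<lambda>i. c * u i" "c * r"] aff_scale_eball[OF assms] by simp

lemma normalize_direction:
  assumes "0 < enorm d x"
  shows "enorm d (\<lambda>i. x i / enorm d x) = 1" "x = (\<lambda>i. enorm d x * (x i / enorm d x))"
  using enorm_scale[of d "1 / enorm d x" x] assms by auto

text \<open>On the lens \<open>\<bar>y - u\<bar> \<le> r\<close>, \<open>\<bar>y\<bar>\<^sup>2 \<le> U\<close>, use
  \<open>\<bar>y - k u\<bar>\<^sup>2 = (1 - k) \<bar>y\<bar>\<^sup>2 + k \<bar>y - u\<bar>\<^sup>2 - k (1 - k)\<close>.\<close>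
lemma lens_volume:
  assumes u: "enorm d u = 1" and k: "0 \<le> k" "k \<le> 1" and r: "0 \<le> r" and \<rho>: "0 < \<rho>"
    and le: "(1 - k) * U + k * r\<^sup>2 - k * (1 - k) \<le> \<rho>\<^sup>2"
  shows "emeasure (Rd d) {y \<in> eball d u r. (enorm d y)\<^sup>2 \<le> U} \<le> ennreal (vol d * \<rho> ^ d)"
proof -
  have "{y \<in> eball d u r. (enorm d y)\<^sup>2 \<le> U} \<subseteq> eball d (\<lambda>i. k * u i) \<rho>"
  proof clarify
    fix y assume y: "y \<in> eball d u r" and U: "(enorm d y)\<^sup>2 \<le> U"
    have d2: "(enorm d y)\<^sup>2 - 2 * ip d u y + 1 \<le> r\<^sup>2"
      using y mem_eball[OF r, of y d u] u by simp
    have "(enorm d y)\<^sup>2 - 2 * k * ip d u y + k\<^sup>2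
        = (1 - k) * (enorm d y)\<^sup>2 + k * ((enorm d y)\<^sup>2 - 2 * ip d u y + 1) - k * (1 - k)"
      by (simp add: power2_eq_square algebra_simps)
    also have "\<dots> \<le> (1 - k) * U + k * r\<^sup>2 - k * (1 - k)"
      using k by (intro diff_right_mono add_mono mult_left_mono U d2) auto
    finally show "y \<in> eball d (\<lambda>i. k * u i) \<rho>"
      using y le u \<rho> by (subst mem_eball_scaled) (auto simp: eball_def)
  qed
  then have "emeasure (Rd d) {y \<in> eball d u r. (enorm d y)\<^sup>2 \<le> U} \<le> emeasure (Rd d) (eball d (\<lambda>i. k * u i) \<rho>)"
    by (intro emeasure_mono) auto
  then show ?thesis by (simp add: emeasure_eball[OF \<rho>])
qed

text \<open>The weight is bounded by its value on the inner sphere, the volume by that of the whole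
  lens inside the outer sphere.\<close>

lemma shell_measure:
  assumes u: "enorm d u = 1" and k: "0 \<le> k" "k \<le> 1" and r: "0 \<le> r" and \<rho>: "0 < \<rho>"
    and le: "(1 - k) * U + k * r\<^sup>2 - k * (1 - k) \<le> \<rho>\<^sup>2" and s: "0 < s" and a: "0 \<le> a"
  shows "emeasure (mu a d) {y \<in> eball d u r. s \<le> enorm d y \<and> (enorm d y)\<^sup>2 \<le> U}
    \<le> ennreal (s powr (- a) * (vol d * \<rho> ^ d))"
proof -
  have eb: "{y \<in> eball d u r. P y} = eball d u r \<inter> {y \<in> space (Rd d). P y}" for P
    by (auto simp: eball_def)
  have m1: "{y \<in> eball d u r. s \<le> enorm d y \<and> (enorm d y)\<^sup>2 \<le> U} \<in> sets (Rd d)"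
    unfolding eb by measurable
  have m2: "{y \<in> eball d u r. (enorm d y)\<^sup>2 \<le> U} \<in> sets (Rd d)"
    unfolding eb by measurable
  have "emeasure (mu a d) {y \<in> eball d u r. s \<le> enorm d y \<and> (enorm d y)\<^sup>2 \<le> U}
     \<le> ennreal (s powr (- a)) * emeasure (Rd d) {y \<in> eball d u r. s \<le> enorm d y \<and> (enorm d y)\<^sup>2 \<le> U}"
    using s a by (intro mu_le m1) (auto intro!: powr_mono2')
  also have "\<dots> \<le> ennreal (s powr (- a)) * emeasure (Rd d) {y \<in> eball d u r. (enorm d y)\<^sup>2 \<le> U}"
    by (intro mult_left_mono emeasure_mono m2) auto
  also have "\<dots> \<le> ennreal (s powr (- a)) * ennreal (vol d * \<rho> ^ d)"
    by (intro mult_left_mono lens_volume[OF u k r \<rho> le]) auto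
  finally show ?thesis by (simp add: ennreal_mult'[symmetric])
qed

lemma power_le_powr:
  fixes a q :: real
  assumes "0 < q" "q \<le> 1" "a \<le> real d"
  shows "q ^ d \<le> q powr a"
  using assms powr_mono'[of a "real d" q] by (simp add: powr_realpow)

text \<open>This converts volume ratios into powers with exponent \<open>a\<close>; the hypothesis
  \<open>a \<le> d / 2\<close> absorbs the square root in a lens radius.\<close>

lemma sqrt_power_le_powr:
  fixes a q :: real
  assumes "0 < q" "q \<le> 1" "a \<le> real d / 2"
  shows "sqrt q ^ d \<le> q powr a"
proof -
  have "sqrt q ^ d \<le> sqrt q powr (2 * a)" using assms by (intro power_le_powr) auto
  also have "sqrt q powr (2 * a) = q powr a"
    using assms by (simp add: powr_half_sqrt[symmetric] powr_powr)
  finally show ?thesis .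
qed

text \<open>Norms are split at \<open>q\<close>, 1 and \<open>1 / q\<close>, and each piece costs at
  most \<open>2 * vol d * q powr a\<close>: below \<open>q\<close> by homogeneity, as
  \<open>d - a \<ge> a\<close>; beyond \<open>1 / q\<close> by the weight; in between by lens
  volumes. A radius slightly above 1 costs only \<open>r ^ d \<le> 2\<close> and lets the ball
  contain a neighbourhood of the origin.\<close>

lemma mu_near_unit_ball:
  fixes q :: real
  assumes u: "enorm d u = 1" and d: "1 \<le> d" and a: "0 \<le> a" "a \<le> real d / 2"
    and r: "1 \<le> r" "r ^ d \<le> 2" and q: "q = 2 / sqrt 5"
  shows "emeasure (mu a d) (eball d u r) \<le> ennreal (8 * vol d * q powr a)"
proof -
  note v = vol_pos[of d]
  have q2: "q\<^sup>2 = 4 / 5" unfolding q by (simp add: power_divide)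
  have q0: "0 < q" unfolding q by simp
  have q1: "q < 1" using q2 q0 by (intro power2_less_imp_less[of q 1]) auto
  have q3: "55 / 64 \<le> q"
  proof (rule power2_le_imp_le)
    show "(55 / 64)\<^sup>2 \<le> q\<^sup>2" unfolding q2 by (simp add: power2_eq_square)
  qed (use q0 in simp)
  have ad: "a < real d" using a d by linarith
  have r0: "0 < r" using r by simp
  have r2: "1 \<le> r\<^sup>2" using r(1) by simp
  define A0 where "A0 = ball0 d q"
  define A1 where "A1 = {y \<in> eball d u r. q \<le> enorm d y \<and> (enorm d y)\<^sup>2 \<le> 1}"
  define A2 where "A2 = {y \<in> eball d u r. 1 \<le> enorm d y \<and> (enorm d y)\<^sup>2 \<le> 5 / 4}"
  define A3 where "A3 = {y \<in> eball d u r. 1 / q \<le> enorm d y}"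
  have eb: "{y \<in> eball d u r. P y} = eball d u r \<inter> {y \<in> space (Rd d). P y}" for P
    by (auto simp: eball_def)
  have [measurable]: "A0 \<in> sets (Rd d)" "A1 \<in> sets (Rd d)" "A2 \<in> sets (Rd d)" "A3 \<in> sets (Rd d)"
    unfolding A0_def A1_def A2_def A3_def eb by measurable
  have cover: "eball d u r \<subseteq> A0 \<union> (A1 \<union> (A2 \<union> A3))"
  proof
    fix y assume y: "y \<in> eball d u r"
    then have ys: "y \<in> space (Rd d)" by (simp add: eball_def)
    consider "enorm d y \<le> q" | "q \<le> enorm d y" "enorm d y \<le> 1" | "1 \<le> enorm d y" "enorm d y \<le> 1 / q" | "1 / q \<le> enorm d y"
      by linarith
    then show "y \<in> A0 \<union> (A1 \<union> (A2 \<union> A3))"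
    proof cases
      case 3
      then have "(enorm d y)\<^sup>2 \<le> (1 / q)\<^sup>2" by (intro power_mono) auto
      also have "\<dots> = 5 / 4" by (simp only: power_divide q2) simp
      finally show ?thesis using 3 y by (simp add: A2_def)
    qed (use y ys in \<open>auto simp: A0_def A1_def A3_def eball_0 power_le_one\<close>)
  qed
  have b0: "emeasure (mu a d) A0 \<le> ennreal (2 * vol d * q powr a)"
  proof -
    have "q powr (real d - a) \<le> q powr a"
      using a q0 q1 by (intro powr_mono') auto
    moreover have "real d / (real d - a) \<le> 2" using a ad by (simp add: divide_le_eq)
    ultimately have "real d / (real d - a) * vol d * q powr (real d - a) \<le> 2 * vol d * q powr a"
      using v by (intro mult_mono) auto
    then show ?thesis
      unfolding A0_def mu_eball_0[OF d ad less_imp_le[OF q0]] by (rule ennreal_leI)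
  qed
  have bnd: "s powr (- a) * (vol d * (\<sigma> * r) ^ d) \<le> 2 * vol d * q powr a"
    if "s powr (- a) * \<sigma> ^ d \<le> q powr a" for s \<sigma> :: real
  proof -
    have "s powr (- a) * (vol d * (\<sigma> * r) ^ d) = vol d * ((s powr (- a) * \<sigma> ^ d) * r ^ d)"
      by (simp add: power_mult_distrib)
    also have "\<dots> \<le> vol d * (q powr a * 2)"
      using v r that r0 by (intro mult_left_mono mult_mono) auto
    finally show ?thesis by simp
  qed
  have b1: "emeasure (mu a d) A1 \<le> ennreal (2 * vol d * q powr a)"
  proof -
    \<comment> \<open>\<open>k = U / 2\<close> minimises the lens radius for \<open>r = 1\<close>.
      With \<open>U = 1\<close> its square is 3/4, below \<open>q^2 = 4/5\<close>; for
      \<open>r \<ge> 1\<close> a factor \<open>r\<close> dominates the change.\<close>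
    have shell: "emeasure (mu a d) A1 \<le> ennreal (q powr (- a) * (vol d * (sqrt (3 / 4) * r) ^ d))"
      unfolding A1_def
      by (rule shell_measure[where k = "1 / 2"]) (use u r0 r2 q0 a in \<open>auto simp: power_mult_distrib field_simps\<close>)
    have "q powr (- a) * sqrt (3 / 4) ^ d \<le> q powr (- a) * (3 / 4) powr a"
      using a by (intro mult_left_mono sqrt_power_le_powr) auto
    also have "\<dots> \<le> q powr (- a) * (q\<^sup>2) powr a"
      using a q2 by (intro mult_left_mono powr_mono2) auto
    also have "(q\<^sup>2) powr a = q powr a * q powr a"
      using q0 by (simp add: power2_eq_square powr_mult)
    also have "q powr (- a) * (q powr a * q powr a) = q powr a"
      using q0 by (simp add: powr_minus)
    finally have "q powr (- a) * sqrt (3 / 4) ^ d \<le> q powr a" .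
    then show ?thesis by (intro order_trans[OF shell] ennreal_leI bnd)
  qed
  have b2: "emeasure (mu a d) A2 \<le> ennreal (2 * vol d * q powr a)"
  proof -
    \<comment> \<open>Again \<open>k = U / 2\<close>, now with \<open>U = 1 / q^2 = 5/4\<close>; the
      squared lens radius is 55/64.\<close>
    have shell: "emeasure (mu a d) A2 \<le> ennreal (1 powr (- a) * (vol d * (sqrt (55 / 64) * r) ^ d))"
      unfolding A2_def
      by (rule shell_measure[where k = "5 / 8"]) (use u r0 r2 a in \<open>auto simp: power_mult_distrib field_simps\<close>)
    have "sqrt (55 / 64) ^ d \<le> (55 / 64) powr a"
      using a by (intro sqrt_power_le_powr) auto
    also have "\<dots> \<le> q powr a" using a q3 by (intro powr_mono2) auto
    finally have "1 powr (- a) * sqrt (55 / 64) ^ d \<le> q powr a" by simp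
    then show ?thesis by (intro order_trans[OF shell] ennreal_leI bnd)
  qed
  have b3: "emeasure (mu a d) A3 \<le> ennreal (2 * vol d * q powr a)"
  proof -
    have "emeasure (mu a d) A3 \<le> ennreal ((1 / q) powr (- a)) * emeasure (Rd d) A3"
      using a q0 by (intro mu_le) (auto simp: A3_def intro!: powr_mono2')
    also have "\<dots> \<le> ennreal ((1 / q) powr (- a)) * emeasure (Rd d) (eball d u r)"
      by (intro mult_left_mono emeasure_mono) (auto simp: A3_def)
    also have "\<dots> = ennreal ((1 / q) powr (- a) * (vol d * (1 * r) ^ d))"
      using r0 by (simp add: emeasure_eball ennreal_mult'[symmetric])
    also have "\<dots> \<le> ennreal (2 * vol d * q powr a)"
      using q0 by (intro ennreal_leI bnd) (simp add: powr_divide powr_minus)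
    finally show ?thesis .
  qed
  have "emeasure (mu a d) (eball d u r) \<le> emeasure (mu a d) (A0 \<union> (A1 \<union> (A2 \<union> A3)))"
    by (intro emeasure_mono cover) auto
  also have "\<dots> \<le> emeasure (mu a d) A0 + (emeasure (mu a d) A1 + (emeasure (mu a d) A2 + emeasure (mu a d) A3))"
    by (intro order_trans[OF emeasure_subadditive] add_left_mono) auto
  also have "\<dots> \<le> ennreal (2 * vol d * q powr a) + (ennreal (2 * vol d * q powr a)
      + (ennreal (2 * vol d * q powr a) + ennreal (2 * vol d * q powr a)))"
    by (intro add_mono b0 b1 b2 b3)
  also have "\<dots> = ennreal (8 * vol d * q powr a)"
    using v by (simp add: ennreal_plus[symmetric] del: ennreal_plus)
  finally show ?thesis .
qed

lemma one_plus_inverse_power_le_2: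
  assumes "1 \<le> d"
  shows "(1 + 1 / (2 * real d)) ^ d \<le> 2"
proof -
  have "(1 + 1 / (2 * real d)) ^ d \<le> exp (1 / (2 * real d)) ^ d"
    by (intro power_mono exp_ge_add_one_self) auto
  also have "\<dots> = exp (1 / 2)"
    using assms by (simp add: exp_of_nat_mult[symmetric])
  also have "\<dots> \<le> 2" using exp_half_le2 by simp
  finally show ?thesis .
qed

text \<open>The mass of \<open>B(0, R)\<close> cancels between average and norm, so the fixed radius
  \<open>R = h / 2\<close> already gives the bound. The constant 1/64 is the mass
  \<open>vol d / 4\<close> of \<open>S\<close> divided by \<open>2 * 8 * vol d\<close>.\<close>

lemma weak_const_1_ge:
  assumes d: "1 \<le> d" and a: "a \<le> real d / 2"
  shows "ennreal (1 / 64 * (sqrt 5 / 2) powr a) \<le> weak_const 1 a d"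
proof (cases "a < 0")
  case True
  \<comment> \<open>For \<open>a < 0\<close> the claimed bound is below 1/64, and the general bound
    is 1/4.\<close>
  have "(1::real) < sqrt 5 / 2" by (simp add: real_less_rsqrt)
  then have "(sqrt 5 / 2) powr a \<le> (sqrt 5 / 2) powr 0" using True by (intro powr_mono) auto
  then have "1 / 64 * (sqrt 5 / 2) powr a \<le> 1 / 2 * (1 / 2) powr (1 / 1)" by simp
  then have "ennreal (1 / 64 * (sqrt 5 / 2) powr a) \<le> ennreal (1 / 2 * (1 / 2) powr (1 / 1))"
    by (rule ennreal_leI)
  also have "\<dots> \<le> weak_const 1 a d" by (rule weak_const_ge_half) (use d True in auto)
  finally show ?thesis .
next
  case False
  then have a0: "0 \<le> a" by simp
  note v = vol_pos[of d]
  have ad: "a < real d" using a d by linarith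
  define q :: real where "q = 2 / sqrt 5"
  have q0: "0 < q" by (simp add: q_def)
  \<comment> \<open>An \<open>h\<close> of order \<open>1 / d\<close> keeps
    \<open>(1 + h) ^ d\<close> bounded.\<close>
  define h where "h = 1 / (2 * real d)"
  have h: "0 < h" "1 \<le> 1 + h" "(1 + h) ^ d \<le> 2"
    using d one_plus_inverse_power_le_2[OF d] by (auto simp: h_def)
  define mR where "mR = measure (mu a d) (ball0 d (h / 2))"
  have mR: "emeasure (mu a d) (ball0 d (h / 2)) = ennreal mR" "0 < mR"
    using h v d ad unfolding mR_def measure_def by (auto simp: mu_eball_0)
  define V where "V = 8 * vol d * q powr a"
  have V: "0 < V" using v q0 by (simp add: V_def)
  \<comment> \<open>Norms above 1/2 give \<open>\<xi> * h \<ge> h / 2\<close>, so the ball of radius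
    \<open>\<xi> * (1 + h)\<close> about \<open>x\<close> contains \<open>B(0, h/2)\<close>.\<close>
  define S where "S = ball0 d 1 - ball0 d (1 / 2)"
  have S[measurable]: "S \<in> sets (Rd d)" by (simp add: S_def)
  have "ennreal (mR / V / 2 * (measure (mu a d) S / measure (mu a d) (ball0 d (h / 2))) powr (1 / 1))
      \<le> weak_const 1 a d"
  proof (rule weak_const_ge[OF d ad])
    fix x assume "x \<in> S"
    then have x: "x \<in> space (Rd d)" "1 / 2 < enorm d x" "enorm d x \<le> 1"
      by (auto simp: S_def eball_0)
    define \<xi> where "\<xi> = enorm d x"
    define u where "u = (\<lambda>i. x i / \<xi>)"
    have \<xi>: "1 / 2 < \<xi>" "\<xi> \<le> 1" "0 < \<xi>" using x by (auto simp: \<xi>_def)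
    have u: "enorm d u = 1" and xu: "x = (\<lambda>i. \<xi> * u i)"
      using normalize_direction[of d x] \<xi>(3) unfolding u_def \<xi>_def by auto
    have "emeasure (mu a d) (eball d x (\<xi> * (1 + h))) = ennreal (\<xi> powr (real d - a)) * emeasure (mu a d) (eball d u (1 + h))"
      unfolding xu by (rule mu_eball_scale) (rule \<xi>)
    also have "\<dots> \<le> ennreal 1 * ennreal V"
    proof (rule mult_mono)
      show "ennreal (\<xi> powr (real d - a)) \<le> ennreal 1"
        using \<xi> ad by (intro ennreal_leI powr_le1) auto
      show "emeasure (mu a d) (eball d u (1 + h)) \<le> ennreal V"
        unfolding V_def by (rule mu_near_unit_ball[OF u d a0 a h(2,3) q_def])
    qed auto
    finally have "ennreal (mR / V) * emeasure (mu a d) (eball d x (\<xi> * (1 + h))) \<le> ennreal (mR / V) * ennreal V"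
      by (intro mult_left_mono) auto
    also have "\<dots> = ennreal mR" using V mR by (simp add: ennreal_mult'[symmetric])
    also have "ennreal mR = emeasure (mu a d) (eball d x (\<xi> * (1 + h)) \<inter> ball0 d (h / 2))"
    proof -
      have "ball0 d (h / 2) \<subseteq> eball d x (\<xi> * (1 + h))"
      proof
        fix y assume y: "y \<in> ball0 d (h / 2)"
        have le: "enorm d y \<le> \<xi> * h"
        proof -
          have "1 / 2 * h \<le> \<xi> * h" using \<xi> h by (intro mult_right_mono) auto
          then show ?thesis using y by (simp add: eball_0)
        qed
        have "(enorm d y)\<^sup>2 - 2 * ip d x y + \<xi>\<^sup>2 \<le> (enorm d y)\<^sup>2 + 2 * (\<xi> * enorm d y) + \<xi>\<^sup>2"
          using ip_abs_le[of d x y] unfolding \<xi>_def[symmetric] by linarith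
        also have "\<dots> = (enorm d y + \<xi>)\<^sup>2" by (simp add: power2_eq_square algebra_simps)
        also have "\<dots> \<le> (\<xi> * (1 + h))\<^sup>2"
          using le \<xi> by (intro power_mono) (auto simp: algebra_simps)
        finally show "y \<in> eball d x (\<xi> * (1 + h))"
          using y \<xi> h by (subst mem_eball) (auto simp: \<xi>_def[symmetric] eball_0)
      qed
      then have "eball d x (\<xi> * (1 + h)) \<inter> ball0 d (h / 2) = ball0 d (h / 2)" by blast
      then show ?thesis using mR by simp
    qed
    finally show "\<exists>r>0. ennreal (mR / V) * emeasure (mu a d) (eball d x r)
        \<le> emeasure (mu a d) (eball d x r \<inter> ball0 d (h / 2))"
      using \<xi> h by (intro exI[of _ "\<xi> * (1 + h)"]) auto
  qed (use h mR V in auto)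
  moreover have "vol d / 4 \<le> measure (mu a d) S"
  proof -
    have "(1 / 2) powr (real d - a) \<le> (1 / 2 :: real) powr (1 / 2)"
      using a d by (intro powr_mono') auto
    also have "\<dots> = sqrt (1 / 2)" by (simp add: powr_half_sqrt)
    also have "\<dots> \<le> 3 / 4" by (rule real_le_lsqrt) (auto simp: power2_eq_square)
    finally have p: "(1 / 2) powr (real d - a) \<le> (3 / 4 :: real)" .
    have M: "measure (mu a d) (ball0 d \<rho>) = real d / (real d - a) * vol d * \<rho> powr (real d - a)"
      if "0 \<le> \<rho>" for \<rho>
      using v ad d that by (simp add: measure_def mu_eball_0)
    have "1 \<le> real d / (real d - a)" using ad a0 by simp
    then have "1 * vol d * (1 / 4) \<le> real d / (real d - a) * vol d * (1 - (1 / 2) powr (real d - a))"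
      using p v ad by (intro mult_mono) auto
    also have "\<dots> = measure (mu a d) (ball0 d 1) - measure (mu a d) (ball0 d (1 / 2))"
      by (simp only: M) (simp add: M algebra_simps)
    also have "\<dots> = measure (mu a d) S"
    proof -
      have "emeasure (mu a d) (ball0 d 1) \<noteq> \<infinity>"
        using mu_eball_finite[OF d ad, of "\<lambda>_. 0" 1] by simp
      moreover have "ball0 d (1 / 2) \<subseteq> ball0 d 1" by (auto simp: eball_0)
      ultimately show ?thesis unfolding S_def by (intro measure_Diff[symmetric]) auto
    qed
    finally show ?thesis by simp
  qed
  moreover have "1 / 64 * (sqrt 5 / 2) powr a \<le> mR / V / 2 * (measure (mu a d) S / mR) powr (1 / 1)"
    if S4: "vol d / 4 \<le> measure (mu a d) S"
  proof -
    have "mR / V / 2 * (measure (mu a d) S / mR) powr (1 / 1) = measure (mu a d) S / (2 * V)"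
      using mR V by simp
    moreover have "vol d / 4 / (2 * V) \<le> measure (mu a d) S / (2 * V)"
      using S4 V by (intro divide_right_mono) auto
    moreover have "vol d / 4 / (2 * V) = 1 / 64 * (sqrt 5 / 2) powr a"
      using v unfolding V_def q_def by (simp add: powr_divide)
    ultimately show ?thesis by simp
  qed
  ultimately show ?thesis
    unfolding mR_def[symmetric] by (meson ennreal_leI order_trans)
qed

lemma weak_const_1_unbounded:
  fixes a :: "nat \<Rightarrow> real"
  assumes a: "\<And>d. 1 \<le> d \<Longrightarrow> a d \<le> real d / 2" and lim: "limsup (\<lambda>d. ereal (a d)) = \<infinity>"
  shows "limsup (\<lambda>d. weak_const 1 (a d) d) = \<infinity>"
proof -
  have frequent: "\<exists>m\<ge>n. L < a m" for n and L :: real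
  proof -
    have "(SUP m\<in>{n..}. ereal (a m)) = top"
      using lim unfolding limsup_INF_SUP top_ereal_def[symmetric] INF_top_conv by blast
    then obtain m where "m \<in> {n..}" "ereal L < ereal (a m)"
      unfolding SUP_eq_top_iff by (metis less_ereal.simps(4) top_ereal_def)
    then show ?thesis by auto
  qed
  have b: "(1::real) < sqrt 5 / 2" by (simp add: real_less_rsqrt)
  have "(SUP m\<in>{n..}. weak_const 1 (a m) m) = top" for n
    unfolding SUP_eq_top_iff
  proof (intro allI impI)
    fix y :: ennreal assume "y < top"
    then obtain M where M: "0 \<le> M" "y = ennreal M" by (cases y) auto
    \<comment> \<open>At the exponent \<open>L\<close> the lower bound equals
      \<open>M + 1\<close>.\<close>
    define L where "L = log (sqrt 5 / 2) (64 * (M + 1))"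
    obtain d where d: "max 1 n \<le> d" and L: "L < a d" using frequent by blast
    have "64 * (M + 1) = (sqrt 5 / 2) powr L" unfolding L_def using b M by simp
    also have "\<dots> \<le> (sqrt 5 / 2) powr a d" using L b by (intro powr_mono) auto
    finally have "M < 1 / 64 * (sqrt 5 / 2) powr a d" by simp
    then have "y < ennreal (1 / 64 * (sqrt 5 / 2) powr a d)" using M by (simp add: ennreal_lessI)
    also have "\<dots> \<le> weak_const 1 (a d) d" using d by (intro weak_const_1_ge a) auto
    finally show "\<exists>d\<in>{n..}. y < weak_const 1 (a d) d" using d by auto
  qed
  then show ?thesis by (simp add: limsup_INF_SUP)
qed

section \<open>Exponential growth\<close>

lemma powr_times_nat:
  fixes x b :: real
  assumes "0 < x"
  shows "x powr (b * real d) = (x powr b) ^ d"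
  using assms by (simp add: powr_powr[symmetric] powr_realpow)

text \<open>The lens contains the slab \<open>\<bar>\<langle>w, u\<rangle>\<bar> \<le> \<delta>\<close>, \<open>w = y - k u\<close>, of a ball of radius \<open>\<rho>\<close>;
  the two caps cut off by the slab lie in balls of radius \<open>\<surd>(\<rho>\<^sup>2 - \<delta>\<^sup>2)\<close> centred at \<open>(k \<plusminus> \<delta>) u\<close>.\<close>
lemma slab_volume:
  assumes u: "enorm d u = 1" and k: "0 \<le> k" "k \<le> 1" and \<delta>: "0 < \<delta>" "\<delta> < \<rho>"
    and r: "0 \<le> r" and s: "0 \<le> s"
    and r_le: "\<rho>\<^sup>2 + 2 * \<delta> + (1 - k)\<^sup>2 \<le> r\<^sup>2" and s_le: "\<rho>\<^sup>2 + 2 * \<delta> + k\<^sup>2 \<le> s\<^sup>2"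
  shows "ennreal (vol d * (\<rho> ^ d - 2 * sqrt (\<rho>\<^sup>2 - \<delta>\<^sup>2) ^ d)) \<le> emeasure (Rd d) (eball d u r \<inter> ball0 d s)"
proof -
  define \<sigma> where "\<sigma> = sqrt (\<rho>\<^sup>2 - \<delta>\<^sup>2)"
  have lt: "\<delta>\<^sup>2 < \<rho>\<^sup>2" using \<delta> by (intro power_strict_mono) auto
  have \<sigma>: "0 < \<sigma>" "\<sigma>\<^sup>2 = \<rho>\<^sup>2 - \<delta>\<^sup>2" using lt by (auto simp: \<sigma>_def)
  have \<rho>: "0 < \<rho>" using \<delta> by simp
  let ?B = "eball d (\<lambda>i. k * u i) \<rho>"
  let ?P = "eball d (\<lambda>i. (k + \<delta>) * u i) \<sigma>"
  let ?M = "eball d (\<lambda>i. (k - \<delta>) * u i) \<sigma>"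
  let ?L = "eball d u r \<inter> ball0 d s"
  have "?B \<subseteq> ?L \<union> (?P \<union> ?M)"
  proof
    fix y assume y: "y \<in> ?B"
    define Y P where "Y = (enorm d y)\<^sup>2" and "P = ip d u y"
    have ys: "y \<in> space (Rd d)" using y by (simp add: eball_def)
    have B: "Y - 2 * k * P + k\<^sup>2 \<le> \<rho>\<^sup>2"
      using y mem_eball_scaled[of \<rho> y d k u] \<rho> u by (simp add: Y_def P_def)
    show "y \<in> ?L \<union> (?P \<union> ?M)"
    proof (cases "y \<in> ?P \<or> y \<in> ?M")
      case False
      then have "\<sigma>\<^sup>2 < Y - 2 * (k + \<delta>) * P + (k + \<delta>)\<^sup>2" "\<sigma>\<^sup>2 < Y - 2 * (k - \<delta>) * P + (k - \<delta>)\<^sup>2"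
        using mem_eball_scaled[of \<sigma> y d "k + \<delta>" u] mem_eball_scaled[of \<sigma> y d "k - \<delta>" u] \<sigma> u ys
        by (auto simp: Y_def P_def)
      then have "2 * \<delta> * P < 2 * \<delta> * (k + \<delta>)" "2 * \<delta> * (k - \<delta>) < 2 * \<delta> * P"
        using B unfolding \<sigma>(2) by (auto simp: power2_eq_square algebra_simps)
      then have P: "P < k + \<delta>" "k - \<delta> < P" using \<delta> by auto
      have "k * P \<le> k * (k + \<delta>)" "(1 - k) * (k - \<delta>) \<le> (1 - k) * P"
        using P k by (auto intro!: mult_left_mono)
      moreover have "k * \<delta> \<le> \<delta>" "(1 - k) * \<delta> \<le> \<delta>" using k \<delta> by (auto intro!: mult_left_le_one_le)
      ultimately have "Y \<le> s\<^sup>2" "Y - 2 * P + 1 \<le> r\<^sup>2"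
        using B r_le s_le by (auto simp: power2_eq_square algebra_simps)
      then show ?thesis
        using ys r s u by (auto simp: mem_eball eball_0 Y_def P_def intro: power2_le_imp_le)
    qed auto
  qed
  then have "emeasure (Rd d) ?B \<le> emeasure (Rd d) (?L \<union> (?P \<union> ?M))"
    by (intro emeasure_mono) auto
  also have "\<dots> \<le> emeasure (Rd d) ?L + (emeasure (Rd d) ?P + emeasure (Rd d) ?M)"
    by (intro order_trans[OF emeasure_subadditive] add_left_mono) auto
  finally have le: "ennreal (vol d * \<rho> ^ d) \<le> emeasure (Rd d) ?L + ennreal (2 * (vol d * \<sigma> ^ d))"
    using \<sigma> vol_pos[of d] by (simp add: emeasure_eball[OF \<rho>] emeasure_eball[OF \<sigma>(1)] ennreal_plus[symmetric] del: ennreal_plus)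
  show ?thesis
  proof (cases "emeasure (Rd d) ?L")
    case (real m)
    then have "vol d * \<rho> ^ d \<le> m + 2 * (vol d * \<sigma> ^ d)"
      using le \<sigma> vol_pos[of d] by (simp add: ennreal_plus[symmetric] del: ennreal_plus)
    then show ?thesis
      unfolding real \<sigma>_def[symmetric] by (intro ennreal_leI) (simp add: algebra_simps)
  qed simp
qed

text \<open>With \<open>\<bar>u\<bar> = 1\<close> and \<open>r\<^sup>2 = \<eta>\<close>, the \<open>d\<close>-th power of this function is, up to a subexponential factor,
  the \<open>\<mu>\<close>-mass of the part of \<open>B(u, r)\<close> near the sphere of radius \<open>s\<close>. Its maximum
  lies inside the unit sphere precisely because \<open>\<alpha> > 1/2\<close>.\<close>
definition profile :: "real \<Rightarrow> real \<Rightarrow> real \<Rightarrow> real" where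
  "profile \<alpha> \<eta> s = s powr (- \<alpha>) * sqrt (\<eta> - (max 0 ((1 + \<eta> - s\<^sup>2) / 2))\<^sup>2)"

text \<open>In \<open>U = s^2\<close> the squared profile is
  \<open>U^(-\<alpha>) * (\<eta> - c^2)\<close>, where
  \<open>c = max 0 ((1 + \<eta> - U) / 2)\<close> is, when positive, the distance from
  \<open>u\<close> to the hyperplane in which the two spheres meet. Beyond \<open>1 + \<eta>\<close>
  only the weight varies. Below, the derivative has the sign of
  \<open>U * c - \<alpha> * (\<eta> - c^2)\<close>, and \<open>gap\<close> makes this negative while
  \<open>c \<le> \<eta> * (1 + \<eta>) / 2\<close>, that is,
  \<open>U \<ge> 1 - \<eta>^2\<close>.\<close>

lemma profile_decreasing:
  assumes \<alpha>: "\<alpha> < 1" and \<eta>: "0 < \<eta>" "\<eta> < 1" and gap: "(1 + \<eta>)\<^sup>2 < 2 * \<alpha>"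
    and s: "0 < s" "1 - \<eta>\<^sup>2 \<le> s\<^sup>2" "s < t"
  shows "profile \<alpha> \<eta> t < profile \<alpha> \<eta> s"
proof -
  define H where "H = (\<lambda>U. U powr (- \<alpha>) * (\<eta> - (max 0 ((1 + \<eta> - U) / 2))\<^sup>2))"
  have \<alpha>0: "0 < \<alpha>" using gap zero_le_power2[of "1 + \<eta>"] by linarith
  have prof: "profile \<alpha> \<eta> x = sqrt (H (x\<^sup>2))" if "0 < x" for x
  proof -
    have "(x\<^sup>2) powr (- \<alpha>) = (x powr (- \<alpha>))\<^sup>2"
      using that by (simp add: power2_eq_square powr_mult)
    then show ?thesis by (simp add: profile_def H_def real_sqrt_mult)
  qed
  have right: "H V < H U" if "1 + \<eta> \<le> U" "U < V" for U V
  proof -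
    have "V powr (- \<alpha>) < U powr (- \<alpha>)" using that \<alpha>0 \<eta> by (intro powr_less_mono2_neg) auto
    then show ?thesis using that \<eta> by (simp add: H_def)
  qed
  have e1: "\<eta>\<^sup>2 < 1" using \<eta> by (simp add: power_less_one_iff)
  have left: "H V < H U" if UV: "1 - \<eta>\<^sup>2 \<le> U" "U < V" "V \<le> 1 + \<eta>" for U V
  proof -
    define h where "h = (\<lambda>U. U powr (- \<alpha>) * (\<eta> - ((1 + \<eta> - U) / 2)\<^sup>2))"
    have "h V < h U"
    proof (rule DERIV_neg_imp_decreasing[OF UV(2)])
      fix x assume x: "U \<le> x" "x \<le> V"
      define c where "c = (1 + \<eta> - x) / 2"
      have x0: "0 < x" using x UV e1 by linarith
      have xc: "x = 1 + \<eta> - 2 * c" by (simp add: c_def field_simps)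
      have c: "0 \<le> c" "c \<le> \<eta> / 2 * (1 + \<eta>)" using x UV by (auto simp: c_def power2_eq_square algebra_simps)
      \<comment> \<open>Substituting \<open>x = 1 + \<eta> - 2 * c\<close> leaves the nonpositive
        term \<open>(\<alpha> - 2) * c^2\<close>.\<close>
      have "x * c + \<alpha> * c\<^sup>2 \<le> c * (1 + \<eta>)"
      proof -
        have "\<alpha> * c\<^sup>2 \<le> 2 * c\<^sup>2" using \<alpha> by (intro mult_right_mono) auto
        then show ?thesis unfolding xc by (simp add: power2_eq_square algebra_simps)
      qed
      also have "\<dots> \<le> \<eta> / 2 * (1 + \<eta>) * (1 + \<eta>)" using c \<eta> by (intro mult_right_mono) auto
      also have "\<dots> = \<eta> / 2 * (1 + \<eta>)\<^sup>2" by (simp add: power2_eq_square)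
      also have "\<dots> < \<eta> / 2 * (2 * \<alpha>)" using gap \<eta> by (intro mult_strict_left_mono) auto
      finally have neg: "x * c - \<alpha> * (\<eta> - c\<^sup>2) < 0" by (simp add: algebra_simps)
      have "(h has_real_derivative (- \<alpha> * x powr (- \<alpha> - 1) * (\<eta> - c\<^sup>2) + x powr (- \<alpha>) * c)) (at x)"
        unfolding h_def c_def using x0
        by (auto intro!: derivative_eq_intros simp: field_simps)
      moreover have "- \<alpha> * x powr (- \<alpha> - 1) * (\<eta> - c\<^sup>2) + x powr (- \<alpha>) * c
          = x powr (- \<alpha> - 1) * (x * c - \<alpha> * (\<eta> - c\<^sup>2))"
        using x0 by (simp add: powr_diff field_simps)
      moreover have "x powr (- \<alpha> - 1) * (x * c - \<alpha> * (\<eta> - c\<^sup>2)) < 0"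
        using neg x0 by (intro mult_pos_neg) auto
      ultimately show "\<exists>y. DERIV h x :> y \<and> y < 0" by auto
    qed
    moreover have "H W = h W" if "W \<le> 1 + \<eta>" for W using that by (simp add: H_def h_def max_def)
    ultimately show ?thesis using UV by simp
  qed
  have st: "s\<^sup>2 < t\<^sup>2" using s by (intro power_strict_mono) auto
  have "H (t\<^sup>2) < H (s\<^sup>2)"
  proof (cases "t\<^sup>2 \<le> 1 + \<eta>")
    case True
    then show ?thesis using left[of "s\<^sup>2" "t\<^sup>2"] s st by simp
  next
    case F: False
    show ?thesis
    proof (cases "1 + \<eta> \<le> s\<^sup>2")
      case True
      then show ?thesis using right[of "s\<^sup>2" "t\<^sup>2"] st by simp
    next
      case False
      then show ?thesis using right[of "1 + \<eta>" "t\<^sup>2"] left[of "s\<^sup>2" "1 + \<eta>"] F s by simp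
    qed
  qed
  then show ?thesis using s by (simp add: prof)
qed

text \<open>The profile drops strictly from \<open>s1\<close> to \<open>R\<close>, and a level
  \<theta> in between separates two exponential rates: outside \<open>B(0, R)\<close> the ball is
  covered by \<open>N\<close> shells of mass at most \<open>vol d * \<theta> ^ d\<close>, while its
  part in \<open>B(0, s1)\<close> has at least half of that mass for large \<open>d\<close>. Since
  \<open>N\<close> is independent of \<open>d\<close>, so is
  \<open>\<tau> = 1 / (1 + 2 * N)\<close>.\<close>

lemma exponential_concentration:
  assumes \<alpha>: "1 / 2 < \<alpha>" "\<alpha> < 1"
  shows "\<exists>r R \<tau> d0. 0 < r \<and> 0 < R \<and> R < 1 \<and> 0 < \<tau> \<and> (\<forall>d u. d0 \<le> d \<longrightarrow> enorm d u = 1 \<longrightarrow>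
    ennreal \<tau> * emeasure (mu (\<alpha> * real d) d) (eball d u r)
      \<le> emeasure (mu (\<alpha> * real d) d) (eball d u r \<inter> ball0 d R))"
proof -
  \<comment> \<open>\<open>1 + \<eta>\<close> is the midpoint of 1 and
    \<open>sqrt (2 * \<alpha>)\<close>, which makes \<open>gap\<close> strict.\<close>
  define \<eta> where "\<eta> = (sqrt (2 * \<alpha>) - 1) / 2"
  have sq: "1 < sqrt (2 * \<alpha>)" "sqrt (2 * \<alpha>) < 2"
    using \<alpha> by (auto simp: real_less_rsqrt intro: real_less_lsqrt)
  have \<eta>: "0 < \<eta>" "\<eta> < 1" using sq by (auto simp: \<eta>_def)
  have gap: "(1 + \<eta>)\<^sup>2 < 2 * \<alpha>"
  proof -
    have "1 + \<eta> < sqrt (2 * \<alpha>)" using sq by (simp add: \<eta>_def field_simps)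
    then have "(1 + \<eta>)\<^sup>2 < (sqrt (2 * \<alpha>))\<^sup>2" using \<eta> by (intro power_strict_mono) auto
    then show ?thesis using \<alpha> by simp
  qed
  have e1: "\<eta>\<^sup>2 < 1" using \<eta> by (simp add: power_less_one_iff)
  have e2: "\<eta>\<^sup>2 < \<eta>" using \<eta> by (simp add: power2_eq_square)
  have e0: "0 < \<eta>\<^sup>2" using \<eta> by simp
  define r where "r = sqrt \<eta>"
  have r: "0 < r" "r\<^sup>2 = \<eta>" using \<eta> by (auto simp: r_def)
  \<comment> \<open>\<open>1 - \<eta>^2\<close> is the smallest squared norm from which
    \<open>profile_decreasing\<close> applies; \<open>R\<close> is chosen strictly between
    \<open>s1\<close> and 1.\<close>
  define s1 where "s1 = sqrt (1 - \<eta>\<^sup>2)"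
  have s1: "0 < s1" "s1\<^sup>2 = 1 - \<eta>\<^sup>2" using e1 by (auto simp: s1_def)
  define R where "R = sqrt (1 - \<eta>\<^sup>2 / 2)"
  have R: "0 < R" "R\<^sup>2 = 1 - \<eta>\<^sup>2 / 2" "R < 1" using e0 e1 by (auto simp: R_def)
  have s1R: "s1 < R" using e0 by (simp add: s1_def R_def)
  define F where "F = profile \<alpha> \<eta>"
  have FR1: "F R < F s1" unfolding F_def using s1 s1R by (intro profile_decreasing \<alpha> \<eta> gap) auto
  have F_le: "F t \<le> F R" if "R \<le> t" for t
    using that profile_decreasing[OF \<alpha>(2) \<eta> gap R(1), of t] R e0
    by (cases "R = t") (auto simp: F_def)
  have cR: "max 0 ((1 + \<eta> - t\<^sup>2) / 2) \<le> \<eta>" if "R \<le> t" for t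
  proof -
    have "R\<^sup>2 \<le> t\<^sup>2" using that R by (intro power_mono) auto
    then show ?thesis using R e2 \<eta> by (auto simp: field_simps)
  qed
  have gpos: "0 < \<eta> - (max 0 ((1 + \<eta> - t\<^sup>2) / 2))\<^sup>2" if "R \<le> t" for t
  proof -
    have "(max 0 ((1 + \<eta> - t\<^sup>2) / 2))\<^sup>2 \<le> \<eta>\<^sup>2" using cR[OF that] by (intro power_mono) auto
    then show ?thesis using e2 by linarith
  qed
  have FR0: "0 < F R" unfolding F_def profile_def using gpos[of R] R by simp
  define \<theta> where "\<theta> = (F R + F s1) / 2"
  have \<theta>: "F R < \<theta>" "\<theta> < F s1" "0 < \<theta>" using FR1 FR0 by (auto simp: \<theta>_def)
  \<comment> \<open>Ratio of consecutive shell radii. Taking the weight at the inner and the lens at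
    the outer radius costs \<open>\<kappa> powr \<alpha>\<close>, which just raises the rate
    \<open>F R\<close> to \<theta>.\<close>
  define \<kappa> where "\<kappa> = (\<theta> / F R) powr (1 / \<alpha>)"
  have \<kappa>: "1 < \<kappa>" "\<kappa> powr \<alpha> * F R = \<theta>"
  proof -
    have "1 < \<theta> / F R" using \<theta> FR0 by simp
    then have "1 powr (1 / \<alpha>) < \<kappa>" unfolding \<kappa>_def using \<alpha> by (intro powr_less_mono2) auto
    then show "1 < \<kappa>" by simp
    show "\<kappa> powr \<alpha> * F R = \<theta>" unfolding \<kappa>_def powr_powr using \<theta> FR0 \<alpha> by simp
  qed
  obtain N :: nat where N: "1 + r \<le> R * \<kappa> ^ N"
  proof -
    obtain N where "(1 + r) / R < \<kappa> ^ N" using real_arch_pow[OF \<kappa>(1)] by blast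
    then show ?thesis using that[of N] R by (simp add: divide_less_eq mult.commute)
  qed
  define c where "c = \<eta> * (1 + \<eta>) / 2"
  have c: "0 \<le> c" "c \<le> 1" "1 + \<eta> - s1\<^sup>2 = 2 * c" using \<eta> e1 unfolding s1 c_def
    by (auto simp: power2_eq_square algebra_simps)
  \<comment> \<open>A ball of radius \<rho>, weighted as at norm \<open>s1\<close>, has rate exactly
    \<theta>. As \<open>\<theta> < F s1\<close>, this radius is below that of the lens, and the
    difference leaves room for a slab of half-width \<delta>.\<close>
  define \<rho> where "\<rho> = \<theta> * s1 powr \<alpha>"
  have \<rho>: "0 < \<rho>" using \<theta> s1 by (simp add: \<rho>_def)
  have \<rho>c: "\<rho>\<^sup>2 < \<eta> - c\<^sup>2"
  proof -
    have "F s1 = s1 powr (- \<alpha>) * sqrt (\<eta> - c\<^sup>2)" using c by (simp add: F_def profile_def max_def)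
    then have "\<rho> < (s1 powr (- \<alpha>) * sqrt (\<eta> - c\<^sup>2)) * s1 powr \<alpha>"
      unfolding \<rho>_def using \<theta> s1 by (intro mult_strict_right_mono) auto
    also have "\<dots> = sqrt (\<eta> - c\<^sup>2)" using s1 by (simp add: powr_minus)
    finally have "\<rho> < sqrt (\<eta> - c\<^sup>2)" .
    then show ?thesis using \<rho> by (metis less_eq_real_def not_less real_sqrt_le_iff real_sqrt_unique sqrt_le_D)
  qed
  define \<delta> where "\<delta> = min ((\<eta> - c\<^sup>2 - \<rho>\<^sup>2) / 2) (\<rho> / 2)"
  have \<delta>: "0 < \<delta>" "\<delta> < \<rho>" "\<rho>\<^sup>2 + 2 * \<delta> \<le> \<eta> - c\<^sup>2"
  proof -
    have "\<delta> \<le> (\<eta> - c\<^sup>2 - \<rho>\<^sup>2) / 2" unfolding \<delta>_def by (rule min.cobounded1)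
    moreover have "\<delta> \<le> \<rho> / 2" unfolding \<delta>_def by (rule min.cobounded2)
    ultimately
    show "\<delta> < \<rho>" "\<rho>\<^sup>2 + 2 * \<delta> \<le> \<eta> - c\<^sup>2" using \<rho> by (auto simp: field_simps)
    show "0 < \<delta>" using \<rho>c \<rho> by (simp add: \<delta>_def)
  qed
  define \<omega> where "\<omega> = sqrt (\<rho>\<^sup>2 - \<delta>\<^sup>2) / \<rho>"
  have lt: "\<delta>\<^sup>2 < \<rho>\<^sup>2" using \<delta> by (intro power_strict_mono) auto
  have \<omega>: "0 \<le> \<omega>" "\<omega> < 1"
  proof -
    have "sqrt (\<rho>\<^sup>2 - \<delta>\<^sup>2) < sqrt (\<rho>\<^sup>2)" using \<delta> by (intro real_sqrt_less_mono) simp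
    then show "\<omega> < 1" using \<rho> by (simp add: \<omega>_def)
    show "0 \<le> \<omega>" using \<rho> lt by (simp add: \<omega>_def)
  qed
  \<comment> \<open>From dimension \<open>d0\<close> on, the two caps outside the slab have at most
    half the volume of the ball of radius \<rho>.\<close>
  obtain d0 :: nat where d0: "\<omega> ^ d0 < 1 / 4"
    using real_arch_pow_inv[of "1 / 4" \<omega>] \<omega> by auto
  define \<tau> where "\<tau> = 1 / (1 + 2 * real N)"
  have main: "ennreal \<tau> * emeasure (mu (\<alpha> * real d) d) (eball d u r)
      \<le> emeasure (mu (\<alpha> * real d) d) (eball d u r \<inter> ball0 d R)"
    if d: "d0 \<le> d" and u: "enorm d u = 1" for d u
  proof -
    let ?\<mu> = "mu (\<alpha> * real d) d"
    note v = vol_pos[of d]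
    have a0: "0 \<le> \<alpha> * real d" using \<alpha> by simp
    let ?I = "eball d u r \<inter> ball0 d R"
    define shell where "shell = (\<lambda>k. {y \<in> eball d u r. R * \<kappa> ^ k \<le> enorm d y \<and> (enorm d y)\<^sup>2 \<le> (R * \<kappa> ^ Suc k)\<^sup>2})"
    have shell_m [measurable]: "shell k \<in> sets (Rd d)" for k
    proof -
      have "shell k = eball d u r \<inter> {y \<in> space (Rd d). R * \<kappa> ^ k \<le> enorm d y \<and> (enorm d y)\<^sup>2 \<le> (R * \<kappa> ^ Suc k)\<^sup>2}"
        by (auto simp: shell_def eball_def)
      then show ?thesis by simp
    qed
    have cover: "eball d u r \<subseteq> ?I \<union> (\<Union>k<N. shell k)"
    proof
      fix y assume y: "y \<in> eball d u r"
      have y1: "enorm d y \<le> 1 + r"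
        using subsetD[OF eball_subset_centered y] u by (simp add: eball_0)
      show "y \<in> ?I \<union> (\<Union>k<N. shell k)"
      proof (cases "enorm d y \<le> R")
        case True
        then show ?thesis using y by (simp add: eball_0 eball_def)
      next
        case False
        define n where "n = (LEAST n. enorm d y \<le> R * \<kappa> ^ n)"
        have "enorm d y \<le> R * \<kappa> ^ N" using y1 N by simp
        then have n: "enorm d y \<le> R * \<kappa> ^ n" "n \<le> N"
          unfolding n_def by (auto intro: LeastI Least_le)
        have "n \<noteq> 0" using n False by (cases n) auto
        then obtain k where k: "n = Suc k" by (cases n) auto
        have "\<not> enorm d y \<le> R * \<kappa> ^ k"
          using not_less_Least[of k "\<lambda>n. enorm d y \<le> R * \<kappa> ^ n"] k unfolding n_def by simp
        then have "y \<in> shell k"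
          using n k y unfolding shell_def by (auto intro!: power_mono simp del: power_Suc)
        then show ?thesis using n k by auto
      qed
    qed
    have shell_le: "emeasure ?\<mu> (shell k) \<le> ennreal (vol d * \<theta> ^ d)" for k
    proof -
      define s where "s = R * \<kappa> ^ k"
      have \<kappa>k: "1 \<le> \<kappa> ^ k" "1 \<le> \<kappa> ^ Suc k" using \<kappa> by (auto simp del: power_Suc intro!: one_le_power)
      have s: "0 < s" "R \<le> \<kappa> * s" and sS: "R * \<kappa> ^ Suc k = \<kappa> * s"
        using \<kappa>k R mult_left_mono[OF \<kappa>k(2), of R] by (auto simp: s_def mult_ac)
      define c' where "c' = max 0 ((1 + \<eta> - (\<kappa> * s)\<^sup>2) / 2)"
      define \<rho>' where "\<rho>' = sqrt (\<eta> - c'\<^sup>2)"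
      have g: "0 < \<eta> - c'\<^sup>2" using gpos[OF s(2)] by (simp add: c'_def)
      then have \<rho>': "0 < \<rho>'" "\<rho>'\<^sup>2 = \<eta> - c'\<^sup>2" by (auto simp: \<rho>'_def)
      have c'1: "0 \<le> c'" "c' \<le> 1" using cR[OF s(2)] \<eta> by (auto simp: c'_def)
      \<comment> \<open>With \<open>k = 1 - c'\<close> the centre lies in the hyperplane where the
        two spheres meet, and equality holds. If \<open>c' = 0\<close>, then \<open>k = 1\<close>
        and the ball is used whole.\<close>
      have ineq: "(1 - (1 - c')) * (\<kappa> * s)\<^sup>2 + (1 - c') * r\<^sup>2 - (1 - c') * (1 - (1 - c')) \<le> \<rho>'\<^sup>2"
      proof (cases "c' = 0")
        case True
        then show ?thesis using r \<rho>' by simp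
      next
        case False
        then have sq: "(\<kappa> * s)\<^sup>2 = 1 + \<eta> - 2 * c'" by (auto simp: c'_def max_def field_simps split: if_splits)
        show ?thesis unfolding sq \<rho>' r by (simp add: power2_eq_square algebra_simps)
      qed
      have "emeasure ?\<mu> (shell k) \<le> ennreal (s powr (- (\<alpha> * real d)) * (vol d * \<rho>' ^ d))"
        unfolding shell_def s_def[symmetric] sS
        by (rule shell_measure[OF u _ _ less_imp_le[OF r(1)] \<rho>'(1) ineq s(1) a0]) (use c'1 in auto)
      also have "s powr (- (\<alpha> * real d)) * (vol d * \<rho>' ^ d) = vol d * (s powr (- \<alpha>) * \<rho>') ^ d"
        using powr_times_nat[OF s(1), of "- \<alpha>" d] by (simp add: power_mult_distrib)
      also have "s powr (- \<alpha>) * \<rho>' = \<kappa> powr \<alpha> * F (\<kappa> * s)"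
        using s \<kappa> by (simp add: F_def profile_def \<rho>'_def c'_def powr_mult powr_minus)
      also have "ennreal (vol d * (\<kappa> powr \<alpha> * F (\<kappa> * s)) ^ d) \<le> ennreal (vol d * \<theta> ^ d)"
        unfolding \<kappa>(2)[symmetric] using v F_le[OF s(2)] gpos[OF s(2)]
        by (intro ennreal_leI mult_left_mono power_mono) (auto simp: F_def profile_def)
      finally show ?thesis .
    qed
    have inner: "ennreal (vol d * \<theta> ^ d / 2) \<le> emeasure ?\<mu> ?I"
    proof -
      let ?J = "eball d u r \<inter> ball0 d s1"
      have "\<omega> ^ d \<le> \<omega> ^ d0" using d \<omega> by (intro power_decreasing) auto
      then have "\<theta> ^ d * (1 / 2) \<le> \<theta> ^ d * (1 - 2 * \<omega> ^ d)" using d0 \<theta> by (intro mult_left_mono) auto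
      also have "\<dots> = s1 powr (- (\<alpha> * real d)) * (\<rho> ^ d - 2 * sqrt (\<rho>\<^sup>2 - \<delta>\<^sup>2) ^ d)"
      proof -
        have "sqrt (\<rho>\<^sup>2 - \<delta>\<^sup>2) = \<omega> * \<rho>" using \<rho> by (simp add: \<omega>_def)
        moreover have "s1 powr (- (\<alpha> * real d)) * \<rho> ^ d = \<theta> ^ d"
        proof -
          have "s1 powr (- (\<alpha> * real d)) = (s1 powr (- \<alpha>)) ^ d"
            using powr_times_nat[OF s1(1), of "- \<alpha>" d] by simp
          then have "s1 powr (- (\<alpha> * real d)) * \<rho> ^ d = (s1 powr (- \<alpha>) * \<rho>) ^ d"
            by (simp add: power_mult_distrib)
          also have "s1 powr (- \<alpha>) * \<rho> = \<theta>" using s1 by (simp add: \<rho>_def powr_minus)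
          finally show ?thesis .
        qed
        ultimately show ?thesis by (simp add: power_mult_distrib algebra_simps)
      qed
      finally have "vol d * \<theta> ^ d / 2 \<le> s1 powr (- (\<alpha> * real d)) * (vol d * (\<rho> ^ d - 2 * sqrt (\<rho>\<^sup>2 - \<delta>\<^sup>2) ^ d))"
        using mult_left_mono[of "\<theta> ^ d * (1 / 2)" _ "vol d"] v by (simp add: mult_ac)
      then have "ennreal (vol d * \<theta> ^ d / 2)
          \<le> ennreal (s1 powr (- (\<alpha> * real d))) * ennreal (vol d * (\<rho> ^ d - 2 * sqrt (\<rho>\<^sup>2 - \<delta>\<^sup>2) ^ d))"
        by (subst ennreal_mult'[symmetric]) (auto intro: ennreal_leI)
      also have "\<dots> \<le> ennreal (s1 powr (- (\<alpha> * real d))) * emeasure (Rd d) ?J"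
      proof (intro mult_left_mono slab_volume[where k = "1 - c"] u)
        show "\<rho>\<^sup>2 + 2 * \<delta> + (1 - (1 - c))\<^sup>2 \<le> r\<^sup>2" using \<delta> r by simp
        show "\<rho>\<^sup>2 + 2 * \<delta> + (1 - c)\<^sup>2 \<le> s1\<^sup>2" using \<delta> c by (simp add: power2_eq_square algebra_simps)
      qed (use c \<delta> r s1 in auto)
      \<comment> \<open>The pointwise lower bound on the weight fails at the origin because
        \<open>0 powr b = 0\<close>; removing this point costs no volume.\<close>
      also have "\<dots> \<le> emeasure ?\<mu> (?J - {y \<in> space (Rd d). enorm d y = 0})"
      proof -
        have d1: "1 \<le> d" using u by (cases d) (auto simp: enorm_def)
        have "emeasure (Rd d) ?J = emeasure (Rd d) (?J - {y \<in> space (Rd d). enorm d y = 0})"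
          by (rule emeasure_Diff_null_set[symmetric]) (auto simp: null_sets_def Rd_origin[OF d1])
        moreover have "ennreal (s1 powr (- (\<alpha> * real d))) * emeasure (Rd d) (?J - {y \<in> space (Rd d). enorm d y = 0})
           \<le> emeasure ?\<mu> (?J - {y \<in> space (Rd d). enorm d y = 0})"
          using a0 by (intro mu_ge) (auto simp: eball_0 less_le intro!: powr_mono2')
        ultimately show ?thesis by simp
      qed
      also have "\<dots> \<le> emeasure ?\<mu> ?I"
        using s1R by (intro emeasure_mono) (auto simp: eball_0)
      finally show ?thesis .
    qed
    have "emeasure ?\<mu> (eball d u r) \<le> emeasure ?\<mu> (?I \<union> (\<Union>k<N. shell k))"
      by (intro emeasure_mono cover) auto
    also have "\<dots> \<le> emeasure ?\<mu> ?I + emeasure ?\<mu> (\<Union>k<N. shell k)"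
      by (intro emeasure_subadditive) auto
    also have "emeasure ?\<mu> (\<Union>k<N. shell k) \<le> (\<Sum>k<N. emeasure ?\<mu> (shell k))"
      by (intro emeasure_subadditive_finite) auto
    also have "\<dots> \<le> (\<Sum>k<N. ennreal (vol d * \<theta> ^ d))" by (intro sum_mono shell_le)
    also have "\<dots> = ennreal (2 * real N) * ennreal (vol d * \<theta> ^ d / 2)"
      using v \<theta> by (simp add: ennreal_mult'[symmetric] ennreal_of_nat_eq_real_of_nat)
    also have "\<dots> \<le> ennreal (2 * real N) * emeasure ?\<mu> ?I" by (intro mult_left_mono inner) auto
    also have "emeasure ?\<mu> ?I + ennreal (2 * real N) * emeasure ?\<mu> ?I = ennreal (1 + 2 * real N) * emeasure ?\<mu> ?I"
      by (simp add: distrib_right)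
    finally have "ennreal \<tau> * emeasure ?\<mu> (eball d u r) \<le> ennreal \<tau> * (ennreal (1 + 2 * real N) * emeasure ?\<mu> ?I)"
      by (auto intro: mult_left_mono add_left_mono)
    also have "\<dots> = ennreal (\<tau> * (1 + 2 * real N)) * emeasure ?\<mu> ?I"
      by (simp add: mult.assoc[symmetric] ennreal_mult'' del: ennreal_plus)
    also have "\<tau> * (1 + 2 * real N) = 1" by (simp add: \<tau>_def)
    finally show ?thesis by simp
  qed
  show ?thesis
    by (intro exI[of _ r] exI[of _ R] exI[of _ \<tau>] exI[of _ d0]) (use r R main in \<open>auto simp: \<tau>_def\<close>)
qed

text \<open>Homogeneity carries the concentration from norm 1 to every norm
  \<open>\<xi> \<le> 1\<close>, with \<open>B(0, \<xi> R)\<close> inside \<open>B(0, R)\<close>. So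
  \<open>S\<close> can be the punctured unit ball, whose mass is that of \<open>B(0, R)\<close>
  times \<open>R powr (- ((1 - \<alpha>) * d))\<close>.\<close>

lemma weak_const_exponential:
  assumes \<alpha>: "1 / 2 < \<alpha>" "\<alpha> < 1" and p: "1 \<le> p"
  shows "\<exists>b>1. \<exists>K>0. \<forall>d\<ge>1. ennreal (K * b ^ d) \<le> weak_const p (\<alpha> * real d) d"
proof -
  obtain r R \<tau> d0 where r: "0 < r" and R: "0 < R" "R < 1" and \<tau>: "0 < \<tau>"
    and conc: "\<And>d u. d0 \<le> d \<Longrightarrow> enorm d u = 1 \<Longrightarrow>
      ennreal \<tau> * emeasure (mu (\<alpha> * real d) d) (eball d u r)
        \<le> emeasure (mu (\<alpha> * real d) d) (eball d u r \<inter> ball0 d R)"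
    using exponential_concentration[OF \<alpha>] by blast
  define b where "b = R powr (- ((1 - \<alpha>) / p))"
  have b: "1 < b" unfolding b_def using R \<alpha> p powr_less_mono2_neg[of "- ((1 - \<alpha>) / p)" R 1] by simp
  \<comment> \<open>The second entry keeps the bound below 1/4 in dimensions under
    \<open>d0\<close>, where only \<open>weak_const_ge_half\<close> is at hand.\<close>
  define K where "K = min (\<tau> / 2) (1 / 4 / b ^ d0)"
  have K: "0 < K" "K \<le> \<tau> / 2" "K * b ^ d0 \<le> 1 / 4"
    using \<tau> b by (auto simp: K_def min_def field_simps)
  have "ennreal (K * b ^ d) \<le> weak_const p (\<alpha> * real d) d" if d: "1 \<le> d" for d
  proof (cases "d0 \<le> d")
    case False
    have ad: "\<alpha> * real d < real d" using \<alpha> d by simp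
    have "K * b ^ d \<le> K * b ^ d0" using False b K by (intro mult_left_mono power_increasing) auto
    also have "\<dots> \<le> 1 / 4" by (rule K)
    also have "\<dots> \<le> 1 / 2 * (1 / 2) powr (1 / p)"
    proof -
      have "(1 / 2) powr 1 \<le> (1 / 2 :: real) powr (1 / p)" using p by (intro powr_mono') auto
      then show ?thesis by simp
    qed
    finally show ?thesis using weak_const_ge_half[OF d ad p] by (meson ennreal_leI order_trans)
  next
    case True
    let ?\<mu> = "mu (\<alpha> * real d) d"
    have ad: "\<alpha> * real d < real d" using \<alpha> d by simp
    define Z where "Z = {y \<in> space (Rd d). enorm d y = 0}"
    have Z[measurable]: "Z \<in> sets (Rd d)" unfolding Z_def by measurable
    define S where "S = ball0 d 1 - Z"
    have "ennreal (\<tau> / 2 * (measure ?\<mu> S / measure ?\<mu> (ball0 d R)) powr (1 / p)) \<le> weak_const p (\<alpha> * real d) d"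
    proof (rule weak_const_ge[OF d ad R(1) p \<tau>])
      fix x assume "x \<in> S"
      then have x: "0 < enorm d x" "enorm d x \<le> 1"
        by (auto simp: S_def Z_def eball_0 less_le)
      define \<xi> where "\<xi> = enorm d x"
      define u where "u = (\<lambda>i. x i / \<xi>)"
      have \<xi>: "0 < \<xi>" "\<xi> \<le> 1" using x by (auto simp: \<xi>_def)
      have u: "enorm d u = 1" and xu: "x = (\<lambda>i. \<xi> * u i)"
        using normalize_direction[of d x] \<xi> unfolding u_def \<xi>_def by auto
      have "ennreal \<tau> * emeasure ?\<mu> (eball d x (\<xi> * r))
          = ennreal (\<xi> powr (real d - \<alpha> * real d)) * (ennreal \<tau> * emeasure ?\<mu> (eball d u r))"
        unfolding xu by (subst mu_eball_scale[OF \<xi>(1)]) (simp add: mult_ac)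
      also have "\<dots> \<le> ennreal (\<xi> powr (real d - \<alpha> * real d)) * emeasure ?\<mu> (eball d u r \<inter> ball0 d R)"
        by (intro mult_left_mono conc True u) auto
      also have "\<dots> = emeasure ?\<mu> (eball d x (\<xi> * r) \<inter> ball0 d (\<xi> * R))"
      proof -
        have "{y \<in> space (Rd d). aff d (\<lambda>_. 0) \<xi> y \<in> eball d x (\<xi> * r) \<inter> ball0 d (\<xi> * R)}
            = eball d u r \<inter> ball0 d R"
          using aff_scale_eball[OF \<xi>(1), of d u r] aff_scale_eball[OF \<xi>(1), of d "\<lambda>_. 0" R]
          unfolding xu[symmetric] by auto
        then show ?thesis
          using mu_scale[OF \<xi>(1), of "eball d x (\<xi> * r) \<inter> ball0 d (\<xi> * R)" d "\<alpha> * real d"] by simp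
      qed
      also have "\<dots> \<le> emeasure ?\<mu> (eball d x (\<xi> * r) \<inter> ball0 d R)"
      proof -
        have "\<xi> * R \<le> R" using \<xi> R by (intro mult_left_le_one_le) auto
        then have "ball0 d (\<xi> * R) \<subseteq> ball0 d R" by (auto simp: eball_0)
        then show ?thesis by (intro emeasure_mono) auto
      qed
      finally show "\<exists>r>0. ennreal \<tau> * emeasure ?\<mu> (eball d x r) \<le> emeasure ?\<mu> (eball d x r \<inter> ball0 d R)"
        using \<xi> r by (intro exI[of _ "\<xi> * r"]) auto
    qed (auto simp: S_def)
    moreover have "(measure ?\<mu> S / measure ?\<mu> (ball0 d R)) powr (1 / p) = b ^ d"
    proof -
      have "emeasure ?\<mu> S = emeasure ?\<mu> (ball0 d 1)"
        unfolding S_def by (rule emeasure_Diff_null_set) (use mu_origin in \<open>auto simp: null_sets_def Z_def\<close>)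
      then have "measure ?\<mu> S / measure ?\<mu> (ball0 d R) = 1 / R powr (real d - \<alpha> * real d)"
        using R vol_pos[of d] ad d by (simp add: measure_def mu_eball_0)
      also have "\<dots> = R powr (- ((1 - \<alpha>) * real d))"
        by (simp add: powr_minus[symmetric] divide_inverse algebra_simps)
      also have "\<dots> powr (1 / p) = b ^ d"
        using powr_times_nat[OF R(1), of "- ((1 - \<alpha>) / p)" d] by (simp add: b_def powr_powr)
      finally show ?thesis .
    qed
    moreover have "K * b ^ d \<le> \<tau> / 2 * b ^ d" using K b by (intro mult_right_mono) auto
    ultimately show ?thesis by (metis ennreal_leI order_trans)
  qed
  then show ?thesis using b K by blast
qed

section \<open>Polar coordinates\<close>

lemma emeasure_uniform_unit_ball:
  assumes "A \<in> sets (Rd d)"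
  shows "ennreal (vol d) * emeasure (uniform_measure (Rd d) (ball0 d 1)) A
    = emeasure (Rd d) (ball0 d 1 \<inter> A)"
proof -
  have V: "emeasure (Rd d) (ball0 d 1) = ennreal (vol d)" by (simp add: emeasure_eball)
  have "ennreal (vol d) * (emeasure (Rd d) (ball0 d 1 \<inter> A) / ennreal (vol d))
      = emeasure (Rd d) (ball0 d 1 \<inter> A) * ennreal (vol d) / ennreal (vol d)"
    by (simp add: ennreal_times_divide mult.commute)
  also have "\<dots> = emeasure (Rd d) (ball0 d 1 \<inter> A)"
    using vol_pos[of d] by (simp add: mult_divide_eq_ennreal)
  finally show ?thesis
    using assms by (simp add: V)
qed

lemma sigma_finite_atMost:
  fixes M :: "real measure"
  assumes "sets M = sets borel" "\<And>t. emeasure M {..t} < \<infinity>"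
  shows "sigma_finite_measure M"
proof
  have "(\<Union>i. {..real i}) = (UNIV :: real set)" by (auto intro: real_arch_simple)
  then have "\<Union> (range (\<lambda>i. {..real i})) = space M"
    using sets_eq_imp_space_eq[OF assms(1)] by simp
  then show "\<exists>A. countable A \<and> A \<subseteq> sets M \<and> \<Union> A = space M \<and> (\<forall>a\<in>A. emeasure M a \<noteq> \<infinity>)"
    using assms by (intro exI[of _ "range (\<lambda>i. {..real i})"]) (auto simp: less_top)
qed

lemma distr_enorm_atMost_finite: "emeasure (distr (Rd d) borel (enorm d)) {..t} < \<infinity>"
proof -
  have "emeasure (distr (Rd d) borel (enorm d)) {..t} \<le> emeasure (Rd d) (ball0 d (max t 1))"
    by (subst emeasure_distr) (auto intro!: emeasure_mono simp: eball_0)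
  also have "\<dots> < \<infinity>" by (simp add: emeasure_eball)
  finally show ?thesis .
qed

text \<open>Polar coordinates without a surface measure: a \<open>0\<close>-homogeneous statistic \<open>T\<close>, distributed
  as under a uniform point of the unit ball, is independent of the norm.\<close>
definition angular :: "nat \<Rightarrow> ((nat \<Rightarrow> real) \<Rightarrow> real) \<Rightarrow> real measure" where
  "angular d T = distr (uniform_measure (Rd d) (ball0 d 1)) borel T"

lemma prob_space_angular:
  assumes [measurable]: "T \<in> borel_measurable (Rd d)"
  shows "prob_space (angular d T)"
proof -
  have "prob_space (uniform_measure (Rd d) (ball0 d 1))"
    using emeasure_unit_ball_pos[of d] emeasure_unit_ball_finite[of d]
    by (intro prob_space_uniform_measure) auto
  then show ?thesis
    unfolding angular_def by (rule prob_space.prob_space_distr) simp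
qed

text \<open>For fixed \<open>B\<close>, restrict Lebesgue measure to \<open>T \<in> B\<close> and
  push it forward by the norm. The dilation by \<open>t\<close> carries the restricted unit ball
  onto the restricted \<open>B(0, t)\<close>, so on half-lines the result is a constant multiple of
  the unrestricted one.\<close>

lemma distr_polar:
  assumes d: "1 \<le> d" and T[measurable]: "T \<in> borel_measurable (Rd d)"
    and hom: "\<And>c y. 0 < c \<Longrightarrow> y \<in> space (Rd d) \<Longrightarrow> T (aff d (\<lambda>_. 0) c y) = T y"
  shows "distr (Rd d) borel (enorm d) \<Otimes>\<^sub>M angular d T
    = distr (Rd d) (borel \<Otimes>\<^sub>M borel) (\<lambda>y. (enorm d y, T y))"
proof (rule pair_measure_eqI)
  let ?\<nu> = "distr (Rd d) borel (enorm d)"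
  show "sigma_finite_measure ?\<nu>"
    by (rule sigma_finite_atMost) (simp, rule distr_enorm_atMost_finite)
  interpret prob_space "angular d T" by (rule prob_space_angular[OF T])
  show "sigma_finite_measure (angular d T)" by unfold_locales
  show "sets (?\<nu> \<Otimes>\<^sub>M angular d T) = sets (distr (Rd d) (borel \<Otimes>\<^sub>M borel) (\<lambda>y. (enorm d y, T y)))"
    unfolding sets_distr by (intro sets_pair_measure_cong) (auto simp: angular_def)
  fix A B :: "real set" assume "A \<in> sets ?\<nu>" "B \<in> sets (angular d T)"
  then have A[measurable]: "A \<in> sets borel" and B[measurable]: "B \<in> sets borel"
    by (auto simp: angular_def)
  define TB where "TB = T -` B \<inter> space (Rd d)"
  have TB[measurable]: "TB \<in> sets (Rd d)" unfolding TB_def by measurable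
  have \<kappa>: "ennreal (vol d) * emeasure (angular d T) B = emeasure (Rd d) (ball0 d 1 \<inter> TB)"
  proof -
    have "emeasure (angular d T) B = emeasure (uniform_measure (Rd d) (ball0 d 1)) TB"
      unfolding angular_def TB_def by (subst emeasure_distr) simp_all
    then show ?thesis by (simp only: emeasure_uniform_unit_ball[OF TB])
  qed
  let ?M = "distr (density (Rd d) (indicator TB)) borel (enorm d)"
  have eM: "emeasure ?M X = emeasure (Rd d) (TB \<inter> (enorm d -` X \<inter> space (Rd d)))" if [measurable]: "X \<in> sets borel" for X
  proof -
    have [measurable]: "enorm d -` X \<inter> space (Rd d) \<in> sets (Rd d)" by measurable
    have "emeasure ?M X = emeasure (density (Rd d) (indicator TB)) (enorm d -` X \<inter> space (Rd d))"
      by (subst emeasure_distr) auto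
    also have "\<dots> = (\<integral>\<^sup>+y. indicator TB y * indicator (enorm d -` X \<inter> space (Rd d)) y \<partial>Rd d)"
      by (rule emeasure_density) measurable
    also have "\<dots> = (\<integral>\<^sup>+y. indicator (TB \<inter> (enorm d -` X \<inter> space (Rd d))) y \<partial>Rd d)"
      by (intro nn_integral_cong) (auto split: split_indicator)
    finally show ?thesis by simp
  qed
  have "?M = density ?\<nu> (\<lambda>_. emeasure (angular d T) B)"
  proof (rule borel_measure_eqI_atMost)
    fix t :: real
    have pre: "enorm d -` {..t} \<inter> space (Rd d) = ball0 d t" by (auto simp: eball_0)
    have N: "emeasure (density ?\<nu> (\<lambda>_. emeasure (angular d T) B)) {..t}
        = emeasure (angular d T) B * emeasure (Rd d) (ball0 d t)"
      by (subst emeasure_density_const) (auto simp: emeasure_distr pre)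
    show "emeasure ?M {..t} = emeasure (density ?\<nu> (\<lambda>_. emeasure (angular d T) B)) {..t}"
    proof (cases "0 < t")
      case True
      have "{y \<in> space (Rd d). aff d (\<lambda>_. 0) t y \<in> TB \<inter> ball0 d t} = ball0 d 1 \<inter> TB"
        using True hom[OF True] by (auto simp: TB_def eball_0 enorm_aff0)
      then have "emeasure (Rd d) (TB \<inter> ball0 d t) = ennreal (t ^ d) * emeasure (Rd d) (ball0 d 1 \<inter> TB)"
        using emeasure_Rd_affine[of t "TB \<inter> ball0 d t" d "\<lambda>_. 0"] True by simp
      also have "\<dots> = emeasure (angular d T) B * (ennreal (vol d) * ennreal (t ^ d))"
        unfolding \<kappa>[symmetric] by (simp add: mult_ac)
      also have "ennreal (vol d) * ennreal (t ^ d) = emeasure (Rd d) (ball0 d t)"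
        using True vol_pos[of d] by (simp add: emeasure_eball ennreal_mult')
      finally show ?thesis by (simp add: eM pre N)
    next
      case False
      have "emeasure (Rd d) (ball0 d t) \<le> emeasure (Rd d) {y \<in> space (Rd d). enorm d y = 0}"
        using False by (intro emeasure_mono) (auto simp: eball_0 intro: antisym order_trans)
      then have 0: "emeasure (Rd d) (ball0 d t) = 0" using Rd_origin[OF d] by simp
      then have "emeasure (Rd d) (TB \<inter> ball0 d t) \<le> 0"
        using emeasure_mono[of "TB \<inter> ball0 d t" "ball0 d t" "Rd d"] by simp
      then show ?thesis using 0 by (simp add: eM pre N)
    qed
    have "emeasure ?M {..t} = emeasure (Rd d) (TB \<inter> (enorm d -` {..t} \<inter> space (Rd d)))"
      by (rule eM) simp
    also have "\<dots> \<le> emeasure (Rd d) (enorm d -` {..t} \<inter> space (Rd d))"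
      by (intro emeasure_mono) auto
    also have "\<dots> = emeasure ?\<nu> {..t}" by (subst emeasure_distr) auto
    also have "\<dots> < \<infinity>" by (rule distr_enorm_atMost_finite)
    finally show "emeasure ?M {..t} < \<infinity>" .
  qed auto
  then have "emeasure ?M A = emeasure (angular d T) B * emeasure ?\<nu> A"
    using emeasure_density_const[of A ?\<nu> "emeasure (angular d T) B"] by simp
  moreover have "emeasure ?M A = emeasure (distr (Rd d) (borel \<Otimes>\<^sub>M borel) (\<lambda>y. (enorm d y, T y))) (A \<times> B)"
  proof -
    have "(\<lambda>y. (enorm d y, T y)) -` (A \<times> B) \<inter> space (Rd d) = TB \<inter> (enorm d -` A \<inter> space (Rd d))"
      by (auto simp: TB_def)
    then have "emeasure (distr (Rd d) (borel \<Otimes>\<^sub>M borel) (\<lambda>y. (enorm d y, T y))) (A \<times> B)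
        = emeasure (Rd d) (TB \<inter> (enorm d -` A \<inter> space (Rd d)))"
      by (subst emeasure_distr) simp_all
    then show ?thesis using eM[OF A] by simp
  qed
  ultimately show "emeasure ?\<nu> A * emeasure (angular d T) B
      = emeasure (distr (Rd d) (borel \<Otimes>\<^sub>M borel) (\<lambda>y. (enorm d y, T y))) (A \<times> B)"
    by (simp add: mult.commute)
qed

section \<open>The radial part of the weighted measure\<close>

definition rad :: "real \<Rightarrow> nat \<Rightarrow> real measure" where
  "rad a d = distr (mu a d) borel (enorm d)"

lemma sets_rad [simp, measurable_cong]: "sets (rad a d) = sets borel"
  by (simp add: rad_def)

lemma space_rad [simp]: "space (rad a d) = UNIV"
  by (simp add: rad_def)

lemma rad_density: "rad a d = density (distr (Rd d) borel (enorm d)) (\<lambda>s. ennreal (s powr (- a)))"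
  unfolding rad_def mu_def by (rule density_distr[symmetric]) auto

lemma nn_integral_rad:
  "h \<in> borel_measurable borel \<Longrightarrow> (\<integral>\<^sup>+s. h s \<partial>rad a d) = (\<integral>\<^sup>+y. h (enorm d y) \<partial>mu a d)"
  unfolding rad_def by (subst nn_integral_distr) auto

lemma rad_nonpos: "emeasure (rad a d) {..0} = 0"
proof -
  have "enorm d -` {..0} \<inter> space (mu a d) = {y \<in> space (Rd d). enorm d y = 0}"
    by (auto intro: antisym)
  then show ?thesis unfolding rad_def by (subst emeasure_distr) (auto simp: mu_origin)
qed

lemma rad_interval_finite:
  assumes "0 < p"
  shows "emeasure (rad a d) {p..q} < \<infinity>"
proof -
  define k where "k = max (p powr (- a)) (q powr (- a))"
  have "emeasure (rad a d) {p..q} = emeasure (mu a d) {y \<in> space (Rd d). p \<le> enorm d y \<and> enorm d y \<le> q}"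
    unfolding rad_def by (subst emeasure_distr) (auto intro!: arg_cong[where f="emeasure _"])
  also have "\<dots> \<le> ennreal k * emeasure (Rd d) {y \<in> space (Rd d). p \<le> enorm d y \<and> enorm d y \<le> q}"
  proof (rule mu_le)
    fix y assume y: "y \<in> {y \<in> space (Rd d). p \<le> enorm d y \<and> enorm d y \<le> q}"
    show "enorm d y powr (- a) \<le> k"
    proof (cases "0 \<le> a")
      case True
      then have "enorm d y powr (- a) \<le> p powr (- a)" using y assms by (intro powr_mono2') auto
      then show ?thesis by (simp add: k_def)
    next
      case False
      then have "enorm d y powr (- a) \<le> q powr (- a)" using y by (intro powr_mono2) auto
      then show ?thesis by (simp add: k_def)
    qed
  qed measurable
  also have "\<dots> \<le> ennreal k * emeasure (Rd d) (ball0 d (max q 1))"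
    by (intro mult_left_mono emeasure_mono) (auto simp: eball_0)
  also have "\<dots> < \<infinity>" by (simp add: emeasure_eball ennreal_mult_less_top)
  finally show ?thesis .
qed

text \<open>Mass may be infinite near 0, so the exhaustion uses intervals away from 0 together with
  the null half-line \<open>{..0}\<close>.\<close>

lemma sigma_finite_rad: "sigma_finite_measure (rad a d)"
proof
  define U where "U = insert {..0} (range (\<lambda>n. {1 / real (Suc n)..real (Suc n)}))"
  have "x \<in> \<Union> U" for x :: real
  proof (cases "x \<le> 0")
    case False
    obtain n where n: "max x (1 / x) < real n" using reals_Archimedean2 by blast
    then have "x \<le> real (Suc n)" "1 / x \<le> real (Suc n)" by auto
    then have "1 / real (Suc n) \<le> x" "x \<le> real (Suc n)" using False by (auto simp: field_simps)
    then show ?thesis by (auto simp: U_def simp del: of_nat_Suc)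
  qed (simp add: U_def)
  then have "\<Union> U = UNIV" by blast
  moreover have "emeasure (rad a d) {1 / real (Suc n)..real (Suc n)} \<noteq> \<infinity>" for n
    using rad_interval_finite[of "1 / real (Suc n)" a d "real (Suc n)"] by (simp del: of_nat_Suc)
  ultimately show "\<exists>A. countable A \<and> A \<subseteq> sets (rad a d) \<and> \<Union> A = space (rad a d) \<and> (\<forall>a'\<in>A. emeasure (rad a d) a' \<noteq> \<infinity>)"
    by (intro exI[of _ U] conjI) (auto simp: U_def rad_nonpos simp del: of_nat_Suc)
qed

text \<open>The weight depends on the norm alone and is absorbed into the radial factor of the
  product decomposition.\<close>

lemma nn_integral_mu_polar:
  assumes d: "1 \<le> d" and T[measurable]: "T \<in> borel_measurable (Rd d)"
    and hom: "\<And>c y. 0 < c \<Longrightarrow> y \<in> space (Rd d) \<Longrightarrow> T (aff d (\<lambda>_. 0) c y) = T y"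
    and H[measurable]: "case_prod H \<in> borel_measurable (borel \<Otimes>\<^sub>M borel)"
  shows "(\<integral>\<^sup>+y. H (enorm d y) (T y) \<partial>mu a d) = (\<integral>\<^sup>+t. (\<integral>\<^sup>+s. H s t \<partial>rad a d) \<partial>angular d T)"
proof -
  let ?\<nu> = "distr (Rd d) borel (enorm d)"
  interpret A: prob_space "angular d T" by (rule prob_space_angular[OF T])
  interpret N: sigma_finite_measure ?\<nu>
    by (rule sigma_finite_atMost) (simp, rule distr_enorm_atMost_finite)
  interpret pair_sigma_finite ?\<nu> "angular d T" ..
  define G where "G = (\<lambda>z::real \<times> real. ennreal (fst z powr (- a)) * H (fst z) (snd z))"
  have H'[measurable]: "(\<lambda>z. H (fst z) (snd z)) \<in> borel_measurable (borel \<Otimes>\<^sub>M borel)"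
    using H by (simp add: case_prod_beta)
  have G[measurable]: "G \<in> borel_measurable (borel \<Otimes>\<^sub>M borel)" unfolding G_def by measurable
  have sets_ang: "sets (angular d T) = sets borel" by (simp add: angular_def)
  have "sets (?\<nu> \<Otimes>\<^sub>M angular d T) = sets (borel \<Otimes>\<^sub>M borel)"
    by (intro sets_pair_measure_cong) (auto simp: sets_ang)
  then have G': "G \<in> borel_measurable (?\<nu> \<Otimes>\<^sub>M angular d T)"
    using G by (simp cong: measurable_cong_sets)
  have Hs: "(\<lambda>s. H s t) \<in> borel_measurable borel" for t
    using measurable_compose[OF measurable_Pair1'[of t borel borel] H'] by simp
  have pr: "(\<lambda>y. (enorm d y, T y)) \<in> Rd d \<rightarrow>\<^sub>M borel \<Otimes>\<^sub>M borel" by measurable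
  have HT: "(\<lambda>y. H (enorm d y) (T y)) \<in> borel_measurable (Rd d)"
    using measurable_compose[OF pr H'] by simp
  have "(\<integral>\<^sup>+y. H (enorm d y) (T y) \<partial>mu a d) = (\<integral>\<^sup>+y. G (enorm d y, T y) \<partial>Rd d)"
    by (subst nn_integral_mu[OF HT]) (simp add: G_def)
  also have "\<dots> = integral\<^sup>N (distr (Rd d) (borel \<Otimes>\<^sub>M borel) (\<lambda>y. (enorm d y, T y))) G"
    by (subst nn_integral_distr[OF pr]) auto
  also have "\<dots> = integral\<^sup>N (?\<nu> \<Otimes>\<^sub>M angular d T) G" by (simp add: distr_polar[OF d T hom])
  also have "\<dots> = (\<integral>\<^sup>+t. (\<integral>\<^sup>+s. G (s, t) \<partial>?\<nu>) \<partial>angular d T)"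
    by (rule nn_integral_snd[symmetric]) (rule G')
  also have "\<dots> = (\<integral>\<^sup>+t. (\<integral>\<^sup>+s. H s t \<partial>rad a d) \<partial>angular d T)"
    unfolding rad_density by (intro nn_integral_cong) (simp add: nn_integral_density Hs G_def)
  finally show ?thesis .
qed

section \<open>Maximal functions on the half-line\<close>

text \<open>A subfamily of least size has no redundant member. Of three intervals through one point,
  the one reaching furthest left and the one reaching furthest right cover the third.\<close>

lemma minimal_subcover:
  fixes I :: "(real \<times> real) set"
  assumes "finite I"
  shows "\<exists>J\<subseteq>I. (\<Union>i\<in>J. {fst i<..<snd i}) = (\<Union>i\<in>I. {fst i<..<snd i})
    \<and> (\<forall>x. card {i \<in> J. x \<in> {fst i<..<snd i}} \<le> 2)"
proof -
  let ?U = "\<lambda>J. \<Union>i\<in>J. {fst i<..<snd i}"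
  let ?P = "\<lambda>J. J \<subseteq> I \<and> ?U J = ?U I"
  obtain J where J: "?P J" and min: "\<And>J'. ?P J' \<Longrightarrow> card J \<le> card J'"
    using ex_has_least_nat[of ?P I card] by auto
  have finJ: "finite J" using J assms finite_subset by blast
  have "card {i \<in> J. x \<in> {fst i<..<snd i}} \<le> 2" for x
  proof (rule ccontr)
    define K where "K = {i \<in> J. x \<in> {fst i<..<snd i}}"
    assume "\<not> card {i \<in> J. x \<in> {fst i<..<snd i}} \<le> 2"
    then have c: "2 < card K" by (simp add: K_def)
    have finK: "finite K" using finJ by (simp add: K_def)
    have "K \<noteq> {}" using c by auto
    then obtain l r where l: "l \<in> K" "\<And>i. i \<in> K \<Longrightarrow> fst l \<le> fst i"
      and r: "r \<in> K" "\<And>i. i \<in> K \<Longrightarrow> snd i \<le> snd r"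
      using arg_min_if_finite[OF finK, of fst] arg_min_if_finite[OF finK, of "\<lambda>i. - snd i"]
      by (metis linorder_not_less neg_less_iff_less)
    have "\<not> K \<subseteq> {l, r}"
    proof
      assume "K \<subseteq> {l, r}"
      then have "card K \<le> card {l, r}" by (intro card_mono) auto
      also have "\<dots> \<le> 2" by (simp add: card_insert_if)
      finally show False using c by simp
    qed
    then obtain m where m: "m \<in> K" "m \<noteq> l" "m \<noteq> r" by blast
    have sub: "{fst m<..<snd m} \<subseteq> {fst l<..<snd l} \<union> {fst r<..<snd r}"
    proof
      fix y assume y: "y \<in> {fst m<..<snd m}"
      have "fst l \<le> fst m" "snd m \<le> snd r" using l(2)[OF m(1)] r(2)[OF m(1)] .
      moreover have "x < snd l" "fst r < x" using l(1) r(1) by (auto simp: K_def)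
      ultimately show "y \<in> {fst l<..<snd l} \<union> {fst r<..<snd r}"
        using y by (cases "y \<le> x") auto
    qed
    have mJ: "m \<in> J" "l \<in> J - {m}" "r \<in> J - {m}" using m l r by (auto simp: K_def)
    have "?U (J - {m}) = ?U J"
    proof
      show "?U J \<subseteq> ?U (J - {m})"
      proof
        fix y assume "y \<in> ?U J"
        then obtain i where i: "i \<in> J" "y \<in> {fst i<..<snd i}" by blast
        show "y \<in> ?U (J - {m})"
        proof (cases "i = m")
          case True
          then have "y \<in> {fst l<..<snd l} \<or> y \<in> {fst r<..<snd r}" using i sub by blast
          then show ?thesis using mJ by blast
        qed (use i in blast)
      qed
    qed auto
    then have "?P (J - {m})" using J by auto
    then have "card J \<le> card (J - {m})" by (rule min)
    moreover have "card (J - {m}) < card J" using mJ finJ by (intro card_Diff1_less)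
    ultimately show False by simp
  qed
  then show ?thesis using J by blast
qed

text \<open>Rational endpoints make the maximal function a countable supremum; they are positive because the radial
  measure may be infinite near \<open>0\<close>.\<close>
definition rational_intervals :: "(real \<times> real) set" where
  "rational_intervals = {(p, q). p \<in> \<rat> \<and> q \<in> \<rat> \<and> 0 < p \<and> p < q}"

lemma countable_rational_intervals: "countable rational_intervals"
proof -
  have "rational_intervals \<subseteq> \<rat> \<times> \<rat>" by (auto simp: rational_intervals_def)
  then show ?thesis by (rule countable_subset) (intro countable_SIGMA countable_rat)
qed

definition interval_avg :: "real measure \<Rightarrow> (real \<Rightarrow> ennreal) \<Rightarrow> real \<times> real \<Rightarrow> ennreal" where
  "interval_avg M F i = (\<integral>\<^sup>+ s \<in> {fst i<..<snd i}. F s \<partial>M) / emeasure M {fst i<..<snd i}"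

definition interval_max :: "real measure \<Rightarrow> (real \<Rightarrow> ennreal) \<Rightarrow> real \<Rightarrow> ennreal" where
  "interval_max M F t = (SUP i \<in> rational_intervals. indicator {fst i<..<snd i} t * interval_avg M F i)"

lemma interval_max_measurable [measurable]: "interval_max M F \<in> borel_measurable borel"
  unfolding interval_max_def by (intro borel_measurable_SUP countable_rational_intervals) measurable

lemma interval_max_level:
  "{t. l < interval_max M F t} = (\<Union>i\<in>{i \<in> rational_intervals. l < interval_avg M F i}. {fst i<..<snd i})"
  unfolding interval_max_def less_SUP_iff
  by (auto split: split_indicator_asm split_indicator)

context
  fixes M :: "real measure"
  assumes sets_M [simp, measurable_cong]: "sets M = sets borel"
    and fin: "\<And>p q. 0 < p \<Longrightarrow> emeasure M {p..q} < \<infinity>"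
    and nonpos: "emeasure M {..0} = 0"
begin

lemma borel_measurable_M [simp]: "borel_measurable M = borel_measurable borel"
  by (rule measurable_cong_sets) simp_all

lemma open_interval_finite: "0 < p \<Longrightarrow> emeasure M {p<..<q} < \<infinity>"
  by (rule le_less_trans[OF emeasure_mono fin[of p q]]) auto

lemma interval_avg_mult:
  assumes "i \<in> rational_intervals" and [measurable]: "F \<in> borel_measurable borel"
  shows "interval_avg M F i * emeasure M {fst i<..<snd i} = (\<integral>\<^sup>+ s \<in> {fst i<..<snd i}. F s \<partial>M)"
proof (cases "emeasure M {fst i<..<snd i} = 0")
  case True
  then have "(\<integral>\<^sup>+ s \<in> {fst i<..<snd i}. F s \<partial>M) = 0"
    by (intro nn_integral_null_set) (auto simp: null_sets_def)
  then show ?thesis using True by simp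
next
  case False
  then show ?thesis
    using open_interval_finite[of "fst i" "snd i"] assms(1)
    unfolding interval_avg_def rational_intervals_def
    by (auto simp: ennreal_divide_times mult_divide_eq_ennreal ennreal_mult_divide_eq)
qed

text \<open>The factor 2 is the overlap of a minimal subcover; no doubling property of
  \<open>M\<close> enters.\<close>

lemma interval_family_measure:
  assumes "finite I" and [measurable]: "F \<in> borel_measurable borel"
    and I: "\<And>i. i \<in> I \<Longrightarrow> l * emeasure M {fst i<..<snd i} \<le> (\<integral>\<^sup>+ s \<in> {fst i<..<snd i}. F s \<partial>M)"
  shows "l * emeasure M (\<Union>i\<in>I. {fst i<..<snd i}) \<le> 2 * (\<integral>\<^sup>+ s. F s \<partial>M)"
proof -
  obtain J where J: "J \<subseteq> I" "(\<Union>i\<in>J. {fst i<..<snd i}) = (\<Union>i\<in>I. {fst i<..<snd i})"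
    and mult: "\<And>x. card {i \<in> J. x \<in> {fst i<..<snd i}} \<le> 2"
    using minimal_subcover[OF assms(1)] by blast
  have finJ: "finite J" using J(1) assms(1) finite_subset by blast
  have "l * emeasure M (\<Union>i\<in>I. {fst i<..<snd i}) \<le> l * (\<Sum>i\<in>J. emeasure M {fst i<..<snd i})"
    unfolding J(2)[symmetric] using finJ
    by (intro mult_left_mono emeasure_subadditive_finite) auto
  also have "\<dots> = (\<Sum>i\<in>J. l * emeasure M {fst i<..<snd i})" by (rule sum_distrib_left)
  also have "\<dots> \<le> (\<Sum>i\<in>J. \<integral>\<^sup>+ s \<in> {fst i<..<snd i}. F s \<partial>M)"
    using J(1) by (intro sum_mono I) auto
  also have "\<dots> = (\<integral>\<^sup>+ s. (\<Sum>i\<in>J. F s * indicator {fst i<..<snd i} s) \<partial>M)"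
    by (subst nn_integral_sum) (simp_all add: borel_measurable_M)
  also have "\<dots> \<le> (\<integral>\<^sup>+ s. 2 * F s \<partial>M)"
  proof (rule nn_integral_mono)
    fix s
    have "(\<Sum>i\<in>J. F s * indicator {fst i<..<snd i} s) = F s * of_nat (card {i \<in> J. s \<in> {fst i<..<snd i}})"
      using finJ by (subst sum_distrib_left[symmetric])
        (simp add: indicator_def sum.If_cases Int_def conj_commute)
    also have "\<dots> \<le> F s * of_nat 2"
      using mult[of s] by (intro mult_left_mono) (auto simp: of_nat_le_iff simp del: of_nat_numeral)
    finally show "(\<Sum>i\<in>J. F s * indicator {fst i<..<snd i} s) \<le> 2 * F s" by (simp add: mult.commute)
  qed
  also have "\<dots> = 2 * (\<integral>\<^sup>+ s. F s \<partial>M)" by (rule nn_integral_cmult) simp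
  finally show ?thesis .
qed

text \<open>The level set is a countable union of rational intervals, the increasing limit of finite
  unions with a common bound.\<close>

lemma interval_max_weak:
  assumes [measurable]: "F \<in> borel_measurable borel"
  shows "l * emeasure M {t. l < interval_max M F t} \<le> 2 * (\<integral>\<^sup>+ s. F s \<partial>M)"
proof -
  define Q where "Q = {i \<in> rational_intervals. l < interval_avg M F i}"
  have cQ: "countable Q"
    using countable_rational_intervals by (rule countable_subset[rotated]) (auto simp: Q_def)
  show ?thesis
  proof (cases "Q = {}")
    case True
    then have "{t. l < interval_max M F t} = {}" unfolding interval_max_level Q_def[symmetric] by simp
    then show ?thesis by simp
  next
    case False
    define A where "A = (\<lambda>n. \<Union>i\<in>from_nat_into Q ` {..n}. {fst i<..<snd i})"
    have "{t. l < interval_max M F t} = (\<Union>n. A n)"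
      unfolding interval_max_level Q_def[symmetric] A_def
      by (subst range_from_nat_into[OF False cQ, symmetric]) auto
    moreover have "(SUP n. emeasure M (A n)) = emeasure M (\<Union>n. A n)"
    proof (rule SUP_emeasure_incseq)
      show "range A \<subseteq> sets M" unfolding A_def by auto
      show "incseq A" unfolding A_def incseq_def by force
    qed
    moreover have "l * emeasure M (A n) \<le> 2 * (\<integral>\<^sup>+ s. F s \<partial>M)" for n
      unfolding A_def
    proof (rule interval_family_measure)
      fix i assume "i \<in> from_nat_into Q ` {..n}"
      then have "i \<in> Q" using from_nat_into[OF False] by auto
      then have i: "i \<in> rational_intervals" "l \<le> interval_avg M F i" by (auto simp: Q_def)
      show "l * emeasure M {fst i<..<snd i} \<le> (\<integral>\<^sup>+ s \<in> {fst i<..<snd i}. F s \<partial>M)"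
        unfolding interval_avg_mult[OF i(1) assms, symmetric] by (intro mult_right_mono i) simp
    qed auto
    ultimately show ?thesis
      by (metis (mono_tags, lifting) SUP_least SUP_mult_left_ennreal)
  qed
qed

text \<open>The closed interval is approximated from outside by rational open ones. Their left ends
  stay positive, so the masses are finite and continuity from above applies.\<close>

lemma closed_interval_integral_le_pos:
  assumes [measurable]: "F \<in> borel_measurable borel" and p: "0 < p" "p \<le> t" "t \<le> q"
  shows "(\<integral>\<^sup>+ s \<in> {p..q}. F s \<partial>M) \<le> emeasure M {p..q} * interval_max M F t"
proof (cases "interval_max M F t = \<infinity>")
  case True
  show ?thesis
  proof (cases "emeasure M {p..q} = 0")
    case True
    then have "(\<integral>\<^sup>+ s \<in> {p..q}. F s \<partial>M) = 0"
      by (intro nn_integral_null_set) (auto simp: null_sets_def)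
    then show ?thesis by simp
  qed (simp add: True ennreal_mult_top)
next
  case False
  \<comment> \<open>Subtracting at most \<open>p / 2\<close> keeps the left end positive.\<close>
  define p' where "p' = (\<lambda>n. p - p / 2 * inverse (real (Suc n)))"
  define q' where "q' = (\<lambda>n. q + inverse (real (Suc n)))"
  have p'0: "0 < p' n" "p' n < p" for n
  proof -
    have "inverse (real (Suc n)) \<le> inverse 1" by (intro le_imp_inverse_le) auto
    then have "p / 2 * inverse (real (Suc n)) \<le> p / 2 * 1" using p by (intro mult_left_mono) auto
    then show "0 < p' n" using p unfolding p'_def by linarith
    have "0 < p / 2 * inverse (real (Suc n))" using p by simp
    then show "p' n < p" by (simp add: p'_def)
  qed
  have q'0: "q < q' n" for n by (simp add: q'_def)
  have step: "(\<integral>\<^sup>+ s \<in> {p..q}. F s \<partial>M) \<le> interval_max M F t * emeasure M {p' n..q' n}" for n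
  proof -
    obtain x where x: "x \<in> \<rat>" "p' n < x" "x < p" using Rats_dense_in_real[OF p'0(2)] by blast
    obtain y where y: "y \<in> \<rat>" "q < y" "y < q' n" using Rats_dense_in_real[OF q'0] by blast
    have xy: "(x, y) \<in> rational_intervals"
      using x y p'0(1)[of n] p by (auto simp: rational_intervals_def)
    have "(\<integral>\<^sup>+ s \<in> {p..q}. F s \<partial>M) \<le> (\<integral>\<^sup>+ s \<in> {x<..<y}. F s \<partial>M)"
      using x y by (intro nn_integral_mono) (auto split: split_indicator)
    also have "\<dots> = interval_avg M F (x, y) * emeasure M {x<..<y}"
      using interval_avg_mult[OF xy assms(1)] by simp
    also have "\<dots> \<le> interval_max M F t * emeasure M {p' n..q' n}"
    proof (rule mult_mono)
      have "indicator {fst (x, y)<..<snd (x, y)} t * interval_avg M F (x, y) \<le> interval_max M F t"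
        unfolding interval_max_def by (rule SUP_upper[OF xy])
      moreover have "t \<in> {x<..<y}" using x y p by auto
      ultimately show "interval_avg M F (x, y) \<le> interval_max M F t" by simp
      show "emeasure M {x<..<y} \<le> emeasure M {p' n..q' n}"
        using x y by (intro emeasure_mono) auto
    qed auto
    finally show ?thesis .
  qed
  have "(\<lambda>n. emeasure M {p' n..q' n}) \<longlonglongrightarrow> emeasure M (\<Inter>n. {p' n..q' n})"
  proof (rule Lim_emeasure_decseq)
    show "decseq (\<lambda>n. {p' n..q' n})"
      unfolding decseq_def
    proof (intro allI impI)
      fix m n :: nat assume "m \<le> n"
      then have le: "inverse (real (Suc n)) \<le> inverse (real (Suc m))" by (intro le_imp_inverse_le) auto
      then have "p / 2 * inverse (real (Suc n)) \<le> p / 2 * inverse (real (Suc m))"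
        using p by (intro mult_left_mono) auto
      then have "p' m \<le> p' n" "q' n \<le> q' m" using le by (simp_all add: p'_def q'_def)
      then show "{p' n..q' n} \<subseteq> {p' m..q' m}" by simp
    qed
    show "emeasure M {p' n..q' n} \<noteq> \<infinity>" for n using fin[OF p'0(1)] by (simp add: less_top)
  qed auto
  also have "(\<Inter>n. {p' n..q' n}) = {p..q}"
  proof
    show "(\<Inter>n. {p' n..q' n}) \<subseteq> {p..q}"
    proof
      fix z assume z: "z \<in> (\<Inter>n. {p' n..q' n})"
      have "p' \<longlonglongrightarrow> p - p / 2 * 0" "q' \<longlonglongrightarrow> q + 0"
        unfolding p'_def q'_def by (intro tendsto_intros LIMSEQ_inverse_real_of_nat)+
      then have "p' \<longlonglongrightarrow> p" "q' \<longlonglongrightarrow> q" by simp_all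
      moreover have "p' n \<le> z" "z \<le> q' n" for n using z by auto
      ultimately show "z \<in> {p..q}" by (auto intro: LIMSEQ_le_const LIMSEQ_le_const2)
    qed
    show "{p..q} \<subseteq> (\<Inter>n. {p' n..q' n})"
    proof
      fix z assume "z \<in> {p..q}"
      then have "p' n \<le> z \<and> z \<le> q' n" for n using p'0(2)[of n] q'0[of n] by auto
      then show "z \<in> (\<Inter>n. {p' n..q' n})" by auto
    qed
  qed
  finally have lim: "(\<lambda>n. emeasure M {p' n..q' n}) \<longlonglongrightarrow> emeasure M {p..q}" .
  have "interval_max M F t < top" using False unfolding less_top[symmetric] by simp
  then have "(\<lambda>n. interval_max M F t * emeasure M {p' n..q' n}) \<longlonglongrightarrow> interval_max M F t * emeasure M {p..q}"
    by (rule ennreal_tendsto_cmult[OF _ lim])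
  then show ?thesis
    using step by (subst mult.commute) (intro LIMSEQ_le_const, auto)
qed

text \<open>For an interval reaching 0 the mass may be infinite and continuity from above is lost.
  It is exhausted from inside by intervals with positive left ends that still contain
  \<open>t\<close>; what remains is null.\<close>

lemma closed_interval_integral_le:
  assumes F[measurable]: "F \<in> borel_measurable borel" and t: "0 < t" "p \<le> t" "t \<le> q"
  shows "(\<integral>\<^sup>+ s \<in> {p..q}. F s \<partial>M) \<le> emeasure M {p..q} * interval_max M F t"
proof -
  define A where "A = (\<lambda>n. {max p (t / real (Suc n))..q})"
  let ?D = "density M F"
  have A: "A n \<subseteq> {p..q}" "0 < max p (t / real (Suc n))" "max p (t / real (Suc n)) \<le> t" for n
  proof -
    have "t / real (Suc n) \<le> t / 1" using t by (intro divide_left_mono) auto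
    then show "max p (t / real (Suc n)) \<le> t" using t by simp
    show "0 < max p (t / real (Suc n))" using t by (simp add: less_max_iff_disj del: of_nat_Suc)
  qed (auto simp: A_def)
  have le: "emeasure ?D (A n) \<le> emeasure M {p..q} * interval_max M F t" for n
  proof -
    have "emeasure ?D (A n) = (\<integral>\<^sup>+ s \<in> A n. F s \<partial>M)"
      unfolding A_def by (rule emeasure_density) (auto simp: borel_measurable_M)
    also have "\<dots> \<le> emeasure M (A n) * interval_max M F t"
      unfolding A_def by (rule closed_interval_integral_le_pos[OF F A(2,3) t(3)])
    also have "\<dots> \<le> emeasure M {p..q} * interval_max M F t"
      using A(1) by (intro mult_right_mono emeasure_mono) auto
    finally show ?thesis .
  qed
  have SUP: "(SUP n. emeasure ?D (A n)) = emeasure ?D (\<Union>n. A n)"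
  proof (rule SUP_emeasure_incseq)
    show "incseq A"
      unfolding incseq_def
    proof (intro allI impI)
      fix m n :: nat assume "m \<le> n"
      then have "t / real (Suc n) \<le> t / real (Suc m)" using t by (intro divide_left_mono) auto
      then show "A m \<subseteq> A n" unfolding A_def by (auto simp del: of_nat_Suc)
    qed
  qed (auto simp: A_def)
  have "{p..q} \<inter> {0<..} \<subseteq> (\<Union>n. A n)"
  proof
    fix s assume s: "s \<in> {p..q} \<inter> {0<..}"
    obtain n where "t / s < real n" using reals_Archimedean2 by blast
    then have "t / s < real (Suc n)" by simp
    then have "t / real (Suc n) \<le> s" using s by (simp add: field_simps del: of_nat_Suc)
    then show "s \<in> (\<Union>n. A n)" using s by (auto simp: A_def)
  qed
  then have "emeasure ?D ({p..q} \<inter> {0<..}) \<le> emeasure ?D (\<Union>n. A n)"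
    by (intro emeasure_mono) (auto simp: A_def)
  also have "\<dots> \<le> emeasure M {p..q} * interval_max M F t"
    unfolding SUP[symmetric] by (intro SUP_least le)
  finally have "emeasure ?D ({p..q} \<inter> {0<..}) \<le> emeasure M {p..q} * interval_max M F t" .
  moreover have "(\<integral>\<^sup>+ s \<in> {p..q}. F s \<partial>M) = emeasure ?D ({p..q} \<inter> {0<..})"
  proof -
    have "AE s in M. s \<notin> {..0}" by (rule AE_not_in) (auto simp: null_sets_def nonpos)
    then show ?thesis
      by (subst emeasure_density) (auto simp: borel_measurable_M intro!: nn_integral_cong_AE elim!: eventually_mono split: split_indicator)
  qed
  ultimately show ?thesis by simp
qed

end

section \<open>Radial hulls of balls\<close>

text \<open>\<open>|x|\<close> times the cosine of the angle between \<open>x\<close> and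
  \<open>y\<close>. Unlike the inner product, it is invariant under dilations of \<open>y\<close>,
  as polar coordinates require.\<close>

definition ang :: "nat \<Rightarrow> (nat \<Rightarrow> real) \<Rightarrow> (nat \<Rightarrow> real) \<Rightarrow> real" where
  "ang d x y = ip d x y / enorm d y"

lemma ang_measurable [measurable]: "ang d x \<in> borel_measurable (Rd d)"
  unfolding ang_def by measurable

lemma ang_aff: "0 < c \<Longrightarrow> ang d x (aff d (\<lambda>_. 0) c y) = ang d x y"
  by (simp add: ang_def ip_aff0 enorm_aff0)

lemma ang_le: "ang d x y \<le> enorm d x"
proof (cases "enorm d y = 0")
  case False
  then have "0 < enorm d y" by (simp add: less_le)
  then show ?thesis using ip_le[of d x y] by (simp add: ang_def divide_le_eq)
qed (simp add: ang_def)

lemma ip_ang: "ip d x y = enorm d y * ang d x y"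
  using ip_abs_le[of d x y] by (auto simp: ang_def)

lemma mem_eball_ang:
  assumes "0 \<le> r"
  shows "y \<in> eball d x r \<longleftrightarrow> y \<in> space (Rd d) \<and>
    (enorm d y)\<^sup>2 - 2 * (enorm d y * ang d x y) + (enorm d x)\<^sup>2 \<le> r\<^sup>2"
  unfolding mem_eball[OF assms] ip_ang ..

text \<open>In the direction making the angular variable \<open>t\<close> with the centre (of norm \<open>\<xi>\<close>), the ball is met in
  the norms \<open>s\<close> between \<open>t - \<surd>D\<close> and \<open>t + \<surd>D\<close>; the hull extends this segment up to \<open>s = \<xi>\<close>.\<close>
definition ray_hull :: "real \<Rightarrow> real \<Rightarrow> real \<Rightarrow> real \<Rightarrow> bool" where
  "ray_hull \<xi> r s t \<longleftrightarrow> 0 \<le> t\<^sup>2 - \<xi>\<^sup>2 + r\<^sup>2 \<and> 0 < t + sqrt (t\<^sup>2 - \<xi>\<^sup>2 + r\<^sup>2)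
    \<and> t - sqrt (t\<^sup>2 - \<xi>\<^sup>2 + r\<^sup>2) \<le> s \<and> s \<le> max \<xi> (t + sqrt (t\<^sup>2 - \<xi>\<^sup>2 + r\<^sup>2))"

definition ball_hull :: "nat \<Rightarrow> (nat \<Rightarrow> real) \<Rightarrow> real \<Rightarrow> (nat \<Rightarrow> real) set" where
  "ball_hull d x r = {y \<in> space (Rd d). 0 < enorm d y \<and> ray_hull (enorm d x) r (enorm d y) (ang d x y)}"

lemma ball_hull_sets [measurable]: "ball_hull d x r \<in> sets (Rd d)"
proof -
  define g where "g = (\<lambda>y. sqrt ((ang d x y)\<^sup>2 - (enorm d x)\<^sup>2 + r\<^sup>2))"
  have g[measurable]: "g \<in> borel_measurable (Rd d)" unfolding g_def by measurable
  have m[measurable]: "(\<lambda>y. max (enorm d x) (ang d x y + g y)) \<in> borel_measurable (Rd d)" by measurable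
  have "ball_hull d x r = {y \<in> space (Rd d). 0 < enorm d y} \<inter> {y \<in> space (Rd d). 0 \<le> (ang d x y)\<^sup>2 - (enorm d x)\<^sup>2 + r\<^sup>2}
    \<inter> {y \<in> space (Rd d). 0 < ang d x y + g y} \<inter> {y \<in> space (Rd d). ang d x y - g y \<le> enorm d y}
    \<inter> {y \<in> space (Rd d). enorm d y \<le> max (enorm d x) (ang d x y + g y)}"
    unfolding ball_hull_def ray_hull_def g_def by blast
  also have "\<dots> \<in> sets (Rd d)"
    by (intro sets.Int borel_measurable_less borel_measurable_le borel_measurable_const m
        borel_measurable_add borel_measurable_diff borel_measurable_power g ang_measurable enorm_measurable)
  finally show ?thesis .
qed

text \<open>The part added by the hull stays in a ball no larger than the original one: for \<open>r < 1\<close>, the centre \<open>S u\<close>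
  is the one for which the sphere of radius \<open>\<rho> = r\<close> passes through the points of the unit sphere on the tangent cone.\<close>
lemma ray_hull_excess:
  fixes s t r \<rho> S :: real
  assumes hull: "ray_hull 1 r s t" and s: "0 < s" and out: "\<not> s\<^sup>2 - 2 * (s * t) + 1 \<le> r\<^sup>2" and r: "0 < r"
    and \<rho>: "\<rho> = min r 1" and S: "S = sqrt (1 - \<rho>\<^sup>2)"
  shows "S \<le> s" "s \<le> 1" "s\<^sup>2 - 2 * S * (s * t) + S\<^sup>2 \<le> \<rho>\<^sup>2"
proof -
  define D where "D = t\<^sup>2 - 1\<^sup>2 + r\<^sup>2"
  have D: "0 \<le> D" "0 < t + sqrt D" "t - sqrt D \<le> s" "s \<le> max 1 (t + sqrt D)"
    using hull unfolding ray_hull_def D_def by auto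
  have "sqrt D < \<bar>s - t\<bar>"
  proof (rule real_less_lsqrt[THEN order_less_le_trans])
    have "D < (s - t)\<^sup>2" using out by (simp add: D_def power2_eq_square algebra_simps)
    then show "D < (\<bar>s - t\<bar>)\<^sup>2" by simp
  qed (use D in auto)
  \<comment> \<open>A hull point outside the ball lies beyond the far end of the segment on its ray;
    hence that segment ends before norm 1.\<close>
  then have st: "t + sqrt D < s" using D(3) by linarith
  show s1: "s \<le> 1" using D(4) st by auto
  have \<rho>1: "0 < \<rho>" "\<rho> \<le> 1" using r by (auto simp: \<rho>)
  have \<rho>2: "\<rho>\<^sup>2 \<le> 1" using \<rho>1 by (simp add: power_le_one)
  have S0: "0 \<le> S" "S\<^sup>2 = 1 - \<rho>\<^sup>2" using \<rho>2 by (auto simp: S)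
  have "S\<^sup>2 \<le> 1\<^sup>2" unfolding S0(2) using zero_le_power2[of \<rho>] by simp
  then have S1: "S \<le> 1" by (rule power2_le_imp_le) simp
  have tS: "S \<le> s \<and> S * S \<le> S * t"
  proof (cases "r < 1")
    case False
    then have "S = 0" by (simp add: S \<rho>)
    then show ?thesis using s by simp
  next
    case True
    then have \<rho>r: "\<rho> = r" by (simp add: \<rho>)
    \<comment> \<open>Power of the origin with respect to the sphere: the norms at the two ends of
      the segment have product \<open>1 - r^2\<close>.\<close>
    have "(t + sqrt D) * (t - sqrt D) = S\<^sup>2"
      using D(1) S0 by (simp add: \<rho>r D_def power2_eq_square algebra_simps flip: real_sqrt_mult)
    moreover have "0 < S\<^sup>2" using True r S0 by (simp add: \<rho>r power_less_one_iff)
    ultimately have "0 < t - sqrt D" using D(2) by (metis zero_less_mult_pos)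
    then have t0: "0 < t" using real_sqrt_ge_zero[OF D(1)] by linarith
    have "S\<^sup>2 \<le> t\<^sup>2" unfolding S0(2) using D(1) by (simp add: D_def \<rho>r)
    then have "S \<le> t" by (rule power2_le_imp_le) (use t0 in simp)
    moreover have "t \<le> s" using st real_sqrt_ge_zero[OF D(1)] by linarith
    ultimately show ?thesis using S0 by (auto intro: mult_left_mono)
  qed
  then show "S \<le> s" by simp
  have "s * (S * S) \<le> s * (S * t)"
    by (rule mult_left_mono[OF conjunct2[OF tS] less_imp_le[OF s]])
  then have "s\<^sup>2 - 2 * S * (s * t) + S\<^sup>2 \<le> s\<^sup>2 - 2 * (s * S\<^sup>2) + S\<^sup>2"
    by (simp add: power2_eq_square algebra_simps)
  \<comment> \<open>The product is nonpositive for \<open>S \<le> s \<le> 1\<close>, because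
    \<open>1 + S - 2 * S^2 = (1 - S) * (1 + 2 * S)\<close>.\<close>
  also have "\<dots> = \<rho>\<^sup>2 + (s - 1) * (s + 1 - 2 * S\<^sup>2)"
  proof -
    have "\<rho>\<^sup>2 = 1 - S\<^sup>2" using S0 by simp
    then show ?thesis by (simp only:) (simp add: power2_eq_square algebra_simps)
  qed
  also have "\<dots> \<le> \<rho>\<^sup>2"
  proof -
    have "0 \<le> (1 - S) * (1 + 2 * S)" using S0 S1 by simp
    then have "0 \<le> S + 1 - 2 * S\<^sup>2" by (simp add: power2_eq_square algebra_simps)
    then have "0 \<le> s + 1 - 2 * S\<^sup>2" using tS by simp
    then have "(s - 1) * (s + 1 - 2 * S\<^sup>2) \<le> 0" using s1 by (intro mult_nonpos_nonneg) auto
    then show ?thesis by simp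
  qed
  finally show "s\<^sup>2 - 2 * S * (s * t) + S\<^sup>2 \<le> \<rho>\<^sup>2" .
qed

text \<open>The point reflection in \<open>u\<close> swaps the two halves of the ball. In the half
  beyond the tangent hyperplane norms are at least 1, so weights with \<open>a \<le> 0\<close> are
  at least 1 there.\<close>

lemma half_ball_volume:
  assumes u: "enorm d u = 1" and r: "0 < r"
  shows "ennreal (vol d * r ^ d / 2) \<le> emeasure (Rd d) {y \<in> eball d u r. 1 \<le> ip d u y}"
proof -
  let ?H = "{y \<in> eball d u r. 1 \<le> ip d u y}" and ?H' = "{y \<in> eball d u r. ip d u y \<le> 1}"
  have eb: "{y \<in> eball d u r. P y} = eball d u r \<inter> {y \<in> space (Rd d). P y}" for P
    by (auto simp: eball_def)
  have [measurable]: "?H \<in> sets (Rd d)" "?H' \<in> sets (Rd d)" unfolding eb by measurable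
  let ?f = "aff d (\<lambda>i. 2 * u i) (- 1)"
  have "(\<Sum>i<d. (?f y i - u i)\<^sup>2) = (\<Sum>i<d. (y i - u i)\<^sup>2)" for y
    unfolding aff_def by (intro sum.cong) (auto simp: power2_eq_square algebra_simps)
  moreover have "ip d u (?f y) = 2 - ip d u y" for y
  proof -
    have "ip d u (?f y) = (\<Sum>i<d. 2 * (u i)\<^sup>2 - u i * y i)"
      unfolding ip_def aff_def by (intro sum.cong) (auto simp: power2_eq_square algebra_simps)
    also have "\<dots> = 2 * (enorm d u)\<^sup>2 - ip d u y"
      by (simp add: sum_subtractf sum_distrib_left enorm_sq ip_def)
    finally show ?thesis using u by simp
  qed
  ultimately have "{y \<in> space (Rd d). ?f y \<in> ?H} = ?H'" by (auto simp: eball_def)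
  then have "emeasure (Rd d) ?H = emeasure (Rd d) ?H'"
    using emeasure_Rd_affine[of "-1" ?H d "\<lambda>i. 2 * u i"] by simp
  moreover have "emeasure (Rd d) (eball d u r) \<le> emeasure (Rd d) (?H \<union> ?H')"
    by (intro emeasure_mono) auto
  moreover have "emeasure (Rd d) (?H \<union> ?H') \<le> emeasure (Rd d) ?H + emeasure (Rd d) ?H'"
    by (intro emeasure_subadditive) auto
  ultimately have le: "ennreal (vol d * r ^ d) \<le> emeasure (Rd d) ?H + emeasure (Rd d) ?H"
    using r by (simp add: emeasure_eball)
  show ?thesis
  proof (cases "emeasure (Rd d) ?H")
    case (real m)
    then have "vol d * r ^ d \<le> m + m"
      using le by (simp add: ennreal_plus[symmetric] del: ennreal_plus)
    then show ?thesis unfolding real by (intro ennreal_leI) simp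
  qed simp
qed

text \<open>The ball of radius 1/8 about \<open>u / 2\<close> lies in the unit ball and in the cone
  of angle 60 degrees around \<open>u\<close>. The loss \<open>8 ^ d\<close> is harmless, as the
  cone serves only in dimensions below \<open>2 * \<alpha>\<close>.\<close>

lemma angular_cone:
  assumes u: "enorm d u = 1"
  shows "ennreal (1 / 8 ^ d) \<le> emeasure (angular d (ang d u)) {1 / 2..}"
proof -
  note v = vol_pos[of d]
  let ?C = "{y \<in> space (Rd d). 1 / 2 \<le> ang d u y}"
  have C: "?C \<in> sets (Rd d)" by measurable
  have "eball d (\<lambda>i. 1 / 2 * u i) (1 / 8) \<subseteq> ball0 d 1 \<inter> ?C"
  proof
    fix y assume y: "y \<in> eball d (\<lambda>i. 1 / 2 * u i) (1 / 8)"
    have ys: "y \<in> space (Rd d)" using y by (simp add: eball_def)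
    have "enorm d y \<le> enorm d (\<lambda>i. 1 / 2 * u i) + 1 / 8"
      using subsetD[OF eball_subset_centered y] by (simp add: eball_0)
    also have "\<dots> = 5 / 8" using u enorm_scale[of d "1 / 2" u] by simp
    finally have n: "enorm d y \<le> 5 / 8" .
    have "(enorm d y)\<^sup>2 - ip d u y + 1 / 4 \<le> 1 / 64"
      using y mem_eball_scaled[of "1 / 8" y d "1 / 2" u] u by (simp add: power2_eq_square)
    then have "(enorm d y)\<^sup>2 + 15 / 64 \<le> ip d u y" by simp
    moreover have "0 \<le> (enorm d y - 1 / 4)\<^sup>2" by simp
    ultimately have i: "1 / 2 * enorm d y \<le> ip d u y"
      by (simp add: power2_eq_square algebra_simps)
    have "0 < ip d u y" using \<open>(enorm d y)\<^sup>2 + 15 / 64 \<le> ip d u y\<close> zero_le_power2[of "enorm d y"] by linarith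
    then have "enorm d y \<noteq> 0" by (auto simp: ip_ang)
    then have "0 < enorm d y" by (simp add: less_le)
    then have "1 / 2 \<le> ang d u y" using i by (simp add: ang_def le_divide_eq)
    then show "y \<in> ball0 d 1 \<inter> ?C" using ys n by (simp add: eball_0)
  qed
  then have "emeasure (Rd d) (eball d (\<lambda>i. 1 / 2 * u i) (1 / 8)) \<le> emeasure (Rd d) (ball0 d 1 \<inter> ?C)"
    using C by (intro emeasure_mono) auto
  then have "ennreal (vol d * (1 / 8) ^ d) \<le> ennreal (vol d) * emeasure (uniform_measure (Rd d) (ball0 d 1)) ?C"
    unfolding emeasure_uniform_unit_ball[OF C] by (simp add: emeasure_eball)
  also have "emeasure (uniform_measure (Rd d) (ball0 d 1)) ?C = emeasure (angular d (ang d u)) {1 / 2..}"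
  proof -
    have "ang d u -` {1 / 2..} \<inter> space (Rd d) = ?C" by auto
    then show ?thesis unfolding angular_def
      by (subst emeasure_distr) (simp_all only: space_uniform_measure ang_measurable, simp_all)
  qed
  finally have le: "ennreal (vol d * (1 / 8) ^ d) \<le> ennreal (vol d) * emeasure (angular d (ang d u)) {1 / 2..}" .
  show ?thesis
  proof (cases "emeasure (angular d (ang d u)) {1 / 2..}")
    case (real m)
    then have "vol d * (1 / 8) ^ d \<le> vol d * m"
      using le v by (simp add: ennreal_mult'[symmetric])
    then have "(1 / 8) ^ d \<le> m" using v by (rule mult_left_le_imp_le)
    then show ?thesis unfolding real by (intro ennreal_leI) (simp add: power_divide)
  qed simp
qed

text \<open>Norm and angle are independent, so the cone carries at least the fraction
  \<open>1 / 8 ^ d\<close> of the mass at norms in \<open>A\<close>. This survives infinite masses,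
  which occur near the origin for \<open>a \<ge> d\<close>.\<close>

lemma rad_cone_le:
  assumes d: "1 \<le> d" and u: "enorm d u = 1" and A[measurable]: "A \<in> sets borel" and B: "B \<in> sets (Rd d)"
    and sub: "\<And>y. y \<in> space (Rd d) \<Longrightarrow> enorm d y \<in> A \<Longrightarrow> 1 / 2 \<le> ang d u y \<Longrightarrow> y \<in> B"
  shows "emeasure (mu a d) {y \<in> space (Rd d). enorm d y \<in> A} \<le> ennreal (8 ^ d) * emeasure (mu a d) B"
proof -
  have "ennreal (1 / 8 ^ d) * emeasure (rad a d) A
      \<le> emeasure (angular d (ang d u)) {1 / 2..} * emeasure (rad a d) A"
    by (intro mult_right_mono angular_cone u) simp
  also have "\<dots> = (\<integral>\<^sup>+t. emeasure (rad a d) A * indicator {1 / 2..} t \<partial>angular d (ang d u))"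
    by (subst nn_integral_cmult) (auto simp: angular_def mult.commute)
  also have "\<dots> = (\<integral>\<^sup>+t. (\<integral>\<^sup>+s. indicator A s * indicator {1 / 2..} t \<partial>rad a d) \<partial>angular d (ang d u))"
    by (intro nn_integral_cong) (simp split: split_indicator)
  also have "\<dots> = (\<integral>\<^sup>+y. indicator A (enorm d y) * indicator {1 / 2..} (ang d u y) \<partial>mu a d)"
    by (rule nn_integral_mu_polar[symmetric, OF d]) (auto simp: ang_aff)
  also have "\<dots> \<le> (\<integral>\<^sup>+y. indicator B y \<partial>mu a d)"
    using sub by (intro nn_integral_mono) (auto split: split_indicator)
  also have "\<dots> = emeasure (mu a d) B" using B by simp
  finally have le: "ennreal (1 / 8 ^ d) * emeasure (rad a d) A \<le> emeasure (mu a d) B" .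
  have "emeasure (mu a d) {y \<in> space (Rd d). enorm d y \<in> A} = emeasure (rad a d) A"
    unfolding rad_def by (subst emeasure_distr) (auto intro!: arg_cong[where f="emeasure _"])
  also have "\<dots> = ennreal (8 ^ d) * (ennreal (1 / 8 ^ d) * emeasure (rad a d) A)"
    by (simp add: mult.assoc[symmetric] ennreal_mult'[symmetric])
  also have "\<dots> \<le> ennreal (8 ^ d) * emeasure (mu a d) B" by (intro mult_left_mono le) simp
  finally show ?thesis .
qed

text \<open>The summands: 1 for the ball itself; 2 for the half-ball comparison with
  \<open>a \<le> 0\<close>; for \<open>a > 0\<close>, \<open>4 powr \<alpha>\<close> from norms at
  least 1/2, and from smaller norms \<open>2 * 4 powr \<alpha>\<close> if
  \<open>d \<ge> 2 * \<alpha>\<close>, or \<open>64 powr \<alpha> = 8 powr (2 * \<alpha>)\<close>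
  from the cone.\<close>

definition hull_const :: "real \<Rightarrow> real" where
  "hull_const \<alpha> = 3 + 3 * 4 powr \<alpha> + 64 powr \<alpha>"

lemma hull_const_ge: "3 \<le> hull_const \<alpha>"
  by (simp add: hull_const_def)

text \<open>The excess has norms between \<open>S\<close> and 1 and lies in a ball of radius
  \<open>\<rho> \<le> r\<close>, so its volume is at most that of \<open>B(u, \<rho>)\<close>. What
  remains is a comparison of weights, delicate only for small norms and
  \<open>a > 0\<close>.\<close>

lemma ball_hull_excess_mu:
  assumes d: "1 \<le> d" and u: "enorm d u = 1" and r: "0 < r" and a: "a \<le> \<alpha>" and \<alpha>: "0 \<le> \<alpha>"
  shows "emeasure (mu a d) (ball_hull d u r - eball d u r)
      \<le> ennreal (2 + 3 * 4 powr \<alpha> + 64 powr \<alpha>) * emeasure (mu a d) (eball d u r)"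
proof -
  note v = vol_pos[of d]
  define E where "E = ball_hull d u r - eball d u r"
  have E[measurable]: "E \<in> sets (Rd d)" by (simp add: E_def)
  define \<rho> where "\<rho> = min r 1"
  define S where "S = sqrt (1 - \<rho>\<^sup>2)"
  let ?m = "emeasure (mu a d) (eball d u r)"
  have \<rho>: "0 < \<rho>" "\<rho> \<le> 1" "\<rho> \<le> r" using r by (auto simp: \<rho>_def)
  have S: "0 \<le> S" "S\<^sup>2 = 1 - \<rho>\<^sup>2" using \<rho> by (auto simp: S_def power_le_one)
  have EE: "0 < enorm d y" "S \<le> enorm d y" "enorm d y \<le> 1" "y \<in> eball d (\<lambda>i. S * u i) \<rho>" "y \<in> space (Rd d)"
    if y: "y \<in> E" for y
  proof -
    have ys: "y \<in> space (Rd d)" "0 < enorm d y" and h: "ray_hull 1 r (enorm d y) (ang d u y)"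
      and out: "\<not> (enorm d y)\<^sup>2 - 2 * (enorm d y * ang d u y) + 1 \<le> r\<^sup>2"
      using y r u by (auto simp: E_def ball_hull_def mem_eball_ang)
    note ex = ray_hull_excess[OF h ys(2) out r \<rho>_def S_def]
    show "0 < enorm d y" "S \<le> enorm d y" "enorm d y \<le> 1" "y \<in> space (Rd d)" using ys ex by auto
    show "y \<in> eball d (\<lambda>i. S * u i) \<rho>"
      using ex(3) ys u \<rho> by (subst mem_eball_scaled) (auto simp: ip_ang)
  qed
  have LE: "emeasure (Rd d) E \<le> ennreal (vol d * \<rho> ^ d)"
    unfolding emeasure_eball[OF \<rho>(1), of d "\<lambda>i. S * u i", symmetric]
    by (intro emeasure_mono) (auto simp: EE)
  have subr: "eball d u \<rho> \<subseteq> eball d u r" using \<rho> by (auto simp: eball_def)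
  show ?thesis
  proof (cases "a \<le> 0")
    case True
    let ?H = "{y \<in> eball d u \<rho>. 1 \<le> ip d u y}"
    have H: "?H \<in> sets (Rd d)"
    proof -
      have "?H = eball d u \<rho> \<inter> {y \<in> space (Rd d). 1 \<le> ip d u y}" by (auto simp: eball_def)
      then show ?thesis by simp
    qed
    have "emeasure (mu a d) E \<le> ennreal 1 * emeasure (Rd d) E"
      using True by (intro mu_le) (auto intro!: powr_le1 simp: EE)
    also have "\<dots> \<le> ennreal (vol d * \<rho> ^ d)" using LE by simp
    also have "\<dots> = ennreal 2 * ennreal (vol d * \<rho> ^ d / 2)"
      by (subst ennreal_mult'[symmetric]) auto
    also have "\<dots> \<le> ennreal 2 * (ennreal 1 * emeasure (Rd d) ?H)"
      using half_ball_volume[OF u \<rho>(1)] by (intro mult_left_mono) auto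
    also have "\<dots> \<le> ennreal 2 * emeasure (mu a d) ?H"
    proof (intro mult_left_mono mu_ge H)
      fix y assume "y \<in> ?H"
      then have "1 \<le> enorm d y" using ip_le[of d u y] u by simp
      then show "1 \<le> enorm d y powr (- a)" using True by (intro ge_one_powr_ge_zero) auto
    qed simp
    also have "\<dots> \<le> ennreal (2 + 3 * 4 powr \<alpha> + 64 powr \<alpha>) * ?m"
      using subr by (intro mult_mono emeasure_mono ennreal_leI) auto
    finally show ?thesis unfolding E_def .
  next
    case False
    then have a0: "0 < a" by simp
    \<comment> \<open>Norms in \<open>B(u, \<rho>)\<close> are at most 2, which bounds the weight
      below by \<open>2 powr (- a)\<close> off the origin.\<close>
    have low: "ennreal (2 powr (- a)) * ennreal (vol d * \<rho> ^ d) \<le> ?m"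
    proof -
      let ?B = "eball d u \<rho> - {y \<in> space (Rd d). enorm d y = 0}"
      have "emeasure (Rd d) (eball d u \<rho>) = emeasure (Rd d) ?B"
        by (rule emeasure_Diff_null_set[symmetric]) (auto simp: null_sets_def Rd_origin[OF d])
      then have "ennreal (2 powr (- a)) * ennreal (vol d * \<rho> ^ d) = ennreal (2 powr (- a)) * emeasure (Rd d) ?B"
        using \<rho> by (simp add: emeasure_eball)
      also have "\<dots> \<le> emeasure (mu a d) ?B"
      proof (rule mu_ge)
        fix y assume y: "y \<in> ?B"
        then have "enorm d y \<le> 1 + \<rho>" using subsetD[OF eball_subset_centered, of y d u \<rho>] u by (auto simp: eball_0)
        moreover have "0 < enorm d y" using y by (auto simp: less_le eball_def)
        ultimately show "2 powr (- a) \<le> enorm d y powr (- a)"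
          using \<rho> a0 by (intro powr_mono2') auto
      qed simp
      also have "\<dots> \<le> ?m" using subr by (intro emeasure_mono) auto
      finally show ?thesis .
    qed
    have low': "ennreal (c * 2 powr a * (vol d * \<rho> ^ d)) \<le> ennreal (c * 4 powr \<alpha>) * ?m" if c: "0 \<le> c" for c
    proof -
      have "ennreal (c * 2 powr a * (vol d * \<rho> ^ d))
          = ennreal (c * 4 powr a) * (ennreal (2 powr (- a)) * ennreal (vol d * \<rho> ^ d))"
      proof -
        have "(4::real) powr a = 2 powr a * 2 powr a" using powr_mult[of 2 2 a] by simp
        then have "c * 2 powr a * (vol d * \<rho> ^ d) = c * 4 powr a * (2 powr (- a) * (vol d * \<rho> ^ d))"
          by (simp add: powr_minus)
        then show ?thesis using c v \<rho> by (simp add: ennreal_mult'[symmetric])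
      qed
      also have "\<dots> \<le> ennreal (c * 4 powr \<alpha>) * ?m"
        using a c by (intro mult_mono low ennreal_leI mult_left_mono powr_mono) auto
      finally show ?thesis .
    qed
    define E1 where "E1 = E \<inter> {y \<in> space (Rd d). 1 / 2 \<le> enorm d y}"
    define E2 where "E2 = E \<inter> {y \<in> space (Rd d). enorm d y < 1 / 2}"
    have [measurable]: "E1 \<in> sets (Rd d)" "E2 \<in> sets (Rd d)" unfolding E1_def E2_def by measurable
    have b1: "emeasure (mu a d) E1 \<le> ennreal (1 * 4 powr \<alpha>) * ?m"
    proof -
      have "emeasure (mu a d) E1 \<le> ennreal ((1 / 2) powr (- a)) * emeasure (Rd d) E1"
        using a0 by (intro mu_le) (auto simp: E1_def intro!: powr_mono2')
      also have "\<dots> \<le> ennreal ((1 / 2) powr (- a)) * ennreal (vol d * \<rho> ^ d)"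
        by (intro mult_left_mono order_trans[OF emeasure_mono LE]) (auto simp: E1_def)
      also have "\<dots> = ennreal (1 * 2 powr a * (vol d * \<rho> ^ d))"
        by (simp add: powr_divide powr_minus ennreal_mult'[symmetric])
      also have "\<dots> \<le> ennreal (1 * 4 powr \<alpha>) * ?m" by (rule low') simp
      finally show ?thesis .
    qed
    \<comment> \<open>Norms below 1/2 occur only for \<open>S < 1/2\<close>, that is, for large
      \<rho>. If \<open>d \<ge> 2 * \<alpha>\<close>, then \<open>B(0, 1/2)\<close> has finite,
      comparable mass; otherwise the cone is used.\<close>
    have b2: "emeasure (mu a d) E2 \<le> ennreal (2 * 4 powr \<alpha> + 64 powr \<alpha>) * ?m"
    proof (cases "S < 1 / 2")
      case False
      then have "E2 = {}" using EE(2) by (force simp: E2_def)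
      then show ?thesis by simp
    next
      case S2: True
      show ?thesis
      proof (cases "2 * \<alpha> \<le> real d")
        case True
        then have ad: "a \<le> real d / 2" "a < real d" using a d a0 by auto
        have "S\<^sup>2 < (1 / 2)\<^sup>2" using S S2 by (intro power_strict_mono) auto
        then have "(1 / 2)\<^sup>2 \<le> \<rho>\<^sup>2" unfolding S(2) by (simp add: power2_eq_square)
        then have \<rho>2: "1 / 2 \<le> \<rho>" by (rule power2_le_imp_le) (use \<rho> in simp)
        have "emeasure (mu a d) E2 \<le> emeasure (mu a d) (ball0 d (1 / 2))"
          by (intro emeasure_mono) (auto simp: E2_def eball_0)
        also have "\<dots> = ennreal (real d / (real d - a) * vol d * (1 / 2) powr (real d - a))"
          by (rule mu_eball_0[OF d ad(2)]) simp
        also have "\<dots> \<le> ennreal (2 * 2 powr a * (vol d * \<rho> ^ d))"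
        proof (rule ennreal_leI)
          have "(1 / 2 :: real) powr (real d - a) = 2 powr a * (1 / 2) ^ d"
            by (simp add: powr_diff powr_realpow powr_divide power_divide)
          also have "\<dots> \<le> 2 powr a * \<rho> ^ d" using \<rho>2 by (intro mult_left_mono power_mono) auto
          finally have 1: "(1 / 2 :: real) powr (real d - a) \<le> 2 powr a * \<rho> ^ d" .
          have "real d / (real d - a) \<le> 2" using ad by (simp add: divide_le_eq)
          then have "real d / (real d - a) * vol d * (1 / 2) powr (real d - a) \<le> 2 * vol d * (2 powr a * \<rho> ^ d)"
            using v 1 by (intro mult_mono) auto
          then show "real d / (real d - a) * vol d * (1 / 2) powr (real d - a) \<le> 2 * 2 powr a * (vol d * \<rho> ^ d)"
            by (simp add: mult_ac)
        qed
        also have "\<dots> \<le> ennreal (2 * 4 powr \<alpha>) * ?m" by (rule low') simp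
        also have "\<dots> \<le> ennreal (2 * 4 powr \<alpha> + 64 powr \<alpha>) * ?m"
          by (intro mult_right_mono ennreal_leI) auto
        finally show ?thesis .
      next
        case False
        let ?A = "{s. 0 < s \<and> S \<le> s \<and> s < 1 / 2}"
        have A: "?A \<in> sets borel" by measurable
        have "emeasure (mu a d) E2 \<le> emeasure (mu a d) {y \<in> space (Rd d). enorm d y \<in> ?A}"
          using A by (intro emeasure_mono) (auto simp: E2_def EE)
        also have "\<dots> \<le> ennreal (8 ^ d) * ?m"
        proof (rule rad_cone_le[OF d u A eball_sets])
          fix y assume y: "y \<in> space (Rd d)" "enorm d y \<in> ?A" "1 / 2 \<le> ang d u y"
          define s where "s = enorm d y"
          have s: "0 < s" "S \<le> s" "s < 1 / 2" using y by (auto simp: s_def)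
          have "S\<^sup>2 \<le> s\<^sup>2" using s S by (intro power_mono) auto
          then have "1 - s\<^sup>2 \<le> \<rho>\<^sup>2" unfolding S(2) by simp
          also have "\<rho>\<^sup>2 \<le> r\<^sup>2" using \<rho> by (intro power_mono) auto
          finally have r2: "1 - s\<^sup>2 \<le> r\<^sup>2" .
          \<comment> \<open>As \<open>s \<le> 1/2 \<le> ang d u y\<close>, the squared distance to
            \<open>u\<close> is at most \<open>s^2 - s + 1 \<le> 1 - s^2\<close>.\<close>
          have "s * (1 / 2) \<le> s * ang d u y" using s y by (intro mult_left_mono) auto
          moreover have "s * s \<le> s * (1 / 2)" using s by (intro mult_left_mono) auto
          ultimately have "s\<^sup>2 - 2 * (s * ang d u y) + 1 \<le> r\<^sup>2"
            using r2 by (simp add: power2_eq_square)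
          then show "y \<in> eball d u r"
            using y u r by (subst mem_eball_ang) (auto simp: s_def)
        qed
        also have "(8::real) ^ d \<le> 64 powr \<alpha>"
        proof -
          have "(8::real) ^ d = 8 powr real d" by (simp add: powr_realpow)
          also have "\<dots> \<le> 8 powr (2 * \<alpha>)" using False by (intro powr_mono) auto
          also have "\<dots> = 64 powr \<alpha>" by (simp add: powr_powr[symmetric])
          finally show ?thesis .
        qed
        then have "ennreal (8 ^ d) * ?m \<le> ennreal (2 * 4 powr \<alpha> + 64 powr \<alpha>) * ?m"
          by (intro mult_right_mono ennreal_leI) (auto intro: order_trans)
        finally show ?thesis .
      qed
    qed
    have "emeasure (mu a d) E \<le> emeasure (mu a d) (E1 \<union> E2)"
      by (intro emeasure_mono) (auto simp: E1_def E2_def EE)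
    also have "\<dots> \<le> emeasure (mu a d) E1 + emeasure (mu a d) E2"
      by (intro emeasure_subadditive) auto
    also have "\<dots> \<le> ennreal (1 * 4 powr \<alpha>) * ?m + ennreal (2 * 4 powr \<alpha> + 64 powr \<alpha>) * ?m"
      by (intro add_mono b1 b2)
    also have "\<dots> = ennreal (3 * 4 powr \<alpha> + 64 powr \<alpha>) * ?m"
      by (simp add: distrib_right[symmetric] ennreal_plus[symmetric] del: ennreal_plus)
    also have "\<dots> \<le> ennreal (2 + 3 * 4 powr \<alpha> + 64 powr \<alpha>) * ?m"
      by (intro mult_right_mono ennreal_leI) auto
    finally show ?thesis unfolding E_def .
  qed
qed

lemma ball_hull_mu_unit:
  assumes d: "1 \<le> d" and u: "enorm d u = 1" and r: "0 < r" and a: "a \<le> \<alpha>" and \<alpha>: "0 \<le> \<alpha>"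
  shows "emeasure (mu a d) (ball_hull d u r) \<le> ennreal (hull_const \<alpha>) * emeasure (mu a d) (eball d u r)"
proof -
  let ?m = "emeasure (mu a d) (eball d u r)"
  have "emeasure (mu a d) (ball_hull d u r) \<le> emeasure (mu a d) (eball d u r \<union> (ball_hull d u r - eball d u r))"
    by (intro emeasure_mono) auto
  also have "\<dots> \<le> ?m + emeasure (mu a d) (ball_hull d u r - eball d u r)"
    by (intro emeasure_subadditive) auto
  also have "\<dots> \<le> ennreal 1 * ?m + ennreal (2 + 3 * 4 powr \<alpha> + 64 powr \<alpha>) * ?m"
    using ball_hull_excess_mu[OF assms] by (intro add_mono) auto
  also have "\<dots> = ennreal (1 + (2 + 3 * 4 powr \<alpha> + 64 powr \<alpha>)) * ?m"
    by (subst distrib_right[symmetric], subst ennreal_plus[symmetric]) auto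
  also have "1 + (2 + 3 * 4 powr \<alpha> + 64 powr \<alpha>) = hull_const \<alpha>" by (simp add: hull_const_def)
  finally show ?thesis .
qed

lemma ray_hull_scale:
  assumes c: "0 < c"
  shows "ray_hull (c * \<xi>) (c * r) (c * s) (c * t) \<longleftrightarrow> ray_hull \<xi> r s t"
proof -
  have D: "(c * t)\<^sup>2 - (c * \<xi>)\<^sup>2 + (c * r)\<^sup>2 = c\<^sup>2 * (t\<^sup>2 - \<xi>\<^sup>2 + r\<^sup>2)"
    by (simp add: power_mult_distrib algebra_simps)
  have sq: "sqrt ((c * t)\<^sup>2 - (c * \<xi>)\<^sup>2 + (c * r)\<^sup>2) = c * sqrt (t\<^sup>2 - \<xi>\<^sup>2 + r\<^sup>2)"
    unfolding D real_sqrt_mult using c by simp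
  define q where "q = sqrt (t\<^sup>2 - \<xi>\<^sup>2 + r\<^sup>2)"
  have "max (c * \<xi>) (c * t + c * q) = c * max \<xi> (t + q)"
    using c by (simp add: max_mult_distrib_left distrib_left)
  moreover have "c * t + c * q = c * (t + q)" "c * t - c * q = c * (t - q)" by (simp_all add: algebra_simps)
  ultimately show ?thesis
    unfolding ray_hull_def sq q_def[symmetric] unfolding D using c
    by (simp add: zero_le_mult_iff zero_less_mult_iff)
qed

lemma ball_hull_mu:
  assumes d: "1 \<le> d" and x: "0 < enorm d x" and r: "0 < r" and a: "a \<le> \<alpha>" and \<alpha>: "0 \<le> \<alpha>"
  shows "emeasure (mu a d) (ball_hull d x r) \<le> ennreal (hull_const \<alpha>) * emeasure (mu a d) (eball d x r)"
proof -
  define \<xi> where "\<xi> = enorm d x"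
  define u where "u = (\<lambda>i. x i / \<xi>)"
  have \<xi>: "0 < \<xi>" using x by (simp add: \<xi>_def)
  have u: "enorm d u = 1" and xu: "x = (\<lambda>i. \<xi> * u i)"
    using normalize_direction[OF x] unfolding u_def \<xi>_def by auto
  have angx: "ang d x y = \<xi> * ang d u y" for y
  proof -
    have "ip d x y = \<xi> * ip d u y"
      unfolding ip_def by (subst xu) (simp add: sum_distrib_left mult.assoc)
    then show ?thesis by (simp add: ang_def)
  qed
  have "{y \<in> space (Rd d). aff d (\<lambda>_. 0) \<xi> y \<in> ball_hull d x r} = ball_hull d u (r / \<xi>)"
  proof -
    have "ray_hull \<xi> r (\<xi> * enorm d y) (\<xi> * ang d u y) = ray_hull 1 (r / \<xi>) (enorm d y) (ang d u y)" for y
      using ray_hull_scale[OF \<xi>, of 1 "r / \<xi>" "enorm d y" "ang d u y"] \<xi> by simp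
    then show ?thesis
      using \<xi> u by (auto simp: ball_hull_def enorm_aff0 ang_aff angx \<xi>_def[symmetric] zero_less_mult_iff)
  qed
  then have "emeasure (mu a d) (ball_hull d x r)
      = ennreal (\<xi> powr (real d - a)) * emeasure (mu a d) (ball_hull d u (r / \<xi>))"
    using mu_scale[OF \<xi>, of "ball_hull d x r" d a] by simp
  also have "\<dots> \<le> ennreal (\<xi> powr (real d - a)) * (ennreal (hull_const \<alpha>) * emeasure (mu a d) (eball d u (r / \<xi>)))"
    using r \<xi> by (intro mult_left_mono ball_hull_mu_unit d u a \<alpha>) auto
  also have "\<dots> = ennreal (hull_const \<alpha>) * emeasure (mu a d) (eball d x r)"
    using mu_eball_scale[OF \<xi>, of a d u "r / \<xi>"] \<xi> by (simp add: xu[symmetric] mult_ac)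
  finally show ?thesis .
qed

section \<open>Uniform bounds\<close>

text \<open>The function given by \<open>radial\<close> is arbitrary off the positive reals.
  Restricting \<open>f\<close> to the first coordinate axis yields a profile measurable on the whole
  line.\<close>

lemma radial_profile:
  assumes d: "1 \<le> d" and f[measurable]: "f \<in> borel_measurable (Rd d)" and rad: "radial d f"
  obtains F :: "real \<Rightarrow> ennreal" where "F \<in> borel_measurable borel" "\<And>s. F s < \<infinity>"
    "\<And>y. y \<in> space (Rd d) \<Longrightarrow> enorm d y \<noteq> 0 \<Longrightarrow> ennreal \<bar>f y\<bar> = F (enorm d y)"
proof -
  define e :: "real \<Rightarrow> nat \<Rightarrow> real" where "e = (\<lambda>s. \<lambda>i\<in>{..<d}. if i = 0 then s else 0)"
  have [measurable]: "e \<in> borel \<rightarrow>\<^sub>M Rd d"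
    unfolding e_def Rd_def by (intro measurable_restrict) simp
  obtain f0 where f0: "\<And>x. x \<in> space (Rd d) \<Longrightarrow> enorm d x \<noteq> 0 \<Longrightarrow> f x = f0 (enorm d x)"
    using rad unfolding radial_def by blast
  have es: "e s \<in> space (Rd d)" for s by (simp add: e_def space_Rd)
  have "(\<Sum>i<d. (e s i)\<^sup>2) = s\<^sup>2" for s
  proof -
    have "(\<Sum>i<d. (e s i)\<^sup>2) = (\<Sum>i<d. if i = 0 then s\<^sup>2 else 0)"
      by (intro sum.cong) (auto simp: e_def)
    then show ?thesis using d by simp
  qed
  then have en: "enorm d (e s) = \<bar>s\<bar>" for s by (simp add: enorm_def)
  show ?thesis
  proof
    show "(\<lambda>s. ennreal \<bar>f (e s)\<bar>) \<in> borel_measurable borel" by measurable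
    fix y assume y: "y \<in> space (Rd d)" "enorm d y \<noteq> 0"
    have "f y = f (e (enorm d y))"
      using f0[OF y] f0[OF es, of "enorm d y"] y by (simp add: en)
    then show "ennreal \<bar>f y\<bar> = ennreal \<bar>f (e (enorm d y))\<bar>" by simp
  qed simp
qed

lemma ennreal_divide_self_le_1: "x / x \<le> (1 :: ennreal)"
proof (cases "x = 0 \<or> x = top")
  case False
  then show ?thesis using ennreal_divide_self[of x] by (simp add: less_top zero_less_iff_neq_zero)
qed (auto simp: ennreal_divide_top)

lemma rad_weak:
  assumes "F \<in> borel_measurable borel"
  shows "l * emeasure (rad a d) {t. l < interval_max (rad a d) F t} \<le> 2 * (\<integral>\<^sup>+ s. F s \<partial>rad a d)"
  by (rule interval_max_weak[OF sets_rad _ rad_nonpos assms]) (rule rad_interval_finite)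

lemma rad_closed_interval:
  assumes "F \<in> borel_measurable borel" "0 < t" "p \<le> t" "t \<le> q"
  shows "(\<integral>\<^sup>+ s \<in> {p..q}. F s \<partial>rad a d) \<le> emeasure (rad a d) {p..q} * interval_max (rad a d) F t"
  by (rule closed_interval_integral_le[OF sets_rad _ rad_nonpos assms]) (rule rad_interval_finite)

text \<open>The ball in the coordinates (norm, angular variable). Genuine angular variables satisfy
  \<open>t \<le> \<xi>\<close> by Cauchy-Schwarz; as \<open>t\<close> ranges over the whole line,
  this is imposed.\<close>

definition segment_set :: "real \<Rightarrow> real \<Rightarrow> (real \<times> real) set" where
  "segment_set \<xi> r = {(s, t). 0 < s \<and> t \<le> \<xi> \<and> s\<^sup>2 - 2 * (s * t) + \<xi>\<^sup>2 \<le> r\<^sup>2}"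

definition hull_set :: "real \<Rightarrow> real \<Rightarrow> (real \<times> real) set" where
  "hull_set \<xi> r = {(s, t). 0 < s \<and> t \<le> \<xi> \<and> ray_hull \<xi> r s t}"

lemma segment_set_measurable [measurable]: "segment_set \<xi> r \<in> sets (borel \<Otimes>\<^sub>M borel)"
proof -
  have "segment_set \<xi> r = {z \<in> space (borel \<Otimes>\<^sub>M borel). 0 < fst z}
     \<inter> {z \<in> space (borel \<Otimes>\<^sub>M borel). snd z \<le> \<xi>}
     \<inter> {z \<in> space (borel \<Otimes>\<^sub>M borel). (fst z)\<^sup>2 - 2 * (fst z * snd z) + \<xi>\<^sup>2 \<le> r\<^sup>2}"
    by (auto simp: segment_set_def space_pair_measure)
  also have "\<dots> \<in> sets (borel \<Otimes>\<^sub>M borel)" by measurable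
  finally show ?thesis .
qed

lemma hull_set_measurable [measurable]: "hull_set \<xi> r \<in> sets (borel \<Otimes>\<^sub>M borel)"
proof -
  define g where "g = (\<lambda>z :: real \<times> real. sqrt ((snd z)\<^sup>2 - \<xi>\<^sup>2 + r\<^sup>2))"
  let ?B = "borel \<Otimes>\<^sub>M borel :: (real \<times> real) measure"
  have g: "g \<in> borel_measurable ?B" unfolding g_def by measurable
  have m: "(\<lambda>z. max \<xi> (snd z + g z)) \<in> borel_measurable ?B" using g by measurable
  have "hull_set \<xi> r = {z \<in> space ?B. 0 < fst z} \<inter> {z \<in> space ?B. snd z \<le> \<xi>}
     \<inter> {z \<in> space ?B. 0 \<le> (snd z)\<^sup>2 - \<xi>\<^sup>2 + r\<^sup>2} \<inter> {z \<in> space ?B. 0 < snd z + g z}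
     \<inter> {z \<in> space ?B. snd z - g z \<le> fst z} \<inter> {z \<in> space ?B. fst z \<le> max \<xi> (snd z + g z)}"
    unfolding hull_set_def ray_hull_def g_def space_pair_measure by auto
  also have "\<dots> \<in> sets ?B"
    by (intro sets.Int borel_measurable_less borel_measurable_le borel_measurable_const m
        borel_measurable_add borel_measurable_diff borel_measurable_power g
        measurable_fst measurable_snd)
  finally show ?thesis .
qed

text \<open>The near end \<open>p\<close> satisfies \<open>p \<le> t \<le> \<xi>\<close>, so moving
  the far end up to \<xi> gives an interval containing \<xi>. The maximal function value that bounds
  its average does not depend on \<open>t\<close>.\<close>

lemma segment_integral_le:
  assumes F[measurable]: "F \<in> borel_measurable borel" and \<xi>: "0 < \<xi>"
  shows "(\<integral>\<^sup>+s. F s * indicator (segment_set \<xi> r) (s, t) \<partial>rad a d)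
    \<le> interval_max (rad a d) F \<xi> * (\<integral>\<^sup>+s. indicator (hull_set \<xi> r) (s, t) \<partial>rad a d)"
proof -
  define D where "D = t\<^sup>2 - \<xi>\<^sup>2 + r\<^sup>2"
  define p where "p = t - sqrt D"
  define q where "q = max \<xi> (t + sqrt D)"
  have seg: "0 \<le> D \<and> p \<le> s \<and> s \<le> t + sqrt D \<and> 0 < t + sqrt D" if "(s, t) \<in> segment_set \<xi> r" for s
  proof -
    have s: "0 < s" "s\<^sup>2 - 2 * (s * t) + \<xi>\<^sup>2 \<le> r\<^sup>2" using that by (auto simp: segment_set_def)
    then have le: "(s - t)\<^sup>2 \<le> D" by (simp add: D_def power2_eq_square algebra_simps)
    then have "\<bar>s - t\<bar> \<le> sqrt D" using real_sqrt_le_mono[OF le] by simp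
    moreover have "0 \<le> D" using le zero_le_power2[of "s - t"] by linarith
    ultimately show ?thesis using s by (auto simp: p_def)
  qed
  show ?thesis
  proof (cases "t \<le> \<xi> \<and> 0 \<le> D \<and> 0 < t + sqrt D")
    case False
    then have "(s, t) \<notin> segment_set \<xi> r" for s using seg[of s] by (auto simp: segment_set_def)
    then show ?thesis by simp
  next
    case True
    have pq: "p \<le> \<xi>" "\<xi> \<le> q" using True by (auto simp: p_def q_def intro: order_trans[of _ t])
    have "(\<integral>\<^sup>+s. F s * indicator (segment_set \<xi> r) (s, t) \<partial>rad a d) \<le> (\<integral>\<^sup>+s\<in>{p..q}. F s \<partial>rad a d)"
      using seg by (intro nn_integral_mono) (force simp: q_def split: split_indicator)
    also have "\<dots> \<le> emeasure (rad a d) {p..q} * interval_max (rad a d) F \<xi>"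
      by (rule rad_closed_interval[OF F \<xi> pq])
    also have "\<dots> \<le> (\<integral>\<^sup>+s. indicator (hull_set \<xi> r) (s, t) \<partial>rad a d) * interval_max (rad a d) F \<xi>"
    proof (rule mult_right_mono)
      have "AE s in rad a d. s \<notin> {..0}" by (rule AE_not_in) (auto simp: null_sets_def rad_nonpos)
      then have "(\<integral>\<^sup>+s. indicator {p..q} s \<partial>rad a d) \<le> (\<integral>\<^sup>+s. indicator (hull_set \<xi> r) (s, t) \<partial>rad a d)"
        using True by (intro nn_integral_mono_AE)
          (auto elim!: eventually_mono split: split_indicator simp: hull_set_def ray_hull_def D_def[symmetric] p_def q_def)
      then show "emeasure (rad a d) {p..q} \<le> (\<integral>\<^sup>+s. indicator (hull_set \<xi> r) (s, t) \<partial>rad a d)" by simp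
    qed simp
    finally show ?thesis by (simp add: mult.commute)
  qed
qed

text \<open>The bound on each ray is integrated over directions; the prolonged segments then add up
  to the mass of the hull.\<close>

lemma maxop_le_interval_max:
  assumes d: "1 \<le> d" and a: "a \<le> \<alpha>" and \<alpha>: "0 \<le> \<alpha>" and F[measurable]: "F \<in> borel_measurable borel"
    and f: "\<And>y. y \<in> space (Rd d) \<Longrightarrow> enorm d y \<noteq> 0 \<Longrightarrow> ennreal \<bar>f y\<bar> = F (enorm d y)"
    and x: "enorm d x \<noteq> 0"
  shows "maxop (mu a d) d f x \<le> ennreal (hull_const \<alpha>) * interval_max (rad a d) F (enorm d x)"
  unfolding maxop_def
proof (rule SUP_least, clarify)
  fix r :: real assume r: "0 < r"
  define \<xi> where "\<xi> = enorm d x"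
  have \<xi>: "0 < \<xi>" using x by (simp add: \<xi>_def less_le)
  let ?N = "interval_max (rad a d) F \<xi>"
  let ?m = "emeasure (mu a d) (eball d x r)"
  have "(\<integral>\<^sup>+ y \<in> eball d x r. ennreal \<bar>f y\<bar> \<partial>mu a d)
     = (\<integral>\<^sup>+ y. F (enorm d y) * indicator (segment_set \<xi> r) (enorm d y, ang d x y) \<partial>mu a d)"
  proof (rule nn_integral_cong_AE)
    show "AE y in mu a d. ennreal \<bar>f y\<bar> * indicator (eball d x r) y
        = F (enorm d y) * indicator (segment_set \<xi> r) (enorm d y, ang d x y)"
      using AE_mu_nonzero[of d a] AE_space[of "mu a d"]
    proof eventually_elim
      case (elim y)
      then have "y \<in> eball d x r \<longleftrightarrow> (enorm d y, ang d x y) \<in> segment_set \<xi> r"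
        using r ang_le[of d x y] by (simp add: mem_eball_ang segment_set_def \<xi>_def less_le)
      then show ?case using elim f[of y] by (simp split: split_indicator)
    qed
  qed
  also have "\<dots> = (\<integral>\<^sup>+t. (\<integral>\<^sup>+s. F s * indicator (segment_set \<xi> r) (s, t) \<partial>rad a d) \<partial>angular d (ang d x))"
    by (rule nn_integral_mu_polar[OF d ang_measurable]) (auto simp: ang_aff case_prod_beta)
  also have "\<dots> \<le> (\<integral>\<^sup>+t. ?N * (\<integral>\<^sup>+s. indicator (hull_set \<xi> r) (s, t) \<partial>rad a d) \<partial>angular d (ang d x))"
    by (intro nn_integral_mono segment_integral_le F \<xi>)
  also have "\<dots> = ?N * (\<integral>\<^sup>+t. (\<integral>\<^sup>+s. indicator (hull_set \<xi> r) (s, t) \<partial>rad a d) \<partial>angular d (ang d x))"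
  proof (rule nn_integral_cmult)
    interpret sigma_finite_measure "rad a d" by (rule sigma_finite_rad)
    have "(\<lambda>z. indicator (hull_set \<xi> r) (snd z, fst z) :: ennreal) \<in> borel_measurable (borel \<Otimes>\<^sub>M borel)"
      by measurable
    then show "(\<lambda>t. \<integral>\<^sup>+s. indicator (hull_set \<xi> r) (s, t) \<partial>rad a d) \<in> borel_measurable (angular d (ang d x))"
      by (intro borel_measurable_nn_integral) (simp add: case_prod_beta angular_def)
  qed
  also have "(\<integral>\<^sup>+t. (\<integral>\<^sup>+s. indicator (hull_set \<xi> r) (s, t) \<partial>rad a d) \<partial>angular d (ang d x))
     = (\<integral>\<^sup>+ y. indicator (hull_set \<xi> r) (enorm d y, ang d x y) \<partial>mu a d)"
    by (rule nn_integral_mu_polar[OF d ang_measurable, symmetric]) (auto simp: ang_aff case_prod_beta)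
  also have "\<dots> = (\<integral>\<^sup>+ y. indicator (ball_hull d x r) y \<partial>mu a d)"
    using ang_le by (intro nn_integral_cong) (auto simp: ball_hull_def hull_set_def \<xi>_def split: split_indicator)
  also have "\<dots> = emeasure (mu a d) (ball_hull d x r)" by simp
  also have "?N * \<dots> \<le> ?N * (ennreal (hull_const \<alpha>) * ?m)"
    using \<xi> by (intro mult_left_mono ball_hull_mu d r a \<alpha>) (auto simp: \<xi>_def)
  finally have "(\<integral>\<^sup>+ y \<in> eball d x r. ennreal \<bar>f y\<bar> \<partial>mu a d) / ?m \<le> ?N * (ennreal (hull_const \<alpha>) * ?m) / ?m"
    by (rule divide_right_mono_ennreal)
  also have "\<dots> = (ennreal (hull_const \<alpha>) * ?N) * (?m / ?m)"
    by (simp add: ennreal_times_divide mult_ac)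
  \<comment> \<open>Not an equality: for a ball of infinite mass the quotient is 0.\<close>
  also have "\<dots> \<le> (ennreal (hull_const \<alpha>) * ?N) * 1"
    by (intro mult_left_mono) (auto simp: ennreal_divide_self_le_1)
  finally show "(\<integral>\<^sup>+ y \<in> eball d x r. ennreal \<bar>f y\<bar> \<partial>mu a d) / ?m
      \<le> ennreal (hull_const \<alpha>) * interval_max (rad a d) F (enorm d x)"
    by (simp add: \<xi>_def)
qed

lemma weak_const_1_le:
  assumes d: "1 \<le> d" and a: "a \<le> \<alpha>" and \<alpha>: "0 \<le> \<alpha>"
  shows "weak_const 1 a d \<le> ennreal (2 * hull_const \<alpha>)"
  unfolding weak_const_def
proof (rule Inf_lower, clarsimp, intro exI conjI ballI allI impI)
  define C where "C = hull_const \<alpha>"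
  have C: "0 < C" using hull_const_ge[of \<alpha>] by (simp add: C_def)
  show "ennreal (2 * hull_const \<alpha>) = ennreal (2 * C)" "0 \<le> 2 * C" using C by (simp_all add: C_def)
  fix f t assume "f \<in> radial_Lp 1 a d" and t: "(0::real) < t"
  then have fm[measurable]: "f \<in> borel_measurable (Rd d)" and "radial d f" by (auto simp: radial_Lp_def)
  then obtain F where F[measurable]: "F \<in> borel_measurable borel"
    and fF: "\<And>y. y \<in> space (Rd d) \<Longrightarrow> enorm d y \<noteq> 0 \<Longrightarrow> ennreal \<bar>f y\<bar> = F (enorm d y)"
    using radial_profile[OF d] by metis
  let ?N = "interval_max (rad a d) F"
  let ?L = "{x \<in> space (Rd d). ennreal t < maxop (mu a d) d f x}"
  let ?Z = "{x \<in> space (Rd d). enorm d x = 0}"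
  let ?U = "{x \<in> space (Rd d). ennreal (t / C) < ?N (enorm d x)}"
  have U[measurable]: "?U \<in> sets (Rd d)" "?Z \<in> sets (Rd d)" by measurable
  have "?L \<subseteq> ?Z \<union> ?U"
  proof clarify
    fix x assume x: "x \<in> space (Rd d)" "ennreal t < maxop (mu a d) d f x" and nU: "\<not> ennreal (t / C) < ?N (enorm d x)"
    show "enorm d x = 0"
    proof (rule ccontr)
      assume "enorm d x \<noteq> 0"
      then have "maxop (mu a d) d f x \<le> ennreal C * ?N (enorm d x)"
        unfolding C_def by (intro maxop_le_interval_max d a \<alpha> F fF)
      also have "\<dots> \<le> ennreal C * ennreal (t / C)" using nU by (intro mult_left_mono) auto
      also have "\<dots> = ennreal t" using C t by (simp add: ennreal_mult'[symmetric])
      finally show False using x by simp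
    qed
  qed
  then have "emeasure (mu a d) ?L \<le> emeasure (mu a d) (?Z \<union> ?U)" by (intro emeasure_mono) auto
  also have "\<dots> \<le> emeasure (mu a d) ?Z + emeasure (mu a d) ?U" by (intro emeasure_subadditive) auto
  also have "\<dots> = emeasure (rad a d) {s. ennreal (t / C) < ?N s}"
  proof -
    have "{s. ennreal (t / C) < ?N s} \<in> sets borel" by measurable
    then have "emeasure (rad a d) {s. ennreal (t / C) < ?N s} = emeasure (mu a d) ?U"
      unfolding rad_def by (subst emeasure_distr) (auto intro!: arg_cong[where f="emeasure _"])
    then show ?thesis by (simp add: mu_origin)
  qed
  finally have "ennreal t * emeasure (mu a d) ?L \<le> ennreal t * emeasure (rad a d) {s. ennreal (t / C) < ?N s}"
    by (intro mult_left_mono) auto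
  also have "\<dots> = ennreal C * (ennreal (t / C) * emeasure (rad a d) {s. ennreal (t / C) < ?N s})"
    using C t by (simp add: mult.assoc[symmetric] ennreal_mult'[symmetric])
  also have "\<dots> \<le> ennreal C * (2 * (\<integral>\<^sup>+s. F s \<partial>rad a d))"
    by (intro mult_left_mono rad_weak F) auto
  also have "\<dots> = ennreal (2 * C) * (\<integral>\<^sup>+s. F s \<partial>rad a d)"
    using C by (simp add: ennreal_mult' mult_ac)
  also have "(\<integral>\<^sup>+s. F s \<partial>rad a d) = (\<integral>\<^sup>+y. ennreal \<bar>f y\<bar> \<partial>mu a d)"
  proof -
    have "AE y in mu a d. F (enorm d y) = ennreal \<bar>f y\<bar>"
      using AE_mu_nonzero[of d a] AE_space[of "mu a d"] by eventually_elim (simp add: fF)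
    then show ?thesis by (subst nn_integral_rad[OF F]) (rule nn_integral_cong_AE)
  qed
  finally show "ennreal t * emeasure (mu a d) ?L \<le> ennreal (2 * C) * lpnorm (mu a d) 1 (\<lambda>x. ennreal \<bar>f x\<bar>)"
    by (simp add: lpnorm_def)
qed

section \<open>Interpolation and strong type bounds\<close>

lemma nn_integral_powr_strict:
  fixes e c :: real
  assumes "-1 < e" "0 \<le> c"
  shows "(\<integral>\<^sup>+t. ennreal (t powr e) * indicator {0..<c} t \<partial>lborel) = ennreal (c powr (e + 1) / (e + 1))"
proof -
  have "AE t in lborel. ennreal (t powr e) * indicator {0..<c} t = ennreal (t powr e) * indicator {0..c} t"
    using AE_lborel_singleton[of c] by eventually_elim (auto split: split_indicator)
  then show ?thesis
    unfolding nn_integral_powr_from_0[OF assms, symmetric] by (rule nn_integral_cong_AE)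
qed

text \<open>\<open>x^p\<close> is the integral of \<open>p * t^(p-1)\<close> over
  \<open>0 \<le> t < x\<close>. The case of infinite \<open>x\<close> follows from the finite ones
  by monotonicity.\<close>

lemma ennpow_layer_cake_le:
  assumes p: "1 < p"
  shows "ennpow x p \<le> (\<integral>\<^sup>+t. ennreal (p * t powr (p - 1)) * (if 0 \<le> t \<and> ennreal t < x then 1 else 0) \<partial>lborel)"
    (is "_ \<le> ?I x")
proof -
  have fin: "?I (ennreal n) = ennreal (n powr p)" if "0 \<le> n" for n
  proof -
    have "?I (ennreal n) = (\<integral>\<^sup>+t. ennreal p * (ennreal (t powr (p - 1)) * indicator {0..<n} t) \<partial>lborel)"
      using p that by (intro nn_integral_cong) (auto simp: ennreal_mult' ennreal_less_iff split: split_indicator)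
    also have "\<dots> = ennreal p * ennreal (n powr p / p)"
      using p that nn_integral_powr_strict[of "p - 1" n] by (subst nn_integral_cmult) auto
    finally show ?thesis using p by (simp add: ennreal_mult'[symmetric])
  qed
  show ?thesis
  proof (cases x)
    case (real n)
    then show ?thesis by (simp add: fin ennpow_ennreal)
  next
    case top
    have "?I top = top"
    proof (rule ccontr)
      assume "?I top \<noteq> top"
      then obtain c where c: "0 \<le> c" "?I top = ennreal c" by (cases "?I top") auto
      define n where "n = (c + 1) powr (1 / p)"
      have "ennreal (c + 1) = ?I (ennreal n)"
        using p c by (subst fin) (auto simp: n_def powr_powr)
      also have "\<dots> \<le> ?I top" by (intro nn_integral_mono mult_left_mono) auto
      finally show False using c by simp
    qed
    then show ?thesis using top by simp
  qed
qed

lemma borel_measurable_rad [simp]: "borel_measurable (rad a d) = borel_measurable borel"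
  by (rule measurable_cong_sets) simp_all

text \<open>\<open>F\<close> is at most its part above \<open>t\<close> plus the constant
  \<open>t\<close>, and averages of a constant do not exceed it.\<close>

lemma interval_max_truncate:
  assumes F[measurable]: "F \<in> borel_measurable borel" and t: "0 \<le> t"
  shows "interval_max (rad a d) F s \<le> interval_max (rad a d) (\<lambda>s. F s * (if ennreal t < F s then 1 else 0)) s + ennreal t"
  unfolding interval_max_def
proof (rule SUP_least)
  let ?G = "\<lambda>s. F s * (if ennreal t < F s then 1 else 0)"
  fix i assume i: "i \<in> rational_intervals"
  let ?I = "{fst i<..<snd i}"
  let ?m = "emeasure (rad a d) ?I"
  have G: "?G \<in> borel_measurable borel" by measurable
  have "(\<integral>\<^sup>+ s \<in> ?I. F s \<partial>rad a d) \<le> (\<integral>\<^sup>+ s. ?G s * indicator ?I s + ennreal t * indicator ?I s \<partial>rad a d)"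
    by (intro nn_integral_mono) (auto split: split_indicator)
  also have "\<dots> = (\<integral>\<^sup>+ s \<in> ?I. ?G s \<partial>rad a d) + ennreal t * ?m"
    by (subst nn_integral_add) (simp_all add: nn_integral_cmult_indicator)
  finally have "interval_avg (rad a d) F i \<le> ((\<integral>\<^sup>+ s \<in> ?I. ?G s \<partial>rad a d) + ennreal t * ?m) / ?m"
    unfolding interval_avg_def by (rule divide_right_mono_ennreal)
  also have "\<dots> = interval_avg (rad a d) ?G i + ennreal t * (?m / ?m)"
    by (simp add: interval_avg_def add_divide_distrib_ennreal ennreal_times_divide)
  also have "\<dots> \<le> interval_avg (rad a d) ?G i + ennreal t * 1"
    by (intro add_left_mono mult_left_mono ennreal_divide_self_le_1) simp
  finally have "indicator ?I s * interval_avg (rad a d) F i \<le> indicator ?I s * interval_avg (rad a d) ?G i + ennreal t"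
    by (auto split: split_indicator)
  also have "\<dots> \<le> (SUP i \<in> rational_intervals. indicator {fst i<..<snd i} s * interval_avg (rad a d) ?G i) + ennreal t"
    by (intro add_right_mono SUP_upper i)
  finally show "indicator ?I s * interval_avg (rad a d) F i
    \<le> (SUP i \<in> rational_intervals. indicator {fst i<..<snd i} s * interval_avg (rad a d) ?G i) + ennreal t" .
qed

lemma interval_max_truncated_weak:
  assumes F[measurable]: "F \<in> borel_measurable borel" and t: "0 < t"
  shows "ennreal (t / 2) * emeasure (rad a d) {s. ennreal t < interval_max (rad a d) F s}
    \<le> 2 * (\<integral>\<^sup>+s. F s * (if ennreal (t / 2) < F s then 1 else 0) \<partial>rad a d)"
proof -
  let ?G = "\<lambda>s. F s * (if ennreal (t / 2) < F s then 1 else 0)"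
  have G[measurable]: "?G \<in> borel_measurable borel" by measurable
  have "{s. ennreal t < interval_max (rad a d) F s} \<subseteq> {s. ennreal (t / 2) < interval_max (rad a d) ?G s}"
  proof clarify
    fix s assume s: "ennreal t < interval_max (rad a d) F s"
    show "ennreal (t / 2) < interval_max (rad a d) ?G s"
    proof (rule ccontr)
      assume "\<not> ?thesis"
      then have "interval_max (rad a d) ?G s + ennreal (t / 2) \<le> ennreal (t / 2) + ennreal (t / 2)"
        by (intro add_right_mono) simp
      also have "\<dots> = ennreal t" using t by (simp add: ennreal_plus[symmetric] del: ennreal_plus)
      finally show False using interval_max_truncate[OF F, of "t / 2" a d s] s t
        by (meson half_gt_zero leD less_eq_real_def order_trans)
    qed
  qed
  then have "ennreal (t / 2) * emeasure (rad a d) {s. ennreal t < interval_max (rad a d) F s}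
     \<le> ennreal (t / 2) * emeasure (rad a d) {s. ennreal (t / 2) < interval_max (rad a d) ?G s}"
    by (intro mult_left_mono emeasure_mono) auto
  also have "\<dots> \<le> 2 * (\<integral>\<^sup>+s. ?G s \<partial>rad a d)" by (rule rad_weak[OF G])
  finally show ?thesis .
qed

text \<open>The Marcinkiewicz argument between the weak type \<open>(1,1)\<close> bound and the trivial \<open>L\<^sup>\<infinity>\<close> bound.\<close>
lemma interval_max_strong:
  assumes F[measurable]: "F \<in> borel_measurable borel" and fin: "\<And>s. F s < \<infinity>" and p: "1 < p"
  shows "(\<integral>\<^sup>+s. ennpow (interval_max (rad a d) F s) p \<partial>rad a d)
    \<le> ennreal (4 * p * 2 powr (p - 1) / (p - 1)) * (\<integral>\<^sup>+s. ennpow (F s) p \<partial>rad a d)"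
proof -
  interpret R: sigma_finite_measure "rad a d" by (rule sigma_finite_rad)
  interpret pair_sigma_finite "rad a d" lborel ..
  let ?N = "interval_max (rad a d) F"
  have ms: "sets (rad a d \<Otimes>\<^sub>M lborel) = sets (borel \<Otimes>\<^sub>M borel)"
    by (intro sets_pair_measure_cong) auto
  have "(\<integral>\<^sup>+s. ennpow (?N s) p \<partial>rad a d)
     \<le> (\<integral>\<^sup>+s. (\<integral>\<^sup>+t. ennreal (p * t powr (p - 1)) * (if 0 \<le> t \<and> ennreal t < ?N s then 1 else 0) \<partial>lborel) \<partial>rad a d)"
    by (intro nn_integral_mono ennpow_layer_cake_le p)
  also have "\<dots> = (\<integral>\<^sup>+t. (\<integral>\<^sup>+s. ennreal (p * t powr (p - 1)) * (if 0 \<le> t \<and> ennreal t < ?N s then 1 else 0) \<partial>rad a d) \<partial>lborel)"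
    by (rule Fubini'[symmetric]) (simp add: case_prod_beta measurable_cong_sets[OF ms refl])
  also have "\<dots> \<le> (\<integral>\<^sup>+t. (\<integral>\<^sup>+s. ennreal (4 * p * t powr (p - 2)) * (F s * (if 0 \<le> t \<and> ennreal (t / 2) < F s then 1 else 0)) \<partial>rad a d) \<partial>lborel)"
  proof (rule nn_integral_mono_AE)
    have "(\<integral>\<^sup>+s. ennreal (p * t powr (p - 1)) * (if 0 \<le> t \<and> ennreal t < ?N s then 1 else 0) \<partial>rad a d)
      \<le> (\<integral>\<^sup>+s. ennreal (4 * p * t powr (p - 2)) * (F s * (if 0 \<le> t \<and> ennreal (t / 2) < F s then 1 else 0)) \<partial>rad a d)"
      if t0: "t \<noteq> 0" for t
    proof (cases "0 < t")
      case False
      then show ?thesis using t0 by simp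
    next
      case True
      have "(\<integral>\<^sup>+s. ennreal (p * t powr (p - 1)) * (if 0 \<le> t \<and> ennreal t < ?N s then 1 else 0) \<partial>rad a d)
        = (\<integral>\<^sup>+s. ennreal (p * t powr (p - 1)) * indicator {s. ennreal t < ?N s} s \<partial>rad a d)"
        using True by (intro nn_integral_cong) (auto split: split_indicator)
      also have "\<dots> = ennreal (p * t powr (p - 1)) * emeasure (rad a d) {s. ennreal t < ?N s}"
        by (rule nn_integral_cmult_indicator) simp
      \<comment> \<open>One factor \<open>t\<close> is split off as \<open>2 * (t / 2)\<close> to
        feed the truncated weak bound; its own constant 2 then turns \<open>2 * p\<close> into
        \<open>4 * p\<close>.\<close>
      also have "\<dots> = ennreal (2 * p * t powr (p - 2)) * (ennreal (t / 2) * emeasure (rad a d) {s. ennreal t < ?N s})"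
      proof -
        have "t powr (p - 1) = t powr (p - 2) * t powr 1" by (subst powr_add[symmetric]) simp
        then have "p * t powr (p - 1) = 2 * p * t powr (p - 2) * (t / 2)" using True by simp
        then have "ennreal (p * t powr (p - 1)) = ennreal (2 * p * t powr (p - 2)) * ennreal (t / 2)"
          using p True by (subst ennreal_mult'[symmetric]) auto
        then show ?thesis by (simp add: mult.assoc)
      qed
      also have "\<dots> \<le> ennreal (2 * p * t powr (p - 2)) * (2 * (\<integral>\<^sup>+s. F s * (if ennreal (t / 2) < F s then 1 else 0) \<partial>rad a d))"
        by (intro mult_left_mono interval_max_truncated_weak F True) simp
      also have "\<dots> = ennreal (4 * p * t powr (p - 2)) * (\<integral>\<^sup>+s. F s * (if ennreal (t / 2) < F s then 1 else 0) \<partial>rad a d)"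
      proof -
        have "ennreal (4 * p * t powr (p - 2)) = ennreal (2 * p * t powr (p - 2)) * ennreal 2"
          using p by (subst ennreal_mult'[symmetric]) (auto simp: mult_ac)
        then show ?thesis by (simp add: mult.assoc)
      qed
      also have "\<dots> = (\<integral>\<^sup>+s. ennreal (4 * p * t powr (p - 2)) * (F s * (if 0 \<le> t \<and> ennreal (t / 2) < F s then 1 else 0)) \<partial>rad a d)"
        using True by (subst nn_integral_cmult) auto
      finally show ?thesis .
    qed
    then show "AE t in lborel. (\<integral>\<^sup>+s. ennreal (p * t powr (p - 1)) * (if 0 \<le> t \<and> ennreal t < ?N s then 1 else 0) \<partial>rad a d)
      \<le> (\<integral>\<^sup>+s. ennreal (4 * p * t powr (p - 2)) * (F s * (if 0 \<le> t \<and> ennreal (t / 2) < F s then 1 else 0)) \<partial>rad a d)"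
      using AE_lborel_singleton[of 0] by (auto elim!: eventually_mono)
  qed
  also have "\<dots> = (\<integral>\<^sup>+s. (\<integral>\<^sup>+t. ennreal (4 * p * t powr (p - 2)) * (F s * (if 0 \<le> t \<and> ennreal (t / 2) < F s then 1 else 0)) \<partial>lborel) \<partial>rad a d)"
    by (rule Fubini') (simp add: case_prod_beta measurable_cong_sets[OF ms refl])
  also have "\<dots> = (\<integral>\<^sup>+s. ennreal (4 * p * 2 powr (p - 1) / (p - 1)) * ennpow (F s) p \<partial>rad a d)"
  proof (rule nn_integral_cong)
    fix s
    obtain m where m: "F s = ennreal m" "0 \<le> m" using fin[of s] by (cases "F s") auto
    \<comment> \<open>The truncation \<open>t / 2 < F s\<close> limits \<open>t\<close> to
      \<open>[0, 2m)\<close>, whence \<open>2 powr (p - 1)\<close>; \<open>p > 1\<close> makes the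
      exponent \<open>p - 2\<close> integrable at 0.\<close>
    have "(\<integral>\<^sup>+t. ennreal (4 * p * t powr (p - 2)) * (F s * (if 0 \<le> t \<and> ennreal (t / 2) < F s then 1 else 0)) \<partial>lborel)
       = (\<integral>\<^sup>+t. ennreal (4 * p * m) * (ennreal (t powr (p - 2)) * indicator {0..<2 * m} t) \<partial>lborel)"
      using m p by (intro nn_integral_cong)
        (auto simp: ennreal_less_iff ennreal_mult'[symmetric] mult_ac split: split_indicator)
    also have "\<dots> = ennreal (4 * p * m) * ennreal ((2 * m) powr (p - 1) / (p - 1))"
      using p m nn_integral_powr_strict[of "p - 2" "2 * m"] by (subst nn_integral_cmult) auto
    also have "\<dots> = ennreal (4 * p * 2 powr (p - 1) / (p - 1)) * ennreal (m powr p)"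
    proof -
      have "m * m powr (p - 1) = m powr p"
        using m p by (cases "m = 0") (auto simp: powr_diff)
      then have "4 * p * m * ((2 * m) powr (p - 1) / (p - 1)) = 4 * p * 2 powr (p - 1) / (p - 1) * m powr p"
        using m by (simp add: powr_mult mult_ac)
      then show ?thesis using p m by (simp add: ennreal_mult'[symmetric])
    qed
    finally show "(\<integral>\<^sup>+t. ennreal (4 * p * t powr (p - 2)) * (F s * (if 0 \<le> t \<and> ennreal (t / 2) < F s then 1 else 0)) \<partial>lborel)
       = ennreal (4 * p * 2 powr (p - 1) / (p - 1)) * ennpow (F s) p"
      using m by (simp add: ennpow_ennreal)
  qed
  also have "\<dots> = ennreal (4 * p * 2 powr (p - 1) / (p - 1)) * (\<integral>\<^sup>+s. ennpow (F s) p \<partial>rad a d)"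
  proof (rule nn_integral_cmult)
    have "ennpow (F s) p = ennreal (enn2real (F s) powr p)" for s
      using fin[of s] by (simp add: ennpow_def)
    then show "(\<lambda>s. ennpow (F s) p) \<in> borel_measurable (rad a d)" by simp
  qed
  finally show ?thesis .
qed

lemma ennpow_mult_const:
  assumes c: "0 < c" and q: "0 < q"
  shows "ennpow (ennreal c * x) q = ennreal (c powr q) * ennpow x q"
proof (cases x)
  case (real r)
  then show ?thesis using c
    by (simp add: ennreal_mult'[symmetric] ennpow_ennreal powr_mult)
next
  case top
  then show ?thesis using c by (simp add: ennreal_mult_top ennpow_def)
qed

lemma strong_const_le:
  assumes d: "1 \<le> d" and a: "a \<le> \<alpha>" and \<alpha>: "0 \<le> \<alpha>" and p: "1 < p"
  shows "strong_const p a d \<le> ennreal (hull_const \<alpha> * (4 * p * 2 powr (p - 1) / (p - 1)) powr (1 / p))"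
  unfolding strong_const_def
proof (rule Inf_lower, clarsimp, intro exI conjI ballI)
  define C where "C = hull_const \<alpha>"
  define K where "K = 4 * p * 2 powr (p - 1) / (p - 1)"
  have C: "0 < C" using hull_const_ge[of \<alpha>] by (simp add: C_def)
  have K: "0 < K" using p by (simp add: K_def)
  show "ennreal (hull_const \<alpha> * (4 * p * 2 powr (p - 1) / (p - 1)) powr (1 / p)) = ennreal (C * K powr (1 / p))"
    "0 \<le> C * K powr (1 / p)" using C by (simp_all add: C_def K_def)
  fix f assume "f \<in> radial_Lp p a d"
  then have fm[measurable]: "f \<in> borel_measurable (Rd d)" and "radial d f" by (auto simp: radial_Lp_def)
  then obtain F where F[measurable]: "F \<in> borel_measurable borel" and fin: "\<And>s. F s < \<infinity>"
    and fF: "\<And>y. y \<in> space (Rd d) \<Longrightarrow> enorm d y \<noteq> 0 \<Longrightarrow> ennreal \<bar>f y\<bar> = F (enorm d y)"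
    using radial_profile[OF d] by metis
  let ?N = "interval_max (rad a d) F"
  have powm: "(\<lambda>x. ennpow x p) \<in> borel_measurable borel"
    unfolding ennpow_def by measurable
  have "(\<integral>\<^sup>+x. ennpow (maxop (mu a d) d f x) p \<partial>mu a d) \<le> (\<integral>\<^sup>+x. ennpow (ennreal C * ?N (enorm d x)) p \<partial>mu a d)"
  proof (rule nn_integral_mono_AE)
    show "AE x in mu a d. ennpow (maxop (mu a d) d f x) p \<le> ennpow (ennreal C * ?N (enorm d x)) p"
      using AE_mu_nonzero[of d a]
    proof eventually_elim
      case (elim x)
      then show ?case
        unfolding C_def using p by (intro ennpow_mono maxop_le_interval_max d a \<alpha> F fF) auto
    qed
  qed
  also have "\<dots> = (\<integral>\<^sup>+x. ennreal (C powr p) * ennpow (?N (enorm d x)) p \<partial>mu a d)"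
    using C p by (simp add: ennpow_mult_const)
  also have "\<dots> = (\<integral>\<^sup>+s. ennreal (C powr p) * ennpow (?N s) p \<partial>rad a d)"
    by (rule nn_integral_rad[symmetric]) (use measurable_compose[OF interval_max_measurable powm] in measurable)
  also have "\<dots> = ennreal (C powr p) * (\<integral>\<^sup>+s. ennpow (?N s) p \<partial>rad a d)"
    using measurable_compose[OF interval_max_measurable powm] by (intro nn_integral_cmult) simp
  also have "\<dots> \<le> ennreal (C powr p) * (ennreal K * (\<integral>\<^sup>+s. ennpow (F s) p \<partial>rad a d))"
    unfolding K_def by (intro mult_left_mono interval_max_strong F fin p) simp
  also have "(\<integral>\<^sup>+s. ennpow (F s) p \<partial>rad a d) = (\<integral>\<^sup>+y. ennpow (ennreal \<bar>f y\<bar>) p \<partial>mu a d)"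
  proof -
    have "AE y in mu a d. ennpow (F (enorm d y)) p = ennpow (ennreal \<bar>f y\<bar>) p"
      using AE_mu_nonzero[of d a] AE_space[of "mu a d"] by eventually_elim (simp add: fF)
    then show ?thesis
      using measurable_compose[OF F powm] by (subst nn_integral_rad) (auto intro: nn_integral_cong_AE)
  qed
  also have "ennreal (C powr p) * (ennreal K * (\<integral>\<^sup>+y. ennpow (ennreal \<bar>f y\<bar>) p \<partial>mu a d))
      = ennreal (C powr p * K) * (\<integral>\<^sup>+y. ennpow (ennreal \<bar>f y\<bar>) p \<partial>mu a d)"
    using K by (simp add: ennreal_mult' mult.assoc)
  finally have "lpnorm (mu a d) p (maxop (mu a d) d f)
     \<le> ennpow (ennreal (C powr p * K) * (\<integral>\<^sup>+y. ennpow (ennreal \<bar>f y\<bar>) p \<partial>mu a d)) (1 / p)"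
    unfolding lpnorm_def using p by (intro ennpow_mono) auto
  also have "\<dots> = ennreal ((C powr p * K) powr (1 / p)) * lpnorm (mu a d) p (\<lambda>x. ennreal \<bar>f x\<bar>)"
    unfolding lpnorm_def using C K p by (intro ennpow_mult_const) auto
  also have "(C powr p * K) powr (1 / p) = C * K powr (1 / p)"
    using C K p by (simp add: powr_mult powr_powr)
  finally show "lpnorm (mu a d) p (maxop (mu a d) d f)
     \<le> ennreal (C * K powr (1 / p)) * lpnorm (mu a d) p (\<lambda>x. ennreal \<bar>f x\<bar>)" .
qed

theorem theorem3p1:
  shows
  "(\<forall>\<alpha>::real. 1/2 < \<alpha> \<and> \<alpha> < 1 \<longrightarrow>
      (\<forall>p::real. 1 \<le> p \<longrightarrow>
        (\<exists>b::real. b > 1 \<and> (\<exists>K::real. K > 0 \<and>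
          (\<forall>d::nat. d \<ge> 1 \<longrightarrow> ennreal (K * b ^ d) \<le> weak_const p (\<alpha> * real d) d)))))
   \<and> (\<exists>K::real. K > 0 \<and>
        (\<forall>d::nat. \<forall>a::real. d \<ge> 1 \<and> a \<le> real d / 2 \<longrightarrow>
           ennreal (K * (sqrt 5 / 2) powr a) \<le> weak_const 1 a d))
   \<and> (\<forall>a::nat \<Rightarrow> real. (\<forall>d\<ge>1. a d \<le> real d / 2) \<and> limsup (\<lambda>d. ereal (a d)) = \<infinity>
        \<longrightarrow> limsup (\<lambda>d. weak_const 1 (a d) d) = \<infinity>)
   \<and> (\<forall>\<alpha>::real. \<exists>C::real.
        (\<forall>a::nat \<Rightarrow> real. (\<forall>d\<ge>1. a d \<le> \<alpha>) \<longrightarrow>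
           (\<forall>d\<ge>1. weak_const 1 (a d) d \<le> ennreal C)))
   \<and> (\<forall>\<alpha>::real. \<forall>p::real. 1 < p \<longrightarrow> (\<exists>C::real.
        (\<forall>a::nat \<Rightarrow> real. (\<forall>d\<ge>1. a d \<le> \<alpha>) \<longrightarrow>
           (\<forall>d\<ge>1. strong_const p (a d) d \<le> ennreal C))))"
proof (intro conjI allI impI)
  fix \<alpha> p :: real assume "1 / 2 < \<alpha> \<and> \<alpha> < 1" "1 \<le> p"
  then show "\<exists>b>1. \<exists>K>0. \<forall>d\<ge>1. ennreal (K * b ^ d) \<le> weak_const p (\<alpha> * real d) d"
    by (intro weak_const_exponential) auto
next
  show "\<exists>K>0. \<forall>d a. 1 \<le> d \<and> a \<le> real d / 2 \<longrightarrow> ennreal (K * (sqrt 5 / 2) powr a) \<le> weak_const 1 a d"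
    by (intro exI[of _ "1 / 64"] conjI allI impI weak_const_1_ge) auto
next
  fix a :: "nat \<Rightarrow> real"
  assume "(\<forall>d\<ge>1. a d \<le> real d / 2) \<and> limsup (\<lambda>d. ereal (a d)) = \<infinity>"
  then show "limsup (\<lambda>d. weak_const 1 (a d) d) = \<infinity>" by (intro weak_const_1_unbounded) auto
next
  fix \<alpha> :: real
  show "\<exists>C. \<forall>a. (\<forall>d\<ge>1. a d \<le> \<alpha>) \<longrightarrow> (\<forall>d\<ge>1. weak_const 1 (a d) d \<le> ennreal C)"
    \<comment> \<open>The hull estimate asks for a nonnegative upper bound, hence
      \<open>max \<alpha> 0\<close>.\<close>
    by (intro exI[of _ "2 * hull_const (max \<alpha> 0)"] allI impI weak_const_1_le) (auto simp: le_max_iff_disj)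
next
  fix \<alpha> p :: real assume "1 < p"
  then show "\<exists>C. \<forall>a. (\<forall>d\<ge>1. a d \<le> \<alpha>) \<longrightarrow> (\<forall>d\<ge>1. strong_const p (a d) d \<le> ennreal C)"
    by (intro exI[of _ "hull_const (max \<alpha> 0) * (4 * p * 2 powr (p - 1) / (p - 1)) powr (1 / p)"] allI impI strong_const_le)
      (auto simp: le_max_iff_disj)
qed

end
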